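(* Let $K$ be a virtual knot, and for a finite quandle $T$ let $QD_T(K)=|\mathrm{Hom}(U,T)|-|\mathrm{Hom}(L,T)|$, where $U$ is the upper quandle and $L$ the lower quandle of $K$. If there exists a finite quandle $T$ with $QD_T(K)\neq 0$, then $K$ is not classical. In particular, if there exists a finite quandle $T$ with $QD_T(K)\ne 0$, then $K$ is not the unknot.
   Context: A quandle is a set $Q$ with an operation $\triangleright:Q\times Q\to Q$ such that (i) $a\triangleright a=a$ for all $a$; (ii) for all $a,b\in Q$ there is a unique $c\in Q$ with $a=c\triangleright b$; (iii) $(a\triangleright b)\triangleright c=(a\triangleright c)\triangleright(b\triangleright c)$ for all $a,b,c$. Quandle homomorphisms are maps preserving $\triangleright$; $\mathrm{Hom}(Q,T)$ is the set of quandle homomorphisms $Q\to T$. A (signed, oriented, one-component) Gauss code is a finite cyclic word, possibly empty, in which each crossing label $X$ occurring in it appears exactly twice, once as an overcrossing $OX^{\varepsilon}$ and once as an undercrossing $UX^{\varepsilon}$, with the same sign $\varepsilon\in\{+,-\}$. Codes are taken up to cyclic permutation and renaming of labels. Virtual isotopy is the equivalence relation on Gauss codes generated by the Reidemeister moves: (I) insert or delete two cyclically adjacent letters $OX^{\varepsilon}UX^{\varepsilon}$ or $UX^{\varepsilon}OX^{\varepsilon}$; (II) insert or delete two crossings $X,Y$ of opposite signs $\varepsilon,-\varepsilon$ such that $OX,OY$ occupy adjacent positions and $UX,UY$ occupy adjacent positions (in either order in each pair); (III) if there are three distinct crossings $A,B,C$ such that $\{OA,OB\}$ (top strand), $\{UA,OC\}$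 (middle strand) and $\{UB,UC\}$ (bottom strand) each occupy two adjacent positions, simultaneously transpose the two letters in each of the three pairs, provided the configuration is one arising from a planar oriented Reidemeister III move. Explicitly, with $\varepsilon_A,\varepsilon_B,\varepsilon_C\in\{\pm1\}$ the crossing signs and with $\sigma_t=+1$ if $A$ precedes $B$ on the top strand, $\sigma_m=+1$ if $A$ precedes $C$ on the middle strand, $\sigma_b=+1$ if $B$ precedes $C$ on the bottom strand (and $-1$ otherwise), the requirement is $\sigma_t\sigma_m\varepsilon_A=\sigma_t\sigma_b\varepsilon_B=\sigma_m\sigma_b\varepsilon_C$. A virtual knot is an equivalence class of Gauss codes under virtual isotopy. A Gauss code is realizable if it is the Gauss code of an oriented planar knot diagram (all crossings being classical crossings recorded in the code). A virtual knot is classical if its equivalence class contains a realizable Gauss code. The unknot is the class of the empty Gauss code. Upper quandle $U$: cut the cyclic word at each undercrossing letter to obtain arcs; these are the generators (if there are no crossings there is one generator and no relation). For each crossing $X$, let $x_i$ and $x_{i+1}$ be the arcs immediately before and after $UX$, and let $y$ be the arc containing $OX$. Impose the relation $x_i\triangleright y=x_{i+1}$ if $X$ has sign $+$, and $x_{i+1}\triangleright y=x_i$ if $X$ has sign $-$. $U$ is the quandle presented in this way. Lower quandle $L$: the upper quandle of the Gauss code obtained by replacing every $OX^{\varepsilon}$ by $UX^{\varepsilon}$ and vice versa, keeping signs. Up to isomorphism $U$ and $L$ depend only on the virtual knot. *)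

theory Defs
  imports "HOL-Analysis.Analysis" "HOL-Algebra.Congruence"
begin

section \<open>Quandles\<close>

record 'a magma = "'a partial_object" +
  qop :: "'a \<Rightarrow> 'a \<Rightarrow> 'a" (infixl "\<triangleright>\<index>" 70)

definition quandle :: "'a magma \<Rightarrow> bool" where
  "quandle Q \<longleftrightarrow>
     (\<forall>a\<in>carrier Q. \<forall>b\<in>carrier Q. a \<triangleright>\<^bsub>Q\<^esub> b \<in> carrier Q) \<and>
     (\<forall>a\<in>carrier Q. a \<triangleright>\<^bsub>Q\<^esub> a = a) \<and>
     (\<forall>a\<in>carrier Q. \<forall>b\<in>carrier Q. \<exists>!c. c \<in> carrier Q \<and> a = c \<triangleright>\<^bsub>Q\<^esub> b) \<and>
     (\<forall>a\<in>carrier Q. \<forall>b\<in>carrier Q. \<forall>c\<in>carrier Q.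
        (a \<triangleright>\<^bsub>Q\<^esub> b) \<triangleright>\<^bsub>Q\<^esub> c = (a \<triangleright>\<^bsub>Q\<^esub> c) \<triangleright>\<^bsub>Q\<^esub> (b \<triangleright>\<^bsub>Q\<^esub> c))"

text \<open>Homomorphisms are extensional functions, so that their number is meaningful.\<close>

definition qhom :: "'a magma \<Rightarrow> 'b magma \<Rightarrow> ('a \<Rightarrow> 'b) set" where
  "qhom Q T = {f \<in> carrier Q \<rightarrow>\<^sub>E carrier T.
     \<forall>a\<in>carrier Q. \<forall>b\<in>carrier Q. f (a \<triangleright>\<^bsub>Q\<^esub> b) = f a \<triangleright>\<^bsub>T\<^esub> f b}"

subsection \<open>Presented quandles\<close>

text \<open>\<open>Act s t\<close> stands for $s \triangleright t$, and \<open>Inv s t\<close> for the unique \<open>c\<close> with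
  $s = c \triangleright t$.\<close>

datatype 'g qterm = Gen 'g | Act "'g qterm" "'g qterm" | Inv "'g qterm" "'g qterm"

definition qterms :: "'g set \<Rightarrow> 'g qterm set" where
  "qterms G = {t. set_qterm t \<subseteq> G}"

text \<open>The least congruence on terms over \<open>G\<close> that contains the relations \<open>R\<close> and makes the
  quotient a quandle; \<open>act_inv\<close> and \<open>inv_act\<close> together amount to axiom (ii).\<close>

inductive qcong :: "'g set \<Rightarrow> ('g qterm \<times> 'g qterm) set \<Rightarrow> 'g qterm \<Rightarrow> 'g qterm \<Rightarrow> bool"
  for G R where
  rel: "(s, t) \<in> R \<Longrightarrow> s \<in> qterms G \<Longrightarrow> t \<in> qterms G \<Longrightarrow> qcong G R s t"
| refl: "s \<in> qterms G \<Longrightarrow> qcong G R s s"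
| sym: "qcong G R s t \<Longrightarrow> qcong G R t s"
| trans: "qcong G R s t \<Longrightarrow> qcong G R t u \<Longrightarrow> qcong G R s u"
| act_cong: "qcong G R s s' \<Longrightarrow> qcong G R t t' \<Longrightarrow> qcong G R (Act s t) (Act s' t')"
| inv_cong: "qcong G R s s' \<Longrightarrow> qcong G R t t' \<Longrightarrow> qcong G R (Inv s t) (Inv s' t')"
| idem: "s \<in> qterms G \<Longrightarrow> qcong G R (Act s s) s"
| act_inv: "s \<in> qterms G \<Longrightarrow> t \<in> qterms G \<Longrightarrow> qcong G R (Act (Inv s t) t) s"
| inv_act: "s \<in> qterms G \<Longrightarrow> t \<in> qterms G \<Longrightarrow> qcong G R (Inv (Act s t) t) s"
| distrib: "s \<in> qterms G \<Longrightarrow> t \<in> qterms G \<Longrightarrow> u \<in> qterms G \<Longrightarrow>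
    qcong G R (Act (Act s t) u) (Act (Act s u) (Act t u))"

definition presented_quandle ::
    "'g set \<Rightarrow> ('g qterm \<times> 'g qterm) set \<Rightarrow> 'g qterm set magma" where
  "presented_quandle G R =
     \<lparr>carrier = qterms G // {(s, t). qcong G R s t},
      qop = (\<lambda>a b. {u. \<exists>s\<in>a. \<exists>t\<in>b. qcong G R (Act s t) u})\<rparr>"

section \<open>Gauss codes and virtual knots\<close>

text \<open>The second argument of a letter is the sign, \<open>1\<close> or \<open>-1\<close>.\<close>

datatype 'x letter =
    is_over: Over (crossing: 'x) (eps: int)
  | is_under: Under (crossing: 'x) (eps: int)

text \<open>Cyclic words are represented by lists; cyclic permutations and renamings of labels are
  among the steps that generate virtual isotopy.\<close>

type_synonym code = "nat letter list"

definition gauss_code :: "code \<Rightarrow> bool" where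
  "gauss_code w \<longleftrightarrow> (\<forall>X \<in> crossing ` set w. \<exists>\<epsilon>\<in>{1, -1}.
     mset (filter (\<lambda>l. crossing l = X) w) = {#Over X \<epsilon>, Under X \<epsilon>#})"

definition arrange :: "int \<Rightarrow> 'b \<Rightarrow> 'b \<Rightarrow> 'b list" where
  "arrange \<sigma> x y = (if \<sigma> = 1 then [x, y] else [y, x])"

text \<open>Because cyclic permutation is available as a step, each Reidemeister move may be stated
  with its first pair of letters at the front of the list. In moves II and III the pairs may
  occur in any cyclic order; this is covered by the rotations and, for III, by two rules.\<close>

inductive code_step :: "code \<Rightarrow> code \<Rightarrow> bool" where
  rotate: "code_step w (rotate n w)"
| rename: "inj_on f (crossing ` set w) \<Longrightarrow> code_step w (map (map_letter f) w)"
| R1_over: "code_step ([Over X \<epsilon>, Under X \<epsilon>] @ w) w"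
| R1_under: "code_step ([Under X \<epsilon>, Over X \<epsilon>] @ w) w"
| R2: "X \<noteq> Y \<Longrightarrow> mset a = {#Over X \<epsilon>, Over Y (- \<epsilon>)#} \<Longrightarrow> mset b = {#Under X \<epsilon>, Under Y (- \<epsilon>)#} \<Longrightarrow>
    code_step (a @ u @ b @ v) (u @ v)"
| R3_tmb: "distinct [A, B, C] \<Longrightarrow> {\<sigma>t, \<sigma>m, \<sigma>b} \<subseteq> {1, -1} \<Longrightarrow>
    \<sigma>t * \<sigma>m * \<epsilon>A = \<sigma>t * \<sigma>b * \<epsilon>B \<Longrightarrow> \<sigma>t * \<sigma>b * \<epsilon>B = \<sigma>m * \<sigma>b * \<epsilon>C \<Longrightarrow>
    t = arrange \<sigma>t (Over A \<epsilon>A) (Over B \<epsilon>B) \<Longrightarrow>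
    m = arrange \<sigma>m (Under A \<epsilon>A) (Over C \<epsilon>C) \<Longrightarrow>
    b = arrange \<sigma>b (Under B \<epsilon>B) (Under C \<epsilon>C) \<Longrightarrow>
    code_step (t @ u @ m @ v @ b @ w) (rev t @ u @ rev m @ v @ rev b @ w)"
| R3_tbm: "distinct [A, B, C] \<Longrightarrow> {\<sigma>t, \<sigma>m, \<sigma>b} \<subseteq> {1, -1} \<Longrightarrow>
    \<sigma>t * \<sigma>m * \<epsilon>A = \<sigma>t * \<sigma>b * \<epsilon>B \<Longrightarrow> \<sigma>t * \<sigma>b * \<epsilon>B = \<sigma>m * \<sigma>b * \<epsilon>C \<Longrightarrow>
    t = arrange \<sigma>t (Over A \<epsilon>A) (Over B \<epsilon>B) \<Longrightarrow>
    m = arrange \<sigma>m (Under A \<epsilon>A) (Over C \<epsilon>C) \<Longrightarrow>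
    b = arrange \<sigma>b (Under B \<epsilon>B) (Under C \<epsilon>C) \<Longrightarrow>
    code_step (t @ u @ b @ v @ m @ w) (rev t @ u @ rev b @ v @ rev m @ w)"

definition virtual_isotopy :: "(code \<times> code) set" where
  "virtual_isotopy = {(w, w'). gauss_code w \<and> gauss_code w' \<and>
     equivclp (\<lambda>x y. gauss_code x \<and> gauss_code y \<and> code_step x y) w w'}"

definition virtual_knots :: "code set set" where
  "virtual_knots = {w. gauss_code w} // virtual_isotopy"

definition unknot :: "code set" where
  "unknot = virtual_isotopy `` {[]}"

section \<open>Planar knot diagrams\<close>

text \<open>The plane is the complex plane. An oriented knot diagram is a closed oriented polygon
  in general position together with a choice of the over-strand at each double point.\<close>

definition vertex :: "complex list \<Rightarrow> nat \<Rightarrow> complex" where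
  "vertex p i = p ! (i mod length p)"

definition edge :: "complex list \<Rightarrow> nat \<Rightarrow> complex set" where
  "edge p i = closed_segment (vertex p i) (vertex p (Suc i))"

text \<open>No vertex lies on an edge other than its own two, and no point lies on three edges.
  Consequently the vertices are distinct, consecutive edges meet only in their common vertex,
  and two other edges meet in at most one point, where they cross transversely.\<close>

definition regular_polygon :: "complex list \<Rightarrow> bool" where
  "regular_polygon p \<longleftrightarrow> 3 \<le> length p \<and>
     (\<forall>i<length p. \<forall>j<length p. vertex p i \<in> edge p j \<longrightarrow> i = j \<or> i = Suc j mod length p) \<and>
     (\<forall>i<length p. \<forall>j<length p. \<forall>k<length p.
        distinct [i, j, k] \<longrightarrow> edge p i \<inter> edge p j \<inter> edge p k = {})"

text \<open>Each double point is recorded by two pairs, \<open>(i, j)\<close> and \<open>(j, i)\<close>; the pair \<open>(i, j)\<close>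
  represents the passage through it along edge \<open>i\<close>.\<close>

definition passages :: "complex list \<Rightarrow> (nat \<times> nat) set" where
  "passages p = {(i, j). i < length p \<and> j < length p \<and> i \<noteq> j \<and>
     j \<noteq> Suc i mod length p \<and> i \<noteq> Suc j mod length p \<and> edge p i \<inter> edge p j \<noteq> {}}"

definition double_point :: "complex list \<Rightarrow> nat \<times> nat \<Rightarrow> complex" where
  "double_point p = (\<lambda>(i, j). THE z. z \<in> edge p i \<inter> edge p j)"

text \<open>\<open>ov i j\<close> means that edge \<open>i\<close> is the over-strand where it crosses edge \<open>j\<close>.\<close>

definition knot_diagram :: "complex list \<Rightarrow> (nat \<Rightarrow> nat \<Rightarrow> bool) \<Rightarrow> bool" where
  "knot_diagram p ov \<longleftrightarrow> regular_polygon p \<and> (\<forall>(i, j)\<in>passages p. ov i j \<longleftrightarrow> \<not> ov j i)"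

definition precedes :: "complex list \<Rightarrow> nat \<times> nat \<Rightarrow> nat \<times> nat \<Rightarrow> bool" where
  "precedes p a b \<longleftrightarrow> fst a < fst b \<or>
     (fst a = fst b \<and>
      dist (vertex p (fst a)) (double_point p a) < dist (vertex p (fst a)) (double_point p b))"

text \<open>A crossing is positive if the direction of the under-strand \<open>j\<close> is obtained from that of
  the over-strand \<open>i\<close> by a counterclockwise rotation through less than half a turn.\<close>

definition crossing_sign :: "complex list \<Rightarrow> nat \<Rightarrow> nat \<Rightarrow> int" where
  "crossing_sign p i j =
     (let u = vertex p (Suc i) - vertex p i; v = vertex p (Suc j) - vertex p j
      in if Re u * Im v - Im u * Re v > 0 then 1 else -1)"

definition passage_letter ::
    "complex list \<Rightarrow> (nat \<Rightarrow> nat \<Rightarrow> bool) \<Rightarrow> (nat set \<Rightarrow> nat) \<Rightarrow> nat \<times> nat \<Rightarrow> nat letter" where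
  "passage_letter p ov lab = (\<lambda>(i, j).
     if ov i j then Over (lab {i, j}) (crossing_sign p i j)
     else Under (lab {i, j}) (crossing_sign p j i))"

definition diagram_code :: "complex list \<Rightarrow> (nat \<Rightarrow> nat \<Rightarrow> bool) \<Rightarrow> code \<Rightarrow> bool" where
  "diagram_code p ov w \<longleftrightarrow> (\<exists>ps lab n.
     set ps = passages p \<and> sorted_wrt (precedes p) ps \<and>
     inj_on lab ((\<lambda>(i, j). {i, j}) ` passages p) \<and>
     w = rotate n (map (passage_letter p ov lab) ps))"

definition realizable :: "code \<Rightarrow> bool" where
  "realizable w \<longleftrightarrow> (\<exists>p ov. knot_diagram p ov \<and> diagram_code p ov w)"

definition classical :: "code set \<Rightarrow> bool" where
  "classical K \<longleftrightarrow> (\<exists>w\<in>K. realizable w)"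

section \<open>Upper and lower quandles\<close>

text \<open>Arcs are numbered cyclically from \<open>0\<close>, arc \<open>0\<close> being the one that contains the base
  point of the list; \<open>arc_at w i\<close> is the arc on which the position just before the letter
  \<open>w ! i\<close> lies. If there are no undercrossings, then \<open>mod 0\<close> is harmless: the only arc is \<open>0\<close>.\<close>

definition num_under :: "code \<Rightarrow> nat" where
  "num_under w = length (filter is_under w)"

definition arc_at :: "code \<Rightarrow> nat \<Rightarrow> nat" where
  "arc_at w i = num_under (take i w) mod num_under w"

definition arcs :: "code \<Rightarrow> nat set" where
  "arcs w = {..<max 1 (num_under w)}"

definition crossing_relations :: "code \<Rightarrow> (nat qterm \<times> nat qterm) set" where
  "crossing_relations w =
     {(Act (Gen (arc_at w i)) (Gen (arc_at w j)), Gen (arc_at w (Suc i))) | i j X.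
        i < length w \<and> j < length w \<and> w ! i = Under X 1 \<and> w ! j = Over X 1} \<union>
     {(Act (Gen (arc_at w (Suc i))) (Gen (arc_at w j)), Gen (arc_at w i)) | i j X.
        i < length w \<and> j < length w \<and> w ! i = Under X (-1) \<and> w ! j = Over X (-1)}"

definition upper_quandle :: "code \<Rightarrow> nat qterm set magma" where
  "upper_quandle w = presented_quandle (arcs w) (crossing_relations w)"

fun swap_letter :: "'x letter \<Rightarrow> 'x letter" where
  "swap_letter (Over X \<epsilon>) = Under X \<epsilon>"
| "swap_letter (Under X \<epsilon>) = Over X \<epsilon>"

definition lower_quandle :: "code \<Rightarrow> nat qterm set magma" where
  "lower_quandle w = upper_quandle (map swap_letter w)"

definition QD :: "'a magma \<Rightarrow> code \<Rightarrow> int" where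
  "QD T w = int (card (qhom (upper_quandle w) T)) - int (card (qhom (lower_quandle w) T))"

end

theory Submission
  imports Defs
begin

text \<open>A colouring of a diagram by \<open>T\<close> is a homomorphism from the upper quandle to \<open>T\<close>, and
  colourings can be carried along Reidemeister moves. For a planar diagram an upper colouring
  extends to the regions of the plane: to each region one assigns an automorphism of \<open>T\<close>, in such
  a way that crossing a strand of colour \<open>x\<close> from left to right changes it by the right
  translation by \<open>x\<close>. This is consistent around every vertex and every crossing, by
  self-distributivity, and hence exists globally because the plane is simply connected. If \<open>g\<close> is
  the automorphism of a region next to a semi-arc of colour \<open>x\<close>, then \<open>g x\<close> depends only on the
  semi-arc, as the translation by \<open>x\<close> fixes \<open>x\<close>, and these elements form a lower colouring.
  The upper colouring can be recovered from it, because in terms of \<open>y = g x\<close> the rule for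
  crossing a strand is to compose \<open>g\<close> from the other side with the translation by \<open>y\<close>. So there
  are at least as many lower as upper colourings, and reflecting the diagram and exchanging over
  and under gives the converse inequality.\<close>

section \<open>Right translations and automorphisms\<close>

text \<open>Regions are never formed as objects. A region colouring is a function \<open>g\<close>
  on the points off the diagram \<open>D\<close>. At a point of an edge it is recorded by a single
  automorphism, its germ: this is the value of \<open>g\<close> on the left of the edge, and the
  value on the right is the germ composed on its right with a translation. No condition is imposed
  at the finite set \<open>F\<close> of vertices and crossings, whose removal does not disconnect a
  connected open subset of the plane. Since translations enter from the right, two region colourings
  differ by a constant left factor. This allows local solutions to be glued along connected
  overlaps, and simple connectivity enters only through rectangles, whose intersections are again
  rectangles. Prescribing the value \<open>id\<close> at one base point removes the left factor and
  makes the passage from upper to lower colourings injective. An injection in each direction is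
  enough for counting, so the inverse map is never constructed; finiteness of \<open>T\<close>
  enters there.\<close>

definition rmul :: "'a magma \<Rightarrow> 'a \<Rightarrow> 'a \<Rightarrow> 'a" where
  "rmul T b = (\<lambda>a. if a \<in> carrier T then a \<triangleright>\<^bsub>T\<^esub> b else a)"

definition act :: "'a magma \<Rightarrow> int \<Rightarrow> 'a \<Rightarrow> 'a \<Rightarrow> 'a" where
  "act T \<epsilon> a b = (if \<epsilon> = 1 then rmul T b a else inv (rmul T b) a)"

text \<open>The maps act on the whole type, and \<open>rmul\<close> is the identity outside the
  carrier, so the group operations are plain \<open>\<circ>\<close>, \<open>inv\<close> and
  \<open>id\<close> without any restriction.\<close>

definition qaut :: "'a magma \<Rightarrow> ('a \<Rightarrow> 'a) set" where
  "qaut T = {f. bij f \<and> f ` carrier T = carrier T \<and>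
     (\<forall>a\<in>carrier T. \<forall>b\<in>carrier T. f (a \<triangleright>\<^bsub>T\<^esub> b) = f a \<triangleright>\<^bsub>T\<^esub> f b)}"

lemma qaut_bij: "f \<in> qaut T \<Longrightarrow> bij f"
  by (simp add: qaut_def)

lemma qaut_carrier_iff: "f \<in> qaut T \<Longrightarrow> f a \<in> carrier T \<longleftrightarrow> a \<in> carrier T"
  unfolding qaut_def by (auto simp: bij_def inj_image_mem_iff) (metis inj_image_mem_iff)

lemma qaut_hom:
  "f \<in> qaut T \<Longrightarrow> a \<in> carrier T \<Longrightarrow> b \<in> carrier T \<Longrightarrow> f (a \<triangleright>\<^bsub>T\<^esub> b) = f a \<triangleright>\<^bsub>T\<^esub> f b"
  by (simp add: qaut_def)

lemma id_in_qaut: "id \<in> qaut T"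
  by (simp add: qaut_def)

lemma comp_in_qaut: "f \<in> qaut T \<Longrightarrow> g \<in> qaut T \<Longrightarrow> f \<circ> g \<in> qaut T"
proof -
  assume f: "f \<in> qaut T" and g: "g \<in> qaut T"
  have "(f \<circ> g) ` carrier T = carrier T"
    unfolding image_comp[symmetric] using f g by (simp add: qaut_def)
  then show ?thesis
    using f g qaut_carrier_iff[OF g] by (auto simp: qaut_def bij_comp)
qed

text \<open>An automorphism conjugates the translation by \<open>b\<close> into the translation by
  \<open>f b\<close>. Consistency at crossings, the lower crossing rule and the recovery of the
  upper colouring all rest on this identity.\<close>

lemma qaut_rmul_comm: "f \<in> qaut T \<Longrightarrow> b \<in> carrier T \<Longrightarrow> f \<circ> rmul T b = rmul T (f b) \<circ> f"
  by (auto simp: fun_eq_iff rmul_def qaut_hom qaut_carrier_iff)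

lemma qaut_rmul: "f \<in> qaut T \<Longrightarrow> b \<in> carrier T \<Longrightarrow> f (rmul T b a) = rmul T (f b) (f a)"
  using qaut_rmul_comm[of f T b] by (simp add: fun_eq_iff)

locale quandle_loc =
  fixes T :: "'a magma"
  assumes quandle: "quandle T"
begin

lemma closed: "a \<in> carrier T \<Longrightarrow> b \<in> carrier T \<Longrightarrow> a \<triangleright>\<^bsub>T\<^esub> b \<in> carrier T"
  and idem: "a \<in> carrier T \<Longrightarrow> a \<triangleright>\<^bsub>T\<^esub> a = a"
  and ex1: "a \<in> carrier T \<Longrightarrow> b \<in> carrier T \<Longrightarrow> \<exists>!c. c \<in> carrier T \<and> a = c \<triangleright>\<^bsub>T\<^esub> b"
  and distrib: "a \<in> carrier T \<Longrightarrow> b \<in> carrier T \<Longrightarrow> c \<in> carrier T \<Longrightarrow>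
    (a \<triangleright>\<^bsub>T\<^esub> b) \<triangleright>\<^bsub>T\<^esub> c = (a \<triangleright>\<^bsub>T\<^esub> c) \<triangleright>\<^bsub>T\<^esub> (b \<triangleright>\<^bsub>T\<^esub> c)"
  by (fact bspec[OF bspec[OF conjunct1[OF quandle[unfolded quandle_def]]]],
      fact bspec[OF conjunct1[OF conjunct2[OF quandle[unfolded quandle_def]]]],
      fact bspec[OF bspec[OF conjunct1[OF conjunct2[OF conjunct2[OF quandle[unfolded quandle_def]]]]]],
      fact bspec[OF bspec[OF bspec[OF
        conjunct2[OF conjunct2[OF conjunct2[OF quandle[unfolded quandle_def]]]]]]])

lemma rmul_in: "a \<in> carrier T \<Longrightarrow> b \<in> carrier T \<Longrightarrow> rmul T b a \<in> carrier T"
  by (simp add: rmul_def closed)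

lemma rmul_eq: "a \<in> carrier T \<Longrightarrow> rmul T b a = a \<triangleright>\<^bsub>T\<^esub> b"
  by (simp add: rmul_def)

lemma rmul_idem: "rmul T a a = a"
  by (simp add: rmul_def idem)

lemma rmul_bij:
  assumes b: "b \<in> carrier T" shows "bij (rmul T b)"
proof (rule bijI)
  show "inj (rmul T b)"
  proof (rule injI)
    fix x y assume e: "rmul T b x = rmul T b y"
    have *: "rmul T b z \<in> carrier T \<longleftrightarrow> z \<in> carrier T" for z
      using rmul_in[OF _ b] by (auto simp: rmul_def)
    have xy: "x \<in> carrier T \<longleftrightarrow> y \<in> carrier T"
      using *[of x] *[of y] unfolding e by blast
    show "x = y"
    proof (cases "x \<in> carrier T")
      case True
      then have "x \<triangleright>\<^bsub>T\<^esub> b = y \<triangleright>\<^bsub>T\<^esub> b" using e xy by (simp add: rmul_def)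
      then show ?thesis using ex1[OF closed[OF True b] b] True xy by blast
    qed (use e xy in \<open>simp add: rmul_def\<close>)
  qed
  show "surj (rmul T b)"
    unfolding surj_def
  proof
    fix y
    show "\<exists>x. y = rmul T b x"
    proof (cases "y \<in> carrier T")
      case True
      then obtain c where "c \<in> carrier T" "y = c \<triangleright>\<^bsub>T\<^esub> b" using ex1[OF _ b] by blast
      then show ?thesis by (auto simp: rmul_def intro!: exI[of _ c])
    qed (auto simp: rmul_def intro!: exI[of _ y])
  qed
qed

lemma rmul_in_qaut: "b \<in> carrier T \<Longrightarrow> rmul T b \<in> qaut T"
  unfolding qaut_def
proof safe
  assume b: "b \<in> carrier T"
  show "bij (rmul T b)" by (rule rmul_bij[OF b])
  show "rmul T b x \<in> carrier T" if "x \<in> carrier T" for x using rmul_in that b by blast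
  show "x \<in> rmul T b ` carrier T" if "x \<in> carrier T" for x
  proof -
    have "\<exists>c. c \<in> carrier T \<and> x = c \<triangleright>\<^bsub>T\<^esub> b" using ex1[OF that b] by blast
    then obtain c where "c \<in> carrier T" "x = c \<triangleright>\<^bsub>T\<^esub> b" by blast
    then show ?thesis by (intro image_eqI[of _ _ c]) (simp_all add: rmul_def)
  qed
  show "rmul T b (x \<triangleright>\<^bsub>T\<^esub> y) = rmul T b x \<triangleright>\<^bsub>T\<^esub> rmul T b y"
    if "x \<in> carrier T" "y \<in> carrier T" for x y
    using closed[OF that] that distrib[OF that b] by (simp add: rmul_def closed[OF _ b])
qed

lemma inv_in_qaut:
  assumes f: "f \<in> qaut T" shows "inv f \<in> qaut T"
proof -
  have b: "bij f" and im: "f ` carrier T = carrier T" using f by (auto simp: qaut_def)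
  have im': "inv f ` carrier T = carrier T"
    using im b by (metis bij_def image_inv_f_f)
  have "inv f (x \<triangleright>\<^bsub>T\<^esub> y) = inv f x \<triangleright>\<^bsub>T\<^esub> inv f y" if x: "x \<in> carrier T" and y: "y \<in> carrier T" for x y
  proof -
    have c: "inv f x \<in> carrier T" "inv f y \<in> carrier T" using x y im' by auto
    have "f (inv f x \<triangleright>\<^bsub>T\<^esub> inv f y) = x \<triangleright>\<^bsub>T\<^esub> y"
      using qaut_hom[OF f c] b by (simp add: bij_def surj_f_inv_f)
    then show ?thesis using b by (metis bij_def inv_f_f)
  qed
  then show ?thesis using b im' by (simp add: qaut_def bij_imp_bij_inv)
qed

lemma act_in_qaut: "b \<in> carrier T \<Longrightarrow> (\<lambda>a. act T \<epsilon> a b) \<in> qaut T"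
  using rmul_in_qaut[of b] inv_in_qaut[OF rmul_in_qaut[of b]]
  by (cases "\<epsilon> = 1") (simp_all add: act_def)

lemma act_in: "a \<in> carrier T \<Longrightarrow> b \<in> carrier T \<Longrightarrow> act T \<epsilon> a b \<in> carrier T"
  using qaut_carrier_iff[OF act_in_qaut, of b] by simp

lemma inv_rmul_eq_iff: "b \<in> carrier T \<Longrightarrow> inv (rmul T b) a = c \<longleftrightarrow> rmul T b c = a"
  using rmul_bij[of b] by (metis bij_def inv_f_f surj_f_inv_f)

lemma rmul_inv_rmul: "b \<in> carrier T \<Longrightarrow> rmul T b (inv (rmul T b) a) = a"
  using rmul_bij[of b] by (simp add: bij_def surj_f_inv_f)

lemma inv_rmul_rmul: "b \<in> carrier T \<Longrightarrow> inv (rmul T b) (rmul T b a) = a"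
  using rmul_bij[of b] by (simp add: bij_def inv_f_f)

lemma qaut_act:
  assumes f: "f \<in> qaut T" and b: "b \<in> carrier T"
  shows "f (act T \<epsilon> a b) = act T \<epsilon> (f a) (f b)"
proof (cases "\<epsilon> = 1")
  case False
  have fb: "f b \<in> carrier T" by (simp add: qaut_carrier_iff[OF f] b)
  have "rmul T (f b) (f (inv (rmul T b) a)) = f a"
    by (simp add: qaut_rmul[OF f b, symmetric] rmul_inv_rmul[OF b])
  then have "inv (rmul T (f b)) (f a) = f (inv (rmul T b) a)"
    by (simp add: inv_rmul_eq_iff[OF fb])
  then show ?thesis using False by (simp add: act_def)
qed (simp add: act_def qaut_rmul[OF f b])

text \<open>Translations and their inverses are automorphisms, so self-distributivity holds for
  every combination of signs.\<close>

lemma act_distrib: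
  "b \<in> carrier T \<Longrightarrow> c \<in> carrier T \<Longrightarrow>
    act T \<epsilon>' (act T \<epsilon> a b) c = act T \<epsilon> (act T \<epsilon>' a c) (act T \<epsilon>' b c)"
  by (rule qaut_act[OF act_in_qaut])

lemma act_idem: "a \<in> carrier T \<Longrightarrow> act T \<epsilon> a a = a"
  by (simp add: act_def rmul_idem inv_rmul_eq_iff)

lemma act_uminus_act:
  "b \<in> carrier T \<Longrightarrow> \<epsilon> \<in> {1, -1} \<Longrightarrow> act T (- \<epsilon>) (act T \<epsilon> a b) b = a"
  by (auto simp: act_def rmul_inv_rmul inv_rmul_rmul)

end

section \<open>Homomorphisms from presented quandles\<close>

primrec qeval :: "'a magma \<Rightarrow> ('g \<Rightarrow> 'a) \<Rightarrow> 'g qterm \<Rightarrow> 'a" where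
  "qeval T c (Gen x) = c x"
| "qeval T c (Act s t) = rmul T (qeval T c t) (qeval T c s)"
| "qeval T c (Inv s t) = inv (rmul T (qeval T c t)) (qeval T c s)"

text \<open>Relations with a term that is not over \<open>G\<close> impose nothing, in agreement
  with rule \<open>rel\<close> of \<open>qcong\<close>.\<close>

definition respecting ::
    "'g set \<Rightarrow> ('g qterm \<times> 'g qterm) set \<Rightarrow> 'a magma \<Rightarrow> ('g \<Rightarrow> 'a) set" where
  "respecting G R T = {c \<in> G \<rightarrow>\<^sub>E carrier T.
     \<forall>(s, t)\<in>R. s \<in> qterms G \<longrightarrow> t \<in> qterms G \<longrightarrow> qeval T c s = qeval T c t}"

lemma qterms_simps [simp]:
  "Gen x \<in> qterms G \<longleftrightarrow> x \<in> G"
  "Act s t \<in> qterms G \<longleftrightarrow> s \<in> qterms G \<and> t \<in> qterms G"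
  "Inv s t \<in> qterms G \<longleftrightarrow> s \<in> qterms G \<and> t \<in> qterms G"
  by (auto simp: qterms_def)

definition qclass :: "'g set \<Rightarrow> ('g qterm \<times> 'g qterm) set \<Rightarrow> 'g qterm \<Rightarrow> 'g qterm set" where
  "qclass G R t = {u. qcong G R t u}"

lemma carrier_presented: "carrier (presented_quandle G R) = qclass G R ` qterms G"
  by (auto simp: presented_quandle_def quotient_def qclass_def)

lemma qclass_in_carrier: "t \<in> qterms G \<Longrightarrow> qclass G R t \<in> carrier (presented_quandle G R)"
  by (simp add: carrier_presented)

lemma qclass_eq: "qcong G R s t \<Longrightarrow> qclass G R s = qclass G R t"
  unfolding qclass_def by (blast intro: qcong.trans qcong.sym)

lemma qclass_op:
  assumes "s \<in> qterms G" "t \<in> qterms G"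
  shows "qclass G R s \<triangleright>\<^bsub>presented_quandle G R\<^esub> qclass G R t = qclass G R (Act s t)"
proof -
  have "qcong G R (Act s t) u" if "qcong G R s s'" "qcong G R t t'" "qcong G R (Act s' t') u" for s' t' u
    using that by (meson qcong.act_cong qcong.trans)
  moreover have "qcong G R s s" "qcong G R t t" using assms by (auto intro: qcong.refl)
  ultimately show ?thesis by (auto simp: presented_quandle_def qclass_def)
qed

context quandle_loc begin

lemma qeval_in:
  "c \<in> G \<rightarrow> carrier T \<Longrightarrow> t \<in> qterms G \<Longrightarrow> qeval T c t \<in> carrier T"
proof (induction t)
  case (Inv s t)
  then show ?case using qaut_carrier_iff[OF inv_in_qaut[OF rmul_in_qaut]] by auto
qed (auto simp: rmul_in)

lemma qeval_qcong:
  assumes c: "c \<in> respecting G R T"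
  shows "qcong G R s t \<Longrightarrow> qeval T c s = qeval T c t"
proof (induction rule: qcong.induct)
  case (rel s t)
  then show ?case using c by (auto simp: respecting_def)
next
  case (distrib s t u)
  have "c \<in> G \<rightarrow> carrier T" using c by (auto simp: respecting_def)
  then have "qeval T c s \<in> carrier T" "qeval T c t \<in> carrier T" "qeval T c u \<in> carrier T"
    using distrib qeval_in by blast+
  then show ?case using qaut_rmul[OF rmul_in_qaut] by auto
next
  case (act_inv s t)
  then show ?case using c qeval_in[of c G t] rmul_inv_rmul by (auto simp: respecting_def)
next
  case (inv_act s t)
  then show ?case using c qeval_in[of c G t] inv_rmul_rmul by (auto simp: respecting_def)
qed (simp_all add: rmul_idem)

lemma qhom_qclass:
  assumes f: "f \<in> qhom (presented_quandle G R) T" and t: "t \<in> qterms G"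
  shows "f (qclass G R t) = qeval T (\<lambda>x. f (qclass G R (Gen x))) t"
  using t
proof (induction t)
  let ?P = "presented_quandle G R"
  have fin: "f (qclass G R s) \<in> carrier T" if "s \<in> qterms G" for s
    using f qclass_in_carrier[OF that] by (auto simp: qhom_def)
  have hom: "f (qclass G R (Act s t)) = rmul T (f (qclass G R t)) (f (qclass G R s))"
    if s: "s \<in> qterms G" and t: "t \<in> qterms G" for s t
  proof -
    have "f (qclass G R s \<triangleright>\<^bsub>?P\<^esub> qclass G R t) = f (qclass G R s) \<triangleright>\<^bsub>T\<^esub> f (qclass G R t)"
      using f qclass_in_carrier[OF s, of R] qclass_in_carrier[OF t, of R]
      unfolding qhom_def by blast
    then show ?thesis by (simp add: qclass_op[OF s t] rmul_eq[OF fin[OF s]])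
  qed
  {
    case (Gen x)
    then show ?case by simp
  next
    case (Act s t)
    then show ?case using hom[of s t] by simp
  next
    case (Inv s t)
    have st: "s \<in> qterms G" "t \<in> qterms G" using Inv.prems by auto
    \<comment> \<open>A homomorphism is only assumed to respect \<open>Act\<close>. Its value at
      \<open>Inv s t\<close> is forced, since acting by \<open>t\<close> gives back the class of
      \<open>s\<close> and translations are injective.\<close>
    have "qclass G R (Act (Inv s t) t) = qclass G R s"
      by (rule qclass_eq) (use st qcong.act_inv in auto)
    then have "rmul T (f (qclass G R t)) (f (qclass G R (Inv s t))) = f (qclass G R s)"
      using hom[of "Inv s t" t] st by simp
    then have "f (qclass G R (Inv s t)) = inv (rmul T (f (qclass G R t))) (f (qclass G R s))"
      using inv_rmul_eq_iff[OF fin[OF st(2)]] by metis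
    then show ?case using Inv.IH st by simp
  }
qed

text \<open>Universal property of a presentation: a homomorphism is determined by its values on the
  generators, and an assignment respecting the relations extends by evaluating an arbitrary
  representative of each class.\<close>

lemma card_qhom_presented: "card (qhom (presented_quandle G R) T) = card (respecting G R T)"
proof -
  let ?P = "presented_quandle G R"
  let ?F = "\<lambda>f. \<lambda>x\<in>G. f (qclass G R (Gen x))"
  have carr: "A \<in> carrier ?P \<longleftrightarrow> (\<exists>t\<in>qterms G. A = qclass G R t)" for A
    by (auto simp: carrier_presented)
  have ev: "qeval T (?F f) t = f (qclass G R t)"
    if "f \<in> qhom ?P T" "t \<in> qterms G" for f t
  proof -
    have "qeval T (?F f) t = qeval T (\<lambda>x. f (qclass G R (Gen x))) t"
      using that(2) by (induction t) auto
    then show ?thesis using qhom_qclass[OF that] by simp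
  qed
  have "bij_betw ?F (qhom ?P T) (respecting G R T)"
    unfolding bij_betw_def
  proof
    show "inj_on ?F (qhom ?P T)"
    proof (rule inj_onI)
      fix f g assume f: "f \<in> qhom ?P T" and g: "g \<in> qhom ?P T" and e: "?F f = ?F g"
      show "f = g"
      proof
        fix A show "f A = g A"
        proof (cases "A \<in> carrier ?P")
          case True
          then obtain t where "t \<in> qterms G" "A = qclass G R t" using carr by blast
          then show ?thesis using ev[OF f, of t] ev[OF g, of t] e by simp
        next
          case False
          then show ?thesis using f g by (auto simp: qhom_def PiE_def extensional_def)
        qed
      qed
    qed
    show "?F ` qhom ?P T = respecting G R T"
    proof (intro equalityI subsetI)
      fix c assume "c \<in> ?F ` qhom ?P T"
      then obtain f where f: "f \<in> qhom ?P T" and c: "c = ?F f" by blast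
      have "qeval T c s = qeval T c t" if "(s, t) \<in> R" "s \<in> qterms G" "t \<in> qterms G" for s t
        unfolding c ev[OF f that(2)] ev[OF f that(3)]
        using qclass_eq[OF qcong.rel[OF that]] by simp
      moreover have "f (qclass G R (Gen x)) \<in> carrier T" if "x \<in> G" for x
        using f qclass_in_carrier[of "Gen x" G R] that by (auto simp: qhom_def)
      ultimately show "c \<in> respecting G R T" using c by (auto simp: respecting_def)
    next
      fix c assume c: "c \<in> respecting G R T"
      define f where "f = (\<lambda>A\<in>carrier ?P. qeval T c (SOME t. t \<in> A))"
      have fc: "f (qclass G R t) = qeval T c t" if t: "t \<in> qterms G" for t
      proof -
        have "(SOME u. u \<in> qclass G R t) \<in> qclass G R t"
          by (rule someI[of _ t]) (use t qcong.refl in \<open>auto simp: qclass_def\<close>)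
        then have "qcong G R t (SOME u. u \<in> qclass G R t)" by (simp add: qclass_def)
        then show ?thesis using qeval_qcong[OF c] qclass_in_carrier[OF t, of R]
          unfolding f_def by simp
      qed
      have cP: "c \<in> G \<rightarrow> carrier T" using c by (auto simp: respecting_def)
      have "f \<in> qhom ?P T"
        unfolding qhom_def
      proof (safe intro!: PiE_I)
        fix A assume "A \<in> carrier ?P"
        then show "f A \<in> carrier T" unfolding carr using fc qeval_in[OF cP] by auto
      next
        fix A assume "A \<notin> carrier ?P"
        then show "f A = undefined" by (simp add: f_def)
      next
        fix A B assume "A \<in> carrier ?P" "B \<in> carrier ?P"
        then obtain s t where st: "s \<in> qterms G" "t \<in> qterms G" "A = qclass G R s" "B = qclass G R t"
          unfolding carr by blast
        show "f (A \<triangleright>\<^bsub>?P\<^esub> B) = f A \<triangleright>\<^bsub>T\<^esub> f B"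
          unfolding st(3,4) qclass_op[OF st(1,2)]
          using fc[of "Act s t"] fc[of s] fc[of t] st rmul_eq[OF qeval_in[OF cP st(1)]] by simp
      qed
      moreover have "c = ?F f"
      proof
        fix x show "c x = ?F f x"
          using fc[of "Gen x"] c by (cases "x \<in> G") (auto simp: respecting_def PiE_def extensional_def)
      qed
      ultimately show "c \<in> ?F ` qhom ?P T" by blast
    qed
  qed
  then show ?thesis by (rule bij_betw_same_card)
qed

end

section \<open>Colourings of Gauss codes\<close>

text \<open>A colouring is given by the colour \<open>a\<close> at the base point and the colours \<open>f X\<close> of the
  over-strands; all other colours are found by walking along the code.\<close>

fun walk :: "'a magma \<Rightarrow> (nat \<Rightarrow> 'a) \<Rightarrow> code \<Rightarrow> 'a \<Rightarrow> 'a \<Rightarrow> bool" where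
  "walk T f [] a b \<longleftrightarrow> a = b"
| "walk T f (Over X \<epsilon> # w) a b \<longleftrightarrow> a = f X \<and> walk T f w a b"
| "walk T f (Under X \<epsilon> # w) a b \<longleftrightarrow> walk T f w (act T \<epsilon> a (f X)) b"

definition colourings :: "'a magma \<Rightarrow> code \<Rightarrow> ('a \<times> (nat \<Rightarrow> 'a)) set" where
  "colourings T w = {(a, f). a \<in> carrier T \<and> f \<in> crossing ` set w \<rightarrow>\<^sub>E carrier T \<and> walk T f w a a}"

lemma walk_append: "walk T f (u @ v) a c \<longleftrightarrow> (\<exists>b. walk T f u a b \<and> walk T f v b c)"
  by (induction T f u a c rule: walk.induct) auto

lemma walk_unique: "walk T f w a b \<Longrightarrow> walk T f w a c \<Longrightarrow> b = c"
  by (induction T f w a b rule: walk.induct) auto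

lemma walk_cong:
  "(\<And>X. X \<in> crossing ` set w \<Longrightarrow> f X = g X) \<Longrightarrow> walk T f w a b \<longleftrightarrow> walk T g w a b"
  by (induction T f w a b rule: walk.induct) auto

lemma walk_map_letter: "walk T f (map (map_letter h) w) a b \<longleftrightarrow> walk T (f \<circ> h) w a b"
  by (induction T "f \<circ> h" w a b rule: walk.induct) auto

lemma crossing_map_letter: "crossing (map_letter h l) = h (crossing l)"
  by (cases l) auto

lemma crossing_swap_letter: "crossing (swap_letter l) = crossing l"
  by (cases l) auto

lemma swap_map_letter: "swap_letter (map_letter h l) = map_letter h (swap_letter l)"
  by (cases l) auto

lemma gauss_code_mset:
  assumes "mset w = mset w'" shows "gauss_code w \<longleftrightarrow> gauss_code w'"
proof -
  have "set w = set w'" using assms by (metis set_mset_mset)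
  moreover have "mset (filter P w) = mset (filter P w')" for P
    using assms by (simp add: mset_filter)
  ultimately show ?thesis by (simp add: gauss_code_def)
qed

lemma gauss_code_swap:
  assumes "gauss_code w" shows "gauss_code (map swap_letter w)"
  unfolding gauss_code_def
proof
  fix X assume "X \<in> crossing ` set (map swap_letter w)"
  then have "X \<in> crossing ` set w" by (auto simp: crossing_swap_letter)
  then obtain \<epsilon> where e: "\<epsilon> \<in> {1, -1}"
      "mset (filter (\<lambda>l. crossing l = X) w) = {#Over X \<epsilon>, Under X \<epsilon>#}"
    using assms unfolding gauss_code_def by blast
  have "mset (filter (\<lambda>l. crossing l = X) (map swap_letter w))
      = image_mset swap_letter (mset (filter (\<lambda>l. crossing l = X) w))"
    by (simp add: filter_map o_def crossing_swap_letter)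
  then show "\<exists>\<epsilon>\<in>{1, -1}. mset (filter (\<lambda>l. crossing l = X) (map swap_letter w))
      = {#Over X \<epsilon>, Under X \<epsilon>#}"
    using e by (auto simp: add_mset_commute)
qed

lemma gauss_code_eps:
  assumes "gauss_code w" "l \<in> set w" shows "eps l \<in> {1, -1}"
proof -
  obtain \<epsilon> where e: "\<epsilon> \<in> {1, -1}"
      "mset (filter (\<lambda>l'. crossing l' = crossing l) w) = {#Over (crossing l) \<epsilon>, Under (crossing l) \<epsilon>#}"
    using assms unfolding gauss_code_def by blast
  have "l \<in># mset (filter (\<lambda>l'. crossing l' = crossing l) w)" using assms by simp
  then show ?thesis unfolding e(2) using e(1) by (cases l) auto
qed

text \<open>The label \<open>X\<close> occurs exactly twice in \<open>w\<close>, and both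
  occurrences are accounted for outside \<open>v\<close>.\<close>

lemma gauss_code_fresh:
  assumes "gauss_code w" "mset w = {#Over X \<epsilon>, Under X \<epsilon>#} + mset v"
  shows "X \<notin> crossing ` set v"
proof
  assume X: "X \<in> crossing ` set v"
  have "Over X \<epsilon> \<in># mset w" unfolding assms(2) by simp
  then have "X \<in> crossing ` set w" by (metis image_eqI letter.sel(1) set_mset_mset)
  then obtain \<delta> where e: "mset (filter (\<lambda>l. crossing l = X) w) = {#Over X \<delta>, Under X \<delta>#}"
    using assms unfolding gauss_code_def by blast
  have "mset (filter (\<lambda>l. crossing l = X) w)
      = {#Over X \<epsilon>, Under X \<epsilon>#} + mset (filter (\<lambda>l. crossing l = X) v)"
    using assms(2) by (simp add: mset_filter)
  then have "size (mset (filter (\<lambda>l. crossing l = X) v)) = 0"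
    using arg_cong[OF e, of size] by simp
  then show False using X by (auto simp: filter_empty_conv)
qed

section \<open>Change of base point, renaming and deletion of crossings\<close>

context quandle_loc begin

lemma act_cancel: "b \<in> carrier T \<Longrightarrow> act T \<epsilon> a b = act T \<epsilon> a' b \<longleftrightarrow> a = a'"
  using qaut_bij[OF act_in_qaut[of b \<epsilon>]] by (auto simp: bij_def inj_def)

text \<open>Moving the base point past an overcrossing changes nothing; moving it past an
  undercrossing applies a translation or its inverse to the base colour, which is a
  bijection.\<close>

lemma card_colourings_rotate1: "card (colourings T (u @ [l])) = card (colourings T (l # u))"
proof (cases l)
  case (Over X \<epsilon>)
  have "colourings T (u @ [l]) = colourings T (l # u)"
    unfolding Over colourings_def walk_append by (auto dest: walk_unique)
  then show ?thesis by simp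
next
  case (Under X \<epsilon>)
  have "bij_betw (\<lambda>(a, f). (act T \<epsilon> a (f X), f)) (colourings T (l # u)) (colourings T (u @ [l]))"
    unfolding bij_betw_def
  proof
    show "inj_on (\<lambda>(a, f). (act T \<epsilon> a (f X), f)) (colourings T (l # u))"
    proof -
      have "f X \<in> carrier T" if "(a, f) \<in> colourings T (l # u)" for a f
        using that by (auto simp: colourings_def Under)
      then show ?thesis by (auto simp: inj_on_def act_cancel)
    qed
    show "(\<lambda>(a, f). (act T \<epsilon> a (f X), f)) ` colourings T (l # u) = colourings T (u @ [l])"
    proof (intro equalityI subsetI)
      fix p assume "p \<in> (\<lambda>(a, f). (act T \<epsilon> a (f X), f)) ` colourings T (l # u)"
      then show "p \<in> colourings T (u @ [l])"
        unfolding Under colourings_def walk_append by (auto intro!: act_in)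
    next
      fix p assume p: "p \<in> colourings T (u @ [l])"
      then obtain b f where bf: "p = (b, f)" "b \<in> carrier T"
          "f \<in> crossing ` set (l # u) \<rightarrow>\<^sub>E carrier T" "walk T f (u @ [l]) b b"
        by (auto simp: colourings_def)
      then obtain c where c: "walk T f u b c" "act T \<epsilon> c (f X) = b"
        by (auto simp: walk_append Under)
      have fX: "f X \<in> carrier T" using bf(3) Under by auto
      have "c \<in> carrier T"
        using qaut_carrier_iff[OF act_in_qaut[OF fX, of \<epsilon>], of c] c(2) bf(2) by simp
      then have "(c, f) \<in> colourings T (l # u)"
        using bf(3) c by (simp add: colourings_def Under)
      then show "p \<in> (\<lambda>(a, f). (act T \<epsilon> a (f X), f)) ` colourings T (l # u)"
        using c(2) bf(1) by force
    qed
  qed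
  then show ?thesis by (rule bij_betw_same_card[symmetric])
qed

lemma card_colourings_rotate: "card (colourings T (rotate n w)) = card (colourings T w)"
proof (induction n)
  case (Suc n)
  have "card (colourings T (rotate1 v)) = card (colourings T v)" for v
    by (cases v) (simp_all add: card_colourings_rotate1)
  then show ?case using Suc by (simp add: rotate_Suc)
qed simp

lemma card_colourings_append: "card (colourings T (u @ v)) = card (colourings T (v @ u))"
  by (metis card_colourings_rotate rotate_append)

lemma card_colourings_rename:
  assumes h: "inj_on h (crossing ` set w)"
  shows "card (colourings T (map (map_letter h) w)) = card (colourings T w)"
proof -
  let ?L = "crossing ` set w"
  have L: "crossing ` set (map (map_letter h) w) = h ` ?L"
    by (auto simp: crossing_map_letter image_iff)
  have tr: "walk T (restrict (f \<circ> h) ?L) w a b \<longleftrightarrow> walk T f (map (map_letter h) w) a b" for f a b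
    unfolding walk_map_letter by (rule walk_cong) simp
  have "bij_betw (\<lambda>(a, f). (a, restrict (f \<circ> h) ?L)) (colourings T (map (map_letter h) w)) (colourings T w)"
  proof (rule bij_betw_byWitness[where f' = "\<lambda>(a, g). (a, restrict (g \<circ> the_inv_into ?L h) (h ` ?L))"])
    show "\<forall>p\<in>colourings T (map (map_letter h) w).
        (case case p of (a, f) \<Rightarrow> (a, restrict (f \<circ> h) ?L) of
          (a, g) \<Rightarrow> (a, restrict (g \<circ> the_inv_into ?L h) (h ` ?L))) = p"
      unfolding colourings_def L
      by (auto simp: fun_eq_iff the_inv_into_f_f[OF h] restrict_def PiE_def extensional_def)
    show "\<forall>p\<in>colourings T w.
        (case case p of (a, g) \<Rightarrow> (a, restrict (g \<circ> the_inv_into ?L h) (h ` ?L)) of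
          (a, f) \<Rightarrow> (a, restrict (f \<circ> h) ?L)) = p"
      unfolding colourings_def
      by (auto simp: fun_eq_iff the_inv_into_f_f[OF h] restrict_def PiE_def extensional_def)
    show "(\<lambda>(a, f). (a, restrict (f \<circ> h) ?L)) ` colourings T (map (map_letter h) w) \<subseteq> colourings T w"
      unfolding colourings_def L by (auto simp: tr)
    show "(\<lambda>(a, g). (a, restrict (g \<circ> the_inv_into ?L h) (h ` ?L))) ` colourings T w
        \<subseteq> colourings T (map (map_letter h) w)"
    proof safe
      fix a g assume p: "(a, g) \<in> colourings T w"
      let ?f = "restrict (g \<circ> the_inv_into ?L h) (h ` ?L)"
      have "walk T ?f (map (map_letter h) w) a a \<longleftrightarrow> walk T g w a a"
        unfolding walk_map_letter by (rule walk_cong) (simp add: the_inv_into_f_f[OF h])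
      moreover have "?f \<in> h ` ?L \<rightarrow>\<^sub>E carrier T"
        using p by (auto simp: colourings_def the_inv_into_f_f[OF h])
      ultimately show "(a, ?f) \<in> colourings T (map (map_letter h) w)"
        using p unfolding colourings_def L by simp
    qed
  qed
  then show ?thesis by (rule bij_betw_same_card)
qed

text \<open>In Reidemeister moves I and II the colours of the deleted crossings are forced.\<close>

lemma card_colourings_delete:
  assumes L: "crossing ` set w' = M \<union> crossing ` set w" "M \<inter> crossing ` set w = {}"
    and tr: "\<And>a f. a \<in> carrier T \<Longrightarrow> f \<in> crossing ` set w' \<rightarrow> carrier T \<Longrightarrow>
      walk T f w' a a \<longleftrightarrow> (\<forall>X\<in>M. f X = a) \<and> walk T f w a a"
  shows "card (colourings T w') = card (colourings T w)"
proof -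
  let ?L = "crossing ` set w"
  let ?ext = "\<lambda>a g X. if X \<in> M then a else g X"
  have "bij_betw (\<lambda>(a, f). (a, restrict f ?L)) (colourings T w') (colourings T w)"
  proof (rule bij_betw_byWitness[where f' = "\<lambda>(a, g). (a, ?ext a g)"])
    show "\<forall>p\<in>colourings T w'. (case case p of (a, f) \<Rightarrow> (a, restrict f ?L) of (a, g) \<Rightarrow> (a, ?ext a g)) = p"
    proof
      fix p assume "p \<in> colourings T w'"
      then obtain a f where p: "p = (a, f)" "f \<in> crossing ` set w' \<rightarrow>\<^sub>E carrier T" "a \<in> carrier T"
          "walk T f w' a a"
        by (auto simp: colourings_def)
      then have "\<forall>X\<in>M. f X = a" using tr[of a f] by (auto simp: PiE_def)
      then have "?ext a (restrict f ?L) = f"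
        using p(2) unfolding L(1) by (auto simp: fun_eq_iff restrict_def PiE_def extensional_def)
      then show "(case case p of (a, f) \<Rightarrow> (a, restrict f ?L) of (a, g) \<Rightarrow> (a, ?ext a g)) = p"
        unfolding p(1) prod.case by simp
    qed
    show "\<forall>p\<in>colourings T w. (case case p of (a, g) \<Rightarrow> (a, ?ext a g) of (a, f) \<Rightarrow> (a, restrict f ?L)) = p"
      using L(2) unfolding colourings_def
      by (auto simp: fun_eq_iff restrict_def PiE_def extensional_def)
    show "(\<lambda>(a, f). (a, restrict f ?L)) ` colourings T w' \<subseteq> colourings T w"
    proof safe
      fix a f assume p: "(a, f) \<in> colourings T w'"
      have "walk T f w a a" using p tr[of a f] by (auto simp: colourings_def PiE_def)
      moreover have "walk T (restrict f ?L) w a a \<longleftrightarrow> walk T f w a a" by (rule walk_cong) simp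
      ultimately show "(a, restrict f ?L) \<in> colourings T w"
        using p L(1) by (auto simp: colourings_def)
    qed
    show "(\<lambda>(a, g). (a, ?ext a g)) ` colourings T w \<subseteq> colourings T w'"
    proof safe
      fix a g assume p: "(a, g) \<in> colourings T w"
      have "walk T (?ext a g) w a a \<longleftrightarrow> walk T g w a a"
        by (rule walk_cong) (use L(2) in auto)
      moreover have f: "?ext a g \<in> crossing ` set w' \<rightarrow>\<^sub>E carrier T"
        using p L(1) by (auto simp: colourings_def PiE_def extensional_def)
      ultimately show "(a, ?ext a g) \<in> colourings T w'"
        using p tr[of a "?ext a g"] by (auto simp: colourings_def)
    qed
  qed
  then show ?thesis by (rule bij_betw_same_card)
qed

end

section \<open>Invariance under virtual isotopy\<close>

lemma mset_pairE:
  assumes "mset a = {#x, y#}"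
  obtains "a = [x, y]" | "a = [y, x]"
proof -
  have "size (mset a) = 2" using assms by simp
  then have "length a = 2" by simp
  then obtain p q where "a = [p, q]" by (auto simp: length_Suc_conv numeral_2_eq_2)
  with assms that show thesis by (auto simp: add_eq_conv_ex)
qed

lemma rev_arrange: "\<sigma> \<in> {1, -1} \<Longrightarrow> rev (arrange \<sigma> x y) = arrange (- \<sigma>) x y"
  by (auto simp: arrange_def)

lemma arrange_commute: "\<sigma> \<in> {1, -1} \<Longrightarrow> arrange \<sigma> x y = arrange (- \<sigma>) y x"
  by (auto simp: arrange_def)

lemma map_arrange: "map f (arrange \<sigma> x y) = arrange \<sigma> (f x) (f y)"
  by (simp add: arrange_def)

lemma crossing_arrange: "crossing ` set (arrange \<sigma> x y) = {crossing x, crossing y}"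
  by (auto simp: arrange_def)

lemma mset_arrange: "mset (arrange \<sigma> x y) = {#x, y#}"
  by (simp add: arrange_def add_mset_commute)

context quandle_loc begin

lemma card_colourings_R1:
  assumes g: "gauss_code (p @ w)" and p: "p = [Over X \<epsilon>, Under X \<epsilon>] \<or> p = [Under X \<epsilon>, Over X \<epsilon>]"
  shows "card (colourings T (p @ w)) = card (colourings T w)"
proof (rule card_colourings_delete[where M = "{X}"])
  have "X \<notin> crossing ` set w"
    by (rule gauss_code_fresh[OF g, of _ \<epsilon>]) (use p in auto)
  then show "{X} \<inter> crossing ` set w = {}" by simp
  show "crossing ` set (p @ w) = {X} \<union> crossing ` set w" using p by auto
  fix a f assume a: "a \<in> carrier T" and "f \<in> crossing ` set (p @ w) \<rightarrow> carrier T"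
  then have fX: "f X \<in> carrier T" using p by auto
  \<comment> \<open>By idempotence \<open>f X\<close> is fixed by its own translation, so
    injectivity forces the arc entering the kink to have colour \<open>f X\<close> already.\<close>
  have "act T \<epsilon> a (f X) = f X \<longleftrightarrow> f X = a"
    using act_cancel[OF fX, of \<epsilon> a "f X"] act_idem[OF fX] by auto
  then show "walk T f (p @ w) a a \<longleftrightarrow> (\<forall>Y\<in>{X}. f Y = a) \<and> walk T f w a a"
    using p act_idem[OF a] by auto
qed

text \<open>The over pair forces both labels to carry the base colour, and on the under pair two
  translations by the same element with opposite signs cancel.\<close>

lemma card_colourings_R2:
  assumes g: "gauss_code (p @ u @ q @ v)"
    and p: "mset p = {#Over X \<epsilon>, Over Y (- \<epsilon>)#}" and q: "mset q = {#Under X \<epsilon>, Under Y (- \<epsilon>)#}"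
  shows "card (colourings T (p @ u @ q @ v)) = card (colourings T (u @ v))"
proof (rule card_colourings_delete[where M = "{X, Y}"])
  have sp: "set p = {Over X \<epsilon>, Over Y (- \<epsilon>)}" using arg_cong[OF p, of set_mset] by simp
  have sq: "set q = {Under X \<epsilon>, Under Y (- \<epsilon>)}" using arg_cong[OF q, of set_mset] by simp
  have "X \<notin> crossing ` set ([Over Y (- \<epsilon>), Under Y (- \<epsilon>)] @ u @ v)"
    by (rule gauss_code_fresh[OF g, of _ \<epsilon>]) (simp add: p q ac_simps)
  moreover have "Y \<notin> crossing ` set ([Over X \<epsilon>, Under X \<epsilon>] @ u @ v)"
    by (rule gauss_code_fresh[OF g, of _ "- \<epsilon>"]) (simp add: p q ac_simps)
  ultimately show "{X, Y} \<inter> crossing ` set (u @ v) = {}" by auto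
  show L: "crossing ` set (p @ u @ q @ v) = {X, Y} \<union> crossing ` set (u @ v)"
    using sp sq by auto
  have e: "\<epsilon> \<in> {1, -1}" using gauss_code_eps[OF g, of "Over X \<epsilon>"] sp by simp
  fix a f assume a: "a \<in> carrier T" and "f \<in> crossing ` set (p @ u @ q @ v) \<rightarrow> carrier T"
  then have fX: "f X \<in> carrier T" using L by auto
  have wp: "walk T f p b c \<longleftrightarrow> b = f X \<and> f Y = f X \<and> b = c" for b c
    using p by (rule mset_pairE) auto
  have e': "- \<epsilon> \<in> {1, -1}" using e by auto
  have wq: "walk T f q b c \<longleftrightarrow> b = c" if "f Y = f X" for b c
    using q
  proof (rule mset_pairE)
    assume "q = [Under X \<epsilon>, Under Y (- \<epsilon>)]"
    then show ?thesis using act_uminus_act[OF fX e] that by simp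
  next
    assume "q = [Under Y (- \<epsilon>), Under X \<epsilon>]"
    then show ?thesis using act_uminus_act[OF fX e'] that by simp
  qed
  show "walk T f (p @ u @ q @ v) a a \<longleftrightarrow> (\<forall>Z\<in>{X, Y}. f Z = a) \<and> walk T f (u @ v) a a"
    using wq by (auto simp: walk_append wp)
qed

text \<open>Across move III only the colour of the over-strand at \<open>C\<close> changes, because this strand
  passes under the top strand on the other side of \<open>C\<close>.\<close>

lemma walk_R3:
  assumes dist: "distinct [A, B, C]" and s: "{\<sigma>t, \<sigma>m, \<sigma>b} \<subseteq> {1, -1}"
    and e: "\<epsilon>A \<in> {1, -1}" "\<epsilon>B \<in> {1, -1}" and AB: "\<sigma>m * \<epsilon>A = \<sigma>b * \<epsilon>B"
    and fA: "f A \<in> carrier T" and fB: "f B = f A" and fC: "f C \<in> carrier T"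
    and f': "f' = f(C := act T (- \<sigma>m * \<epsilon>A) (f C) (f A))"
  shows "walk T f (arrange \<sigma>m (Under A \<epsilon>A) (Over C \<epsilon>C)) a b \<Longrightarrow>
      walk T f' (arrange (- \<sigma>m) (Under A \<epsilon>A) (Over C \<epsilon>C)) a b"
    and "walk T f (arrange \<sigma>b (Under B \<epsilon>B) (Under C \<epsilon>C)) a b \<Longrightarrow>
      walk T f' (arrange (- \<sigma>b) (Under B \<epsilon>B) (Under C \<epsilon>C)) a b"
proof -
  \<comment> \<open>The over-strand at \<open>C\<close> is moved to the other side of the
    undercrossing at \<open>A\<close>: its colour goes back across it if \<open>A\<close> precedes
    \<open>C\<close> on the middle strand, and forward otherwise. This is the origin of the sign
    \<open>- \<sigma>m * \<epsilon>A\<close>.\<close>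
  have c: "f' A = f A" "f' B = f A" "f' C = act T (- \<sigma>m * \<epsilon>A) (f C) (f A)"
    using dist fB f' by auto
  have f'C: "f' C \<in> carrier T" unfolding c by (rule act_in[OF fC fA])
  have u: "act T (- \<epsilon>) (act T \<epsilon> x (f A)) (f A) = x" if "\<epsilon> \<in> {1, -1}" for \<epsilon> x
    by (rule act_uminus_act[OF fA that])
  have e': "- \<epsilon>B \<in> {1, -1}" using e by auto
  note d = act_distrib[OF fC fA] act_distrib[OF f'C fA]
  show "walk T f' (arrange (- \<sigma>m) (Under A \<epsilon>A) (Over C \<epsilon>C)) a b"
    if w: "walk T f (arrange \<sigma>m (Under A \<epsilon>A) (Over C \<epsilon>C)) a b"
  proof (cases "\<sigma>m = 1")
    case True
    then show ?thesis using w c u[OF e(1), of a] by (auto simp: arrange_def)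
  next
    case False
    then have "\<sigma>m = -1" using s by auto
    then show ?thesis using w c by (auto simp: arrange_def)
  qed
  show "walk T f' (arrange (- \<sigma>b) (Under B \<epsilon>B) (Under C \<epsilon>C)) a b"
    if w: "walk T f (arrange \<sigma>b (Under B \<epsilon>B) (Under C \<epsilon>C)) a b"
  \<comment> \<open>\<open>AB\<close> rewrites the sign in \<open>f' C\<close> in terms of
    \<open>B\<close>; distributivity then exchanges passing under the top strand with passing under
    the middle strand.\<close>
  proof (cases "\<sigma>b = 1")
    case True
    then have "f' C = act T (- \<epsilon>B) (f C) (f A)" using c(3) AB by simp
    then have "act T \<epsilon>B (f' C) (f A) = f C" using u[OF e', of "f C"] by simp
    then have "act T \<epsilon>B (act T \<epsilon>C a (f' C)) (f A) = act T \<epsilon>C (act T \<epsilon>B a (f A)) (f C)"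
      by (simp add: d(2)[of \<epsilon>B \<epsilon>C a])
    then show ?thesis using w c True fB by (simp add: arrange_def)
  next
    case False
    then have sb: "\<sigma>b = -1" using s by auto
    then have "f' C = act T \<epsilon>B (f C) (f A)" using c(3) AB by simp
    then show ?thesis using w c sb fB d(1)[of \<epsilon>B \<epsilon>C a] by (simp add: arrange_def)
  qed
qed

lemma card_colourings_R3:
  assumes dist: "distinct [A, B, C]" and s: "{\<sigma>t, \<sigma>m, \<sigma>b} \<subseteq> {1, -1}"
    and sgn: "\<sigma>t * \<sigma>m * \<epsilon>A = \<sigma>t * \<sigma>b * \<epsilon>B"
    and t: "t = arrange \<sigma>t (Over A \<epsilon>A) (Over B \<epsilon>B)"
    and m: "m = arrange \<sigma>m (Under A \<epsilon>A) (Over C \<epsilon>C)"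
    and b: "b = arrange \<sigma>b (Under B \<epsilon>B) (Under C \<epsilon>C)"
    and w: "(w, w') = (t @ u @ m @ v @ b @ x, rev t @ u @ rev m @ v @ rev b @ x) \<or>
      (w, w') = (t @ u @ b @ v @ m @ x, rev t @ u @ rev b @ v @ rev m @ x)"
    and g: "gauss_code w"
  shows "card (colourings T w) = card (colourings T w')"
proof -
  let ?L = "{A, B, C} \<union> crossing ` (set u \<union> set v \<union> set x)"
  let ?h = "\<lambda>\<delta> (a, f). (a, f(C := act T \<delta> (f C) (f A)))"
  have e: "\<epsilon>A \<in> {1, -1}" "\<epsilon>B \<in> {1, -1}"
    using gauss_code_eps[OF g, of "Over A \<epsilon>A"] gauss_code_eps[OF g, of "Over B \<epsilon>B"] w
    by (auto simp: t arrange_def)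
  have AB: "\<sigma>m * \<epsilon>A = \<sigma>b * \<epsilon>B" using sgn s by auto
  have fresh: "C \<notin> crossing ` (set u \<union> set v \<union> set x)"
  proof -
    have "mset w = {#Over C \<epsilon>C, Under C \<epsilon>C#}
        + mset ([Over A \<epsilon>A, Over B \<epsilon>B, Under A \<epsilon>A, Under B \<epsilon>B] @ u @ v @ x)"
      using w by (auto simp: t m b mset_arrange)
    from gauss_code_fresh[OF g this] show ?thesis by auto
  qed
  define tt where "tt = (\<lambda>\<sigma>. arrange \<sigma> (Over A \<epsilon>A) (Over B \<epsilon>B))"
  define mm where "mm = (\<lambda>\<sigma>. arrange \<sigma> (Under A \<epsilon>A) (Over C \<epsilon>C))"
  define bb where "bb = (\<lambda>\<sigma>. arrange \<sigma> (Under B \<epsilon>B) (Under C \<epsilon>C))"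
  note defs = tt_def mm_def bb_def
  have cross: "crossing ` set (tt \<sigma>) = {A, B}" "crossing ` set (mm \<sigma>) = {A, C}"
    "crossing ` set (bb \<sigma>) = {B, C}" for \<sigma>
    by (simp_all add: defs crossing_arrange)
  \<comment> \<open>One inclusion is shown for arbitrary orders. The inverse move is the same
    statement with all three \<sigma> negated, which preserves \<open>AB'\<close>.\<close>
  have half: "?h (- \<sigma>m' * \<epsilon>A) ` colourings T w1 \<subseteq> colourings T w2"
    if s': "{\<sigma>t', \<sigma>m', \<sigma>b'} \<subseteq> {1, -1}" and AB': "\<sigma>m' * \<epsilon>A = \<sigma>b' * \<epsilon>B"
      and ww: "(w1, w2) = (tt \<sigma>t' @ u @ mm \<sigma>m' @ v @ bb \<sigma>b' @ x, tt (- \<sigma>t') @ u @ mm (- \<sigma>m') @ v @ bb (- \<sigma>b') @ x) \<or>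
        (w1, w2) = (tt \<sigma>t' @ u @ bb \<sigma>b' @ v @ mm \<sigma>m' @ x, tt (- \<sigma>t') @ u @ bb (- \<sigma>b') @ v @ mm (- \<sigma>m') @ x)"
    for \<sigma>t' \<sigma>m' \<sigma>b' w1 w2
  proof
    fix p assume "p \<in> ?h (- \<sigma>m' * \<epsilon>A) ` colourings T w1"
    then obtain a f where p: "p = ?h (- \<sigma>m' * \<epsilon>A) (a, f)" and af: "(a, f) \<in> colourings T w1"
      by auto
    define f' where "f' = f(C := act T (- \<sigma>m' * \<epsilon>A) (f C) (f A))"
    have L: "crossing ` set w1 = ?L" "crossing ` set w2 = ?L"
      using ww by (elim disjE; clarify; simp only: set_append image_Un cross; blast)+
    have f: "f \<in> ?L \<rightarrow>\<^sub>E carrier T" "a \<in> carrier T" and W: "walk T f w1 a a"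
      using af by (auto simp: colourings_def L)
    have wt: "walk T f (tt \<sigma>) c d \<longleftrightarrow> c = f A \<and> f B = f A \<and> d = c"
      "walk T f' (tt \<sigma>) c d \<longleftrightarrow> c = f A \<and> f B = f A \<and> d = c" for \<sigma> c d
      using dist by (auto simp: tt_def f'_def arrange_def)
    have fB: "f B = f A" using W ww by (auto simp: walk_append wt)
    have fAC: "f A \<in> carrier T" "f C \<in> carrier T" using f by auto
    note R = walk_R3[OF dist s' e AB' fAC(1) fB fAC(2) f'_def]
    have Rm: "walk T f (mm \<sigma>m') c d \<Longrightarrow> walk T f' (mm (- \<sigma>m')) c d" for c d
      unfolding mm_def by (rule R(1))
    have Rb: "walk T f (bb \<sigma>b') c d \<Longrightarrow> walk T f' (bb (- \<sigma>b')) c d" for c d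
      unfolding bb_def by (rule R(2))
    have "walk T f' y c d \<longleftrightarrow> walk T f y c d" if "y \<in> {u, v, x}" for y c d
      by (rule walk_cong) (use fresh that in \<open>auto simp: f'_def\<close>)
    then have "walk T f' w2 a a"
      using ww W by (auto simp: walk_append wt) (blast intro: Rm Rb)+
    moreover have "f' \<in> ?L \<rightarrow>\<^sub>E carrier T"
      using f act_in[OF fAC(2,1)] by (auto simp: f'_def PiE_def extensional_def)
    ultimately show "p \<in> colourings T w2"
      using f(2) unfolding p prod.case f'_def[symmetric] by (simp add: colourings_def L)
  qed
  have rev: "rev t = tt (- \<sigma>t)" "rev m = mm (- \<sigma>m)" "rev b = bb (- \<sigma>b)"
    using s by (simp_all add: t m b defs rev_arrange)
  have ww: "(w, w') = (tt \<sigma>t @ u @ mm \<sigma>m @ v @ bb \<sigma>b @ x, tt (- \<sigma>t) @ u @ mm (- \<sigma>m) @ v @ bb (- \<sigma>b) @ x) \<or>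
      (w, w') = (tt \<sigma>t @ u @ bb \<sigma>b @ v @ mm \<sigma>m @ x, tt (- \<sigma>t) @ u @ bb (- \<sigma>b) @ v @ mm (- \<sigma>m) @ x)"
    using w unfolding rev by (simp add: t m b defs)
  have L: "crossing ` set w = ?L" "crossing ` set w' = ?L"
    using ww by (elim disjE; clarify; simp only: set_append image_Un cross; blast)+
  have inv: "?h (- \<delta>) (?h \<delta> p) = p" if "p \<in> colourings T y" "crossing ` set y = ?L" "\<delta> \<in> {1, -1}"
    for \<delta> p y
  proof -
    obtain a f where p: "p = (a, f)" by force
    have "f A \<in> carrier T" using that(1,2) by (auto simp: p colourings_def)
    then show ?thesis using dist act_uminus_act[OF _ that(3)] by (auto simp: p)
  qed
  have "bij_betw (?h (- \<sigma>m * \<epsilon>A)) (colourings T w) (colourings T w')"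
  proof (rule bij_betw_byWitness[where f' = "?h (\<sigma>m * \<epsilon>A)"])
    have d: "- \<sigma>m * \<epsilon>A \<in> {1, -1}" "\<sigma>m * \<epsilon>A \<in> {1, -1}" using s e by auto
    show "\<forall>p\<in>colourings T w. ?h (\<sigma>m * \<epsilon>A) (?h (- \<sigma>m * \<epsilon>A) p) = p"
      using inv[OF _ L(1) d(1)] by simp
    show "\<forall>p\<in>colourings T w'. ?h (- \<sigma>m * \<epsilon>A) (?h (\<sigma>m * \<epsilon>A) p) = p"
      using inv[OF _ L(2) d(2)] by simp
    show "?h (- \<sigma>m * \<epsilon>A) ` colourings T w \<subseteq> colourings T w'"
      by (rule half[OF s AB ww])
    have "?h (- (- \<sigma>m) * \<epsilon>A) ` colourings T w' \<subseteq> colourings T w"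
      by (rule half[of "- \<sigma>t" "- \<sigma>m" "- \<sigma>b"]) (use s AB ww in auto)
    then show "?h (\<sigma>m * \<epsilon>A) ` colourings T w' \<subseteq> colourings T w" by simp
  qed
  then show ?thesis by (rule bij_betw_same_card)
qed

lemma card_colourings_step:
  assumes "code_step w w'" "gauss_code w"
  shows "card (colourings T w) = card (colourings T w')"
  using assms
proof (induction rule: code_step.induct)
  case (rotate w n)
  then show ?case by (simp add: card_colourings_rotate)
next
  case (rename f w)
  then show ?case by (simp add: card_colourings_rename)
next
  case (R1_over X \<epsilon> w)
  then show ?case using card_colourings_R1 by blast
next
  case (R1_under X \<epsilon> w)
  then show ?case using card_colourings_R1 by blast
next
  case (R2 X Y a \<epsilon> b u v)
  then show ?case using card_colourings_R2 by blast
next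
  case (R3_tmb A B C \<sigma>t \<sigma>m \<sigma>b \<epsilon>A \<epsilon>B \<epsilon>C t m b u v w)
  then show ?case by (intro card_colourings_R3[OF R3_tmb(1-3,5-7)]) auto
next
  case (R3_tbm A B C \<sigma>t \<sigma>m \<sigma>b \<epsilon>A \<epsilon>B \<epsilon>C t m b u v w)
  then show ?case by (intro card_colourings_R3[OF R3_tbm(1-3,5-7)]) auto
qed

text \<open>Exchanging over and under turns a move III with top, middle and bottom strand \<open>t, m, b\<close>
  into one with these strands in the order \<open>b, m, t\<close>, in which \<open>A\<close> and \<open>C\<close> are exchanged.\<close>

lemma card_colourings_swap_R3:
  assumes dist: "distinct [A, B, C]" and s: "{\<sigma>t, \<sigma>m, \<sigma>b} \<subseteq> {1, -1}"
    and sgn: "\<sigma>t * \<sigma>b * \<epsilon>B = \<sigma>m * \<sigma>b * \<epsilon>C"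
    and t: "t = arrange \<sigma>t (Over A \<epsilon>A) (Over B \<epsilon>B)"
    and m: "m = arrange \<sigma>m (Under A \<epsilon>A) (Over C \<epsilon>C)"
    and b: "b = arrange \<sigma>b (Under B \<epsilon>B) (Under C \<epsilon>C)"
    and w: "(w, w') = (t @ u @ m @ v @ b @ x, rev t @ u @ rev m @ v @ rev b @ x) \<or>
      (w, w') = (t @ u @ b @ v @ m @ x, rev t @ u @ rev b @ v @ rev m @ x)"
    and g: "gauss_code w"
  shows "card (colourings T (map swap_letter w)) = card (colourings T (map swap_letter w'))"
proof -
  let ?s = "map swap_letter"
  have s': "\<sigma>t \<in> {1, -1}" "\<sigma>m \<in> {1, -1}" "\<sigma>b \<in> {1, -1}" using s by auto
  have tmb: "?s b = arrange (- \<sigma>b) (Over C \<epsilon>C) (Over B \<epsilon>B)" "?s m = arrange (- \<sigma>m) (Under C \<epsilon>C) (Over A \<epsilon>A)"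
    "?s t = arrange (- \<sigma>t) (Under B \<epsilon>B) (Under A \<epsilon>A)"
    using s'[THEN arrange_commute] by (simp_all add: t m b map_arrange)
  have "distinct [C, B, A]" "{- \<sigma>b, - \<sigma>m, - \<sigma>t} \<subseteq> {1, -1}" "- \<sigma>b * - \<sigma>m * \<epsilon>C = - \<sigma>b * - \<sigma>t * \<epsilon>B"
    using dist s sgn by (auto simp: mult.commute)
  note R3 = card_colourings_R3[OF this tmb]
  from w show ?thesis
  proof
    assume w: "(w, w') = (t @ u @ m @ v @ b @ x, rev t @ u @ rev m @ v @ rev b @ x)"
    \<comment> \<open>The swapped word is rotated to begin with its new top strand, the old bottom
      strand. The cyclic order t, m, b read from b is b, t, m, that is, top, bottom, middle for the
      new roles; hence the second alternative of \<open>R3\<close>. The other case leads in the same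
      way to the first.\<close>
    have "gauss_code (?s b @ ?s x @ ?s t @ ?s u @ ?s m @ ?s v)"
      using gauss_code_swap[OF g]
      by (rule iffD1[OF gauss_code_mset, rotated]) (use w in \<open>simp add: ac_simps\<close>)
    from R3[OF disjI2[OF HOL.refl] this] show ?thesis
      using w card_colourings_append[of "?s t @ ?s u @ ?s m @ ?s v" "?s b @ ?s x"]
        card_colourings_append[of "rev (?s t) @ ?s u @ rev (?s m) @ ?s v" "rev (?s b) @ ?s x"]
      by (simp add: rev_map)
  next
    assume w: "(w, w') = (t @ u @ b @ v @ m @ x, rev t @ u @ rev b @ v @ rev m @ x)"
    have "gauss_code (?s b @ ?s v @ ?s m @ ?s x @ ?s t @ ?s u)"
      using gauss_code_swap[OF g]
      by (rule iffD1[OF gauss_code_mset, rotated]) (use w in \<open>simp add: ac_simps\<close>)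
    from R3[OF disjI1[OF HOL.refl] this] show ?thesis
      using w card_colourings_append[of "?s t @ ?s u" "?s b @ ?s v @ ?s m @ ?s x"]
        card_colourings_append[of "rev (?s t) @ ?s u" "rev (?s b) @ ?s v @ rev (?s m) @ ?s x"]
      by (simp add: rev_map)
  qed
qed

lemma card_colourings_swap_step:
  assumes "code_step w w'" "gauss_code w"
  shows "card (colourings T (map swap_letter w)) = card (colourings T (map swap_letter w'))"
  using assms
proof (induction rule: code_step.induct)
  case (rotate w n)
  then show ?case by (simp add: rotate_map[symmetric] card_colourings_rotate)
next
  case (rename f w)
  have "crossing ` set (map swap_letter w) = crossing ` set w"
    by (auto simp: crossing_swap_letter image_iff)
  then have "card (colourings T (map (map_letter f) (map swap_letter w)))
      = card (colourings T (map swap_letter w))"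
    using rename by (intro card_colourings_rename) simp
  then show ?case by (simp add: o_def swap_map_letter)
next
  case (R1_over X \<epsilon> w)
  then show ?case
    using card_colourings_R1[of "map swap_letter [Over X \<epsilon>, Under X \<epsilon>]" "map swap_letter w" X \<epsilon>]
      gauss_code_swap by fastforce
next
  case (R1_under X \<epsilon> w)
  then show ?case
    using card_colourings_R1[of "map swap_letter [Under X \<epsilon>, Over X \<epsilon>]" "map swap_letter w" X \<epsilon>]
      gauss_code_swap by fastforce
next
  case (R2 X Y a \<epsilon> b u v)
  let ?s = "map swap_letter"
  have a: "mset (?s a) = {#Under X \<epsilon>, Under Y (- \<epsilon>)#}" and b: "mset (?s b) = {#Over X \<epsilon>, Over Y (- \<epsilon>)#}"
    using R2 by simp_all
  \<comment> \<open>The over pair of the swapped word is the old under pair, so the word is rotated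
    to begin there.\<close>
  have "gauss_code (?s b @ ?s v @ ?s a @ ?s u)"
    using gauss_code_swap[OF R2(4)]
    by (rule iffD1[OF gauss_code_mset, rotated]) (simp add: ac_simps)
  from card_colourings_R2[OF this b a]
  have "card (colourings T (?s b @ ?s v @ ?s a @ ?s u)) = card (colourings T (?s u @ ?s v))"
    by (simp add: card_colourings_append[of "?s v"])
  then show ?case
    using card_colourings_append[of "?s a @ ?s u" "?s b @ ?s v"] by simp
next
  case (R3_tmb A B C \<sigma>t \<sigma>m \<sigma>b \<epsilon>A \<epsilon>B \<epsilon>C t m b u v w)
  then show ?case by (intro card_colourings_swap_R3[OF R3_tmb(1,2,4-7)]) auto
next
  case (R3_tbm A B C \<sigma>t \<sigma>m \<sigma>b \<epsilon>A \<epsilon>B \<epsilon>C t m b u v w)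
  then show ?case by (intro card_colourings_swap_R3[OF R3_tbm(1,2,4-7)]) auto
qed

end

section \<open>Colourings and the quandle difference\<close>

lemma gauss_codeE:
  assumes "gauss_code w" "X \<in> crossing ` set w"
  obtains \<epsilon> where "\<epsilon> \<in> {1, -1}" "Over X \<epsilon> \<in> set w" "Under X \<epsilon> \<in> set w"
    "\<And>l. l \<in> set w \<Longrightarrow> crossing l = X \<Longrightarrow> l = Over X \<epsilon> \<or> l = Under X \<epsilon>"
proof -
  obtain \<epsilon> where e: "\<epsilon> \<in> {1, -1}"
      "mset (filter (\<lambda>l. crossing l = X) w) = {#Over X \<epsilon>, Under X \<epsilon>#}"
    using assms unfolding gauss_code_def by blast
  have "set (filter (\<lambda>l. crossing l = X) w) = {Over X \<epsilon>, Under X \<epsilon>}"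
    using arg_cong[OF e(2), of set_mset] by simp
  then show thesis by (intro that[of \<epsilon>]) (use e(1) in auto)
qed

lemma gauss_code_distinct:
  assumes g: "gauss_code w" shows "distinct w"
  unfolding distinct_count_atmost_1
proof
  fix l show "count (mset w) l = (if l \<in> set w then 1 else 0)"
  proof (cases "l \<in> set w")
    case True
    then obtain \<epsilon> where e: "mset (filter (\<lambda>l'. crossing l' = crossing l) w)
        = {#Over (crossing l) \<epsilon>, Under (crossing l) \<epsilon>#}"
      using g unfolding gauss_code_def by blast
    have "l \<in># mset (filter (\<lambda>l'. crossing l' = crossing l) w)" using True by simp
    then have "count (mset (filter (\<lambda>l'. crossing l' = crossing l) w)) l = 1"
      unfolding e by (cases l) auto
    then show ?thesis using True by (simp add: mset_filter)
  next
    case False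
    then show ?thesis by (simp add: count_mset_0_iff)
  qed
qed

lemma gauss_code_over_unique:
  assumes g: "gauss_code w" and "i < length w" "j < length w" "w ! i = Over X \<epsilon>" "w ! j = Over X \<delta>"
  shows "i = j \<and> \<epsilon> = \<delta>"
proof -
  have "X \<in> crossing ` set w" using assms nth_mem[of i w] by (force simp: image_iff)
  then obtain \<epsilon>' where "\<And>l. l \<in> set w \<Longrightarrow> crossing l = X \<Longrightarrow> l = Over X \<epsilon>' \<or> l = Under X \<epsilon>'"
    by (rule gauss_codeE[OF g]) blast
  from this[OF nth_mem[OF assms(2)]] this[OF nth_mem[OF assms(3)]]
  have "\<epsilon> = \<delta>" using assms by auto
  then show ?thesis using nth_eq_iff_index_eq[OF gauss_code_distinct[OF g]] assms by metis
qed

text \<open>The colours \<open>s i\<close> of the semi-arcs: the walk has colour \<open>s i\<close> before the letter \<open>w ! i\<close>.\<close>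

definition semiarc_step :: "'a magma \<Rightarrow> (nat \<Rightarrow> 'a) \<Rightarrow> nat letter \<Rightarrow> 'a \<Rightarrow> 'a \<Rightarrow> bool" where
  "semiarc_step T f l x y \<longleftrightarrow>
     (case l of Over X \<epsilon> \<Rightarrow> f X = x \<and> y = x | Under X \<epsilon> \<Rightarrow> y = act T \<epsilon> x (f X))"

lemma walk_iff_semiarcs:
  "walk T f w a b \<longleftrightarrow>
    (\<exists>s. s 0 = a \<and> s (length w) = b \<and> (\<forall>i<length w. semiarc_step T f (w ! i) (s i) (s (Suc i))))"
proof (induction w arbitrary: a)
  case Nil
  then show ?case by auto
next
  case (Cons l w)
  have "walk T f (l # w) a b \<longleftrightarrow> (\<exists>a'. semiarc_step T f l a a' \<and> walk T f w a' b)"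
    by (cases l) (auto simp: semiarc_step_def)
  also have "\<dots> \<longleftrightarrow> (\<exists>s. s 0 = a \<and> s (length (l # w)) = b \<and>
      (\<forall>i<length (l # w). semiarc_step T f ((l # w) ! i) (s i) (s (Suc i))))" (is "?L \<longleftrightarrow> ?R")
  proof
    assume ?L
    then obtain s where s: "semiarc_step T f l a (s 0)" "s (length w) = b"
        "\<forall>i<length w. semiarc_step T f (w ! i) (s i) (s (Suc i))"
      unfolding Cons.IH by blast
    show ?R
      by (rule exI[of _ "case_nat a s"]) (use s in \<open>auto simp: less_Suc_eq_0_disj\<close>)
  next
    assume ?R
    then obtain s where s: "s 0 = a" "s (Suc (length w)) = b"
        "\<forall>i<Suc (length w). semiarc_step T f ((l # w) ! i) (s i) (s (Suc i))" by auto
    have "walk T f w (s (Suc 0)) b"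
      unfolding Cons.IH by (rule exI[of _ "\<lambda>i. s (Suc i)"]) (use s in auto)
    moreover have "semiarc_step T f l a (s (Suc 0))" using s by force
    ultimately show ?L by blast
  qed
  finally show ?case .
qed

lemma semiarc_step_unique: "semiarc_step T f l x y \<Longrightarrow> semiarc_step T f l x z \<Longrightarrow> y = z"
  by (cases l) (auto simp: semiarc_step_def)

lemma semiarcs_unique:
  assumes "\<forall>i<n. semiarc_step T f (w ! i) (s i) (s (Suc i))"
    "\<forall>i<n. semiarc_step T f (w ! i) (t i) (t (Suc i))" "s 0 = t 0"
  shows "i \<le> n \<Longrightarrow> s i = t i"
proof (induction i)
  case (Suc i)
  then have "i < n" "s i = t i" by auto
  then show ?case using assms(1,2) semiarc_step_unique by metis
qed (rule assms(3))

section \<open>Numbering of the arcs by undercrossings\<close>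

lemma num_under_take_Suc:
  "i < length w \<Longrightarrow> num_under (take (Suc i) w) = num_under (take i w) + (if is_under (w ! i) then 1 else 0)"
  by (simp add: num_under_def take_Suc_conv_app_nth)

lemma num_under_take_mono: "i \<le> j \<Longrightarrow> num_under (take i w) \<le> num_under (take j w)"
proof -
  assume "i \<le> j"
  then have "take j w = take i w @ take (j - i) (drop i w)" by (metis le_add_diff_inverse take_add)
  then show ?thesis by (simp add: num_under_def)
qed

lemma num_under_take_le: "num_under (take i w) \<le> num_under w"
  using num_under_take_mono[of i "max i (length w)" w] by simp

lemma arc_at_in_arcs: "arc_at w i \<in> arcs w"
  unfolding arc_at_def arcs_def using num_under_take_le[of i w]
  by (cases "num_under w = 0") auto

lemma ex_arc_at: "k \<in> arcs w \<Longrightarrow> \<exists>i\<le>length w. num_under (take i w) = k"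
proof -
  assume k: "k \<in> arcs w"
  have "\<exists>i\<le>length w. num_under (take i w) = k" if "k \<le> num_under w"
    using that
  proof (induction k)
    case 0
    then show ?case by (auto simp: num_under_def intro!: exI[of _ 0])
  next
    case (Suc k)
    let ?P = "\<lambda>i. i \<le> length w \<and> Suc k \<le> num_under (take i w)"
    have "?P (length w)" using Suc by simp
    then have L: "?P (LEAST i. ?P i)" by (rule LeastI)
    moreover have "\<not> ?P 0" by (simp add: num_under_def)
    ultimately have "(LEAST i. ?P i) \<noteq> 0" by metis
    then obtain j where j: "(LEAST i. ?P i) = Suc j" using not0_implies_Suc by blast
    have "\<not> ?P j" by (rule not_less_Least) (simp add: j)
    then have "num_under (take j w) \<le> k" using L j by auto
    then have "num_under (take (Suc j) w) = Suc k"
      using L j num_under_take_Suc[of j w] by (auto split: if_splits)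
    then show ?case using L j by auto
  qed
  moreover have "k \<le> num_under w" using k by (auto simp: arcs_def)
  ultimately show ?thesis by blast
qed

lemma arc_at_eq: "k \<in> arcs w \<Longrightarrow> num_under (take i w) = k \<Longrightarrow> arc_at w i = k"
  by (cases "num_under w = 0") (auto simp: arc_at_def arcs_def)

section \<open>Colours of arcs versus colourings of codes\<close>

context quandle_loc begin

lemma colourings_semiarcs:
  assumes "(a, f) \<in> colourings T w"
  obtains s where "f \<in> crossing ` set w \<rightarrow>\<^sub>E carrier T" "s 0 = a" "s (length w) = a"
    "\<forall>i<length w. semiarc_step T f (w ! i) (s i) (s (Suc i))"
    "\<And>i. i \<le> length w \<Longrightarrow> s i \<in> carrier T"
proof -
  have a: "a \<in> carrier T" and f: "f \<in> crossing ` set w \<rightarrow>\<^sub>E carrier T" and W: "walk T f w a a"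
    using assms by (auto simp: colourings_def)
  then obtain s where s: "s 0 = a" "s (length w) = a"
    and st: "\<forall>i<length w. semiarc_step T f (w ! i) (s i) (s (Suc i))"
    unfolding walk_iff_semiarcs by blast
  have "s i \<in> carrier T" if "i \<le> length w" for i
    using that
  proof (induction i)
    case (Suc i)
    then have "s i \<in> carrier T" "f (crossing (w ! i)) \<in> carrier T" using f by (auto simp: Suc_le_eq)
    then show ?case using st[rule_format, of i] Suc.prems act_in
      by (cases "w ! i") (auto simp: semiarc_step_def)
  qed (simp add: s a)
  then show thesis using that f s st by blast
qed

text \<open>An overcrossing does not change the arc number, so its step holds once \<open>f\<close>
  agrees with the colour at that position. An undercrossing step is the quandle relation itself,
  solved for the next arc by the inverse translation if the sign is negative.\<close>

lemma respecting_crossing_relations_iff: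
  assumes g: "gauss_code w" and c: "c \<in> arcs w \<rightarrow>\<^sub>E carrier T"
    and s: "\<And>i. i \<le> length w \<Longrightarrow> s i = c (arc_at w i)"
    and f: "\<And>j X \<epsilon>. j < length w \<Longrightarrow> w ! j = Over X \<epsilon> \<Longrightarrow> f X = s j"
  shows "c \<in> respecting (arcs w) (crossing_relations w) T \<longleftrightarrow>
    (\<forall>i<length w. semiarc_step T f (w ! i) (s i) (s (Suc i)))"
proof -
  have sin: "s i \<in> carrier T" if "i \<le> length w" for i
    using c s[OF that] arc_at_in_arcs[of w i] by auto
  have over: "s (Suc i) = s i" if "i < length w" "w ! i = Over X \<epsilon>" for i X \<epsilon>
    using s[of i] s[of "Suc i"] that num_under_take_Suc[of i w] by (simp add: arc_at_def)
  have coll: "(\<forall>(x, y)\<in>{(F i j X, G i j X) |i j X. P i j X}. qeval T c x = qeval T c y) \<longleftrightarrow>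
      (\<forall>i j X. P i j X \<longrightarrow> qeval T c (F i j X) = qeval T c (G i j X))"
    for F G :: "nat \<Rightarrow> nat \<Rightarrow> nat \<Rightarrow> nat qterm" and P
    by blast
  have "c \<in> respecting (arcs w) (crossing_relations w) T \<longleftrightarrow>
      (\<forall>(x, y)\<in>crossing_relations w. qeval T c x = qeval T c y)"
  proof -
    have "\<forall>(x, y)\<in>crossing_relations w. x \<in> qterms (arcs w) \<and> y \<in> qterms (arcs w)"
      by (auto simp: crossing_relations_def arc_at_in_arcs)
    then show ?thesis using c unfolding respecting_def by blast
  qed
  also have "\<dots> \<longleftrightarrow>
      (\<forall>i j X. i < length w \<longrightarrow> j < length w \<longrightarrow> w ! i = Under X 1 \<longrightarrow> w ! j = Over X 1 \<longrightarrow>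
        rmul T (s j) (s i) = s (Suc i)) \<and>
      (\<forall>i j X. i < length w \<longrightarrow> j < length w \<longrightarrow> w ! i = Under X (-1) \<longrightarrow> w ! j = Over X (-1) \<longrightarrow>
        rmul T (s j) (s (Suc i)) = s i)" (is "_ \<longleftrightarrow> ?L")
    unfolding crossing_relations_def ball_Un
    by (simp only: coll qeval.simps imp_conjL[symmetric] conj_assoc) (simp add: s Suc_leI cong: imp_cong)
  also have "\<dots> \<longleftrightarrow> (\<forall>i<length w. semiarc_step T f (w ! i) (s i) (s (Suc i)))" (is "_ \<longleftrightarrow> ?R")
  proof
    assume L: ?L
    show ?R
    proof (intro allI impI)
      fix i assume i: "i < length w"
      show "semiarc_step T f (w ! i) (s i) (s (Suc i))"
      proof (cases "w ! i")
        case (Over X \<epsilon>)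
        then show ?thesis using f[OF i Over] over[OF i Over] by (simp add: semiarc_step_def)
      next
        case (Under X \<epsilon>)
        have "X \<in> crossing ` set w" using i nth_mem[OF i] Under by (force simp: image_iff)
        then obtain \<delta> where d: "\<delta> \<in> {1, -1}" "Over X \<delta> \<in> set w" "Under X \<delta> \<in> set w"
          "\<And>l. l \<in> set w \<Longrightarrow> crossing l = X \<Longrightarrow> l = Over X \<delta> \<or> l = Under X \<delta>"
          by (rule gauss_codeE[OF g]) blast
        have e: "\<epsilon> = \<delta>" using d(4)[OF nth_mem[OF i]] Under by simp
        obtain j where j: "j < length w" "w ! j = Over X \<delta>" using d(2) by (auto simp: in_set_conv_nth)
        have fX: "f X = s j" using f j by blast
        have sj: "s j \<in> carrier T" using sin[of j] j by simp
        show ?thesis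
        proof (cases "\<epsilon> = 1")
          case True
          then have "rmul T (s j) (s i) = s (Suc i)" using L i j Under e by blast
          then show ?thesis using True by (simp add: semiarc_step_def Under act_def fX)
        next
          case False
          then have "\<epsilon> = -1" using e d(1) by auto
          then have "rmul T (s j) (s (Suc i)) = s i" using L i j Under e by blast
          then have "inv (rmul T (s j)) (s i) = s (Suc i)" by (simp add: inv_rmul_eq_iff[OF sj])
          then show ?thesis using False by (simp add: semiarc_step_def Under act_def fX)
        qed
      qed
    qed
  next
    assume R: ?R
    have "rmul T (s j) (s i) = s (Suc i)"
      if "i < length w" "j < length w" "w ! i = Under X 1" "w ! j = Over X 1" for i j X
      using R[rule_format, OF that(1)] that(3) f[OF that(2,4)] by (simp add: semiarc_step_def act_def)
    moreover have "rmul T (s j) (s (Suc i)) = s i"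
      if "i < length w" "j < length w" "w ! i = Under X (-1)" "w ! j = Over X (-1)" for i j X
    proof -
      have "s (Suc i) = inv (rmul T (s j)) (s i)"
        using R[rule_format, OF that(1)] that(3) f[OF that(2,4)] by (simp add: semiarc_step_def act_def)
      then show ?thesis using rmul_inv_rmul[OF sin[of j]] that(2) by simp
    qed
    ultimately show ?L by blast
  qed
  finally show ?thesis .
qed

text \<open>The base colour is that of arc \<open>0\<close>, and the label colours are those of the
  arcs at the over letters. Conversely, walking along the code visits every arc, so these data
  determine all arc colours.\<close>

lemma card_respecting_crossing_relations:
  assumes g: "gauss_code w"
  shows "card (respecting (arcs w) (crossing_relations w) T) = card (colourings T w)"
proof -
  let ?L = "crossing ` set w"
  let ?over = "\<lambda>j X. j < length w \<and> (\<exists>\<epsilon>. w ! j = Over X \<epsilon>)"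
  define pos where "pos = (\<lambda>X. THE j. ?over j X)"
  have pos_eq: "pos X = j" if "j < length w" "w ! j = Over X \<epsilon>" for j X \<epsilon>
    unfolding pos_def
  proof (rule the_equality)
    show "?over j X" using that by blast
    show "i = j" if "?over i X" for i
      using that gauss_code_over_unique[OF g, of i j X _ \<epsilon>] \<open>j < length w\<close> \<open>w ! j = Over X \<epsilon>\<close> by blast
  qed
  have pos: "?over (pos X) X" if "X \<in> ?L" for X
  proof -
    obtain \<epsilon> where "Over X \<epsilon> \<in> set w" using gauss_codeE[OF g \<open>X \<in> ?L\<close>] by metis
    then obtain j where "j < length w" "w ! j = Over X \<epsilon>" by (auto simp: in_set_conv_nth)
    then show ?thesis using pos_eq by auto
  qed
  have cr: "X \<in> ?L" if "j < length w" "w ! j = Over X \<epsilon>" for j X \<epsilon>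
    using nth_mem[OF that(1)] that(2) by (force simp: image_iff)
  let ?F = "\<lambda>c. (c 0, \<lambda>X\<in>?L. c (arc_at w (pos X)))"
  let ?R = "respecting (arcs w) (crossing_relations w) T"
  have arc0: "arc_at w 0 = 0" "arc_at w (length w) = 0" by (simp_all add: arc_at_def num_under_def)
  have steps: "\<forall>i<length w. semiarc_step T (snd (?F c)) (w ! i) (c (arc_at w i)) (c (arc_at w (Suc i)))"
    if c: "c \<in> ?R" for c
  proof -
    have "c \<in> arcs w \<rightarrow>\<^sub>E carrier T" using c by (simp add: respecting_def)
    from respecting_crossing_relations_iff[OF g this, of "\<lambda>i. c (arc_at w i)" "snd (?F c)"] c
    show ?thesis by (simp add: pos_eq cr)
  qed
  have "bij_betw ?F ?R (colourings T w)"
    unfolding bij_betw_def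
  proof
    show "inj_on ?F ?R"
    proof (rule inj_onI)
      fix c d assume c: "c \<in> ?R" and d: "d \<in> ?R" and e: "?F c = ?F d"
      have "c k = d k" if "k \<in> arcs w" for k
      proof -
        obtain i where i: "i \<le> length w" "num_under (take i w) = k" using ex_arc_at[OF \<open>k \<in> arcs w\<close>] by blast
        have "c (arc_at w i) = d (arc_at w i)"
          by (rule semiarcs_unique[OF steps[OF c] steps[OF d, folded e] _ i(1)]) (use e arc0 in simp)
        then show ?thesis using arc_at_eq[OF that i(2)] by simp
      qed
      then show "c = d" using c d by (auto simp: respecting_def intro: PiE_ext)
    qed
    show "?F ` ?R = colourings T w"
    proof (intro equalityI subsetI)
      fix p assume "p \<in> ?F ` ?R"
      then obtain c where c: "c \<in> ?R" and p: "p = ?F c" by blast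
      have cc: "c (arc_at w i) \<in> carrier T" for i
        using c arc_at_in_arcs[of w i] by (auto simp: respecting_def)
      have "walk T (snd (?F c)) w (c 0) (c 0)"
        unfolding walk_iff_semiarcs
        by (rule exI[of _ "\<lambda>i. c (arc_at w i)"]) (use steps[OF c] arc0 in simp)
      then show "p \<in> colourings T w" using cc[of 0] cc by (simp add: p colourings_def arc0)
    next
      fix p assume "p \<in> colourings T w"
      then obtain a f s where p: "p = (a, f)" and f: "f \<in> ?L \<rightarrow>\<^sub>E carrier T"
        and s: "s 0 = a" "s (length w) = a"
        and st: "\<forall>i<length w. semiarc_step T f (w ! i) (s i) (s (Suc i))"
        and sin: "\<And>i. i \<le> length w \<Longrightarrow> s i \<in> carrier T"
        using colourings_semiarcs by (metis prod.collapse)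
      \<comment> \<open>Between two positions with the same number of preceding undercrossings there
        are only over letters, which keep the colour.\<close>
      have same: "s j = s i" if "j \<le> length w" "i \<le> j" "num_under (take i w) = num_under (take j w)" for i j
        using that(2,1,3)
      proof (induction j rule: dec_induct)
        case (step j)
        have "num_under (take i w) \<le> num_under (take j w)" using num_under_take_mono step by blast
        moreover have "num_under (take j w) \<le> num_under (take (Suc j) w)" using num_under_take_mono by simp
        ultimately have "num_under (take i w) = num_under (take j w)"
          "num_under (take (Suc j) w) = num_under (take j w)" using step.prems by auto
        moreover from this have "\<not> is_under (w ! j)"
          using num_under_take_Suc[of j w] step.prems by (auto split: if_splits)
        ultimately show ?case using step st[rule_format, of j]
          by (cases "w ! j") (auto simp: semiarc_step_def)
      qed simp
      define ix where "ix = (\<lambda>k. SOME i. i \<le> length w \<and> num_under (take i w) = k)"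
      have ix: "ix k \<le> length w \<and> num_under (take (ix k) w) = k" if "k \<in> arcs w" for k
        unfolding ix_def by (rule someI_ex) (use ex_arc_at[OF that] in blast)
      define c where "c = (\<lambda>k\<in>arcs w. s (ix k))"
      have sc: "s i = c (arc_at w i)" if i: "i \<le> length w" for i
      proof -
        have ci: "c (arc_at w i) = s (ix (arc_at w i))" using arc_at_in_arcs by (simp add: c_def)
        note I = ix[OF arc_at_in_arcs, of i]
        have eqs: "s i = s j" if "i \<le> length w" "j \<le> length w" "num_under (take i w) = num_under (take j w)" for i j
        proof (cases "i \<le> j")
          case True
          show ?thesis by (rule same[OF that(2) True that(3), symmetric])
        next
          case False
          then show ?thesis by (intro same[OF that(1) _ that(3)[symmetric]]) simp
        qed
        show ?thesis
        proof (cases "num_under (take i w) = num_under w")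
          \<comment> \<open>After the last undercrossing, or if there is none, the arc number is
            \<open>0\<close> by reduction modulo \<open>num_under w\<close>; agreement comes from
            the closing condition \<open>s (length w) = s 0\<close>.\<close>
          case True
          then have "arc_at w i = 0" by (simp add: arc_at_def)
          moreover have "s i = s (length w)" by (rule eqs) (use i True in auto)
          moreover have "s (ix 0) = s 0" by (rule eqs) (use I \<open>arc_at w i = 0\<close> in \<open>auto simp: num_under_def\<close>)
          ultimately show ?thesis using ci s by simp
        next
          case False
          then have "num_under (take i w) < num_under w" using num_under_take_le[of i w] by simp
          then have "arc_at w i = num_under (take i w)" by (simp add: arc_at_def)
          then have "s i = s (ix (arc_at w i))" using I by (intro eqs) (use i in auto)
          then show ?thesis using ci by simp
        qed
      qed
      have cP: "c \<in> arcs w \<rightarrow>\<^sub>E carrier T" using sin ix by (auto simp: c_def)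
      have fs: "f X = s j" if "j < length w" "w ! j = Over X \<epsilon>" for j X \<epsilon>
        using st[rule_format, OF that(1)] that(2) by (simp add: semiarc_step_def)
      have "c \<in> ?R"
        by (rule iffD2[OF respecting_crossing_relations_iff[OF g cP, of s f] st]) (simp_all add: sc fs)
      moreover have "p = ?F c"
      proof -
        have "a = c 0" using sc[of 0] s arc0 by simp
        moreover have "f = (\<lambda>X\<in>?L. c (arc_at w (pos X)))"
        proof
          fix X show "f X = (\<lambda>X\<in>?L. c (arc_at w (pos X))) X"
            using f pos[of X] fs[of "pos X" X] sc[of "pos X"]
            by (cases "X \<in> ?L") (auto simp: PiE_def extensional_def)
        qed
        ultimately show ?thesis by (simp add: p)
      qed
      ultimately show "p \<in> ?F ` ?R" by blast
    qed
  qed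
  then show ?thesis by (rule bij_betw_same_card)
qed

lemma QD_colourings:
  "gauss_code w \<Longrightarrow> QD T w = int (card (colourings T w)) - int (card (colourings T (map swap_letter w)))"
  by (simp add: QD_def lower_quandle_def upper_quandle_def card_qhom_presented
      card_respecting_crossing_relations gauss_code_swap)

lemma QD_virtual_isotopy:
  assumes "(w, w') \<in> virtual_isotopy" shows "QD T w = QD T w'"
proof -
  have step: "QD T x = QD T y" if "gauss_code x" "gauss_code y" "code_step x y" for x y
    using that card_colourings_step card_colourings_swap_step by (simp add: QD_colourings)
  have "equivclp (\<lambda>x y. gauss_code x \<and> gauss_code y \<and> code_step x y) w w'"
    using assms by (simp add: virtual_isotopy_def)
  then show ?thesis
    by (induction rule: equivclp_induct) (auto dest: step)
qed

end

section \<open>Gluing local region colourings\<close>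

text \<open>Density of the complement of \<open>D\<close> makes the local value at each point of
  \<open>S\<close> unique, even at points of \<open>D\<close>. It is thus a locally constant
  function on all of \<open>S\<close>, although \<open>S - D\<close> may be disconnected.\<close>

lemma locally_constant_off_dense:
  fixes S D :: "'b::topological_space set" and r :: "'b \<Rightarrow> 'c"
  assumes S: "connected S" and dense: "\<And>U. open U \<Longrightarrow> U \<noteq> {} \<Longrightarrow> U - D \<noteq> {}"
    and loc: "\<And>Q. Q \<in> S \<Longrightarrow> \<exists>k. \<forall>\<^sub>F Z in nhds Q. Z \<notin> D \<longrightarrow> r Z = k"
  shows "\<exists>k. \<forall>Z\<in>S - D. r Z = k"
proof -
  have uniq: "k = k'" if "\<forall>\<^sub>F Z in nhds Q. Z \<notin> D \<longrightarrow> r Z = k" "\<forall>\<^sub>F Z in nhds Q. Z \<notin> D \<longrightarrow> r Z = k'" for Q k k'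
  proof -
    have "\<forall>\<^sub>F Z in nhds Q. Z \<notin> D \<longrightarrow> k = k'"
      using that by eventually_elim auto
    then obtain U where "open U" "Q \<in> U" "\<forall>Z\<in>U. Z \<notin> D \<longrightarrow> k = k'"
      unfolding eventually_nhds by blast
    then show ?thesis using dense[of U] by blast
  qed
  define R where "R = (\<lambda>Q. SOME k. \<forall>\<^sub>F Z in nhds Q. Z \<notin> D \<longrightarrow> r Z = k)"
  have R: "\<forall>\<^sub>F Z in nhds Q. Z \<notin> D \<longrightarrow> r Z = R Q" if "Q \<in> S" for Q
    unfolding R_def by (rule someI_ex[OF loc[OF that]])
  have "R constant_on S"
  proof (rule locally_constant_imp_constant[OF S])
    fix Q assume Q: "Q \<in> S"
    then obtain U where U: "open U" "Q \<in> U" "\<forall>Z\<in>U. Z \<notin> D \<longrightarrow> r Z = R Q"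
      using R unfolding eventually_nhds by meson
    have "R Q' = R Q" if "Q' \<in> S \<inter> U" for Q'
    proof (rule uniq)
      show "\<forall>\<^sub>F Z in nhds Q'. Z \<notin> D \<longrightarrow> r Z = R Q'" using R that by simp
      show "\<forall>\<^sub>F Z in nhds Q'. Z \<notin> D \<longrightarrow> r Z = R Q"
        unfolding eventually_nhds using U that by blast
    qed
    then show "\<exists>V. openin (top_of_set S) V \<and> Q \<in> V \<and> (\<forall>Q'\<in>V. R Q' = R Q)"
      using U(2) Q openin_open_Int[OF U(1), of S] by (intro exI[of _ "S \<inter> U"]) blast
  qed
  then obtain k where "\<forall>Q\<in>S. R Q = k" by (auto simp: constant_on_def)
  moreover have "r Z = R Z" if "Z \<in> S - D" for Z
    using eventually_nhds_x_imp_x[OF R] that by blast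
  ultimately show ?thesis by auto
qed

section \<open>Region colourings and their gluing over rectangles\<close>

definition open_rect :: "real \<Rightarrow> real \<Rightarrow> real \<Rightarrow> real \<Rightarrow> complex set" where
  "open_rect a b c d = {Z. a < Re Z \<and> Re Z < b \<and> c < Im Z \<and> Im Z < d}"

lemma open_rect_eq: "open_rect a b c d = Re -` {a<..<b} \<inter> Im -` {c<..<d}"
  by (auto simp: open_rect_def)

lemma open_open_rect: "open (open_rect a b c d)"
  unfolding open_rect_eq by (intro open_Int open_vimage continuous_intros open_greaterThanLessThan)

lemma connected_open_rect: "connected (open_rect a b c d)"
  unfolding open_rect_eq
  by (intro convex_connected convex_Int convex_linear_vimage bounded_linear.linear
      bounded_linear_Re bounded_linear_Im) auto

lemma open_rect_Int:
  "open_rect a b c d \<inter> open_rect a' b' c' d' = open_rect (max a a') (min b b') (max c c') (min d d')"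
  by (auto simp: open_rect_def)

text \<open>\<open>D\<close> is the diagram with vertices and crossings \<open>F\<close>. The element \<open>side Q Z\<close> relates the region
  containing a point \<open>Z\<close> near \<open>Q\<close> to the region on the left of the diagram at \<open>Q\<close>.\<close>

locale region_gluing =
  fixes D F :: "complex set" and side :: "complex \<Rightarrow> complex \<Rightarrow> 'a \<Rightarrow> 'a" and T :: "'a magma"
  assumes F: "finite F" "F \<subseteq> D"
    and dense: "\<And>U. open U \<Longrightarrow> U \<noteq> {} \<Longrightarrow> U - D \<noteq> {}"
    and side: "side Q Z \<in> qaut T"
begin

definition germ :: "(complex \<Rightarrow> 'a \<Rightarrow> 'a) \<Rightarrow> ('a \<Rightarrow> 'a) \<Rightarrow> complex \<Rightarrow> bool" where
  "germ g h Q \<longleftrightarrow> (\<forall>\<^sub>F Z in nhds Q. Z \<notin> D \<longrightarrow> g Z = h \<circ> side Q Z)"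

text \<open>Germs are required off the finite set \<open>F\<close> only. A connected open set of the
  plane remains connected without \<open>F\<close>, so these conditions still link all
  values.\<close>

definition region_colouring :: "complex set \<Rightarrow> (complex \<Rightarrow> 'a \<Rightarrow> 'a) \<Rightarrow> bool" where
  "region_colouring S g \<longleftrightarrow> (\<forall>Z\<in>S - D. g Z \<in> qaut T) \<and> (\<forall>Q\<in>S - F. \<exists>h\<in>qaut T. germ g h Q)"

lemma region_colouring_mono: "region_colouring S g \<Longrightarrow> S' \<subseteq> S \<Longrightarrow> region_colouring S' g"
  by (auto simp: region_colouring_def)

lemma germ_comp: "germ g h Q \<Longrightarrow> germ (\<lambda>Z. c \<circ> g Z) (c \<circ> h) Q"
  unfolding germ_def by (elim eventually_mono) (auto simp: o_assoc)

lemma region_colouring_comp: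
  "region_colouring S g \<Longrightarrow> c \<in> qaut T \<Longrightarrow> region_colouring S (\<lambda>Z. c \<circ> g Z)"
  unfolding region_colouring_def using germ_comp comp_in_qaut by blast

lemma germ_cong:
  assumes "germ g h Q" "open U" "Q \<in> U" "\<And>Z. Z \<in> U - D \<Longrightarrow> f Z = g Z"
  shows "germ f h Q"
proof -
  have "\<forall>\<^sub>F Z in nhds Q. Z \<in> U" using assms eventually_nhds by blast
  then show ?thesis using assms(1) unfolding germ_def
    by eventually_elim (use assms(4) in auto)
qed

lemma germ_unique:
  assumes "germ g h Q" "germ g h' Q" shows "h = h'"
proof -
  have "\<forall>\<^sub>F Z in nhds Q. Z \<notin> D \<longrightarrow> h \<circ> side Q Z = h' \<circ> side Q Z"
    using assms unfolding germ_def by eventually_elim auto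
  then obtain U where U: "open U" "Q \<in> U" "\<forall>Z\<in>U. Z \<notin> D \<longrightarrow> h \<circ> side Q Z = h' \<circ> side Q Z"
    unfolding eventually_nhds by blast
  then obtain Z where "h \<circ> side Q Z = h' \<circ> side Q Z" using dense[of U] by blast
  then have "h \<circ> (side Q Z \<circ> inv (side Q Z)) = h' \<circ> (side Q Z \<circ> inv (side Q Z))"
    by (simp add: o_assoc)
  then show ?thesis using qaut_bij[OF side, of Q Z] by (simp add: bij_def surj_iff)
qed

text \<open>In \<open>f Z \<circ> inv (g Z)\<close> the two factors \<open>side Q Z\<close> stand
  next to each other and cancel. The ratio therefore does not jump across the diagram and is
  constant off \<open>D\<close>, because \<open>S - F\<close> is connected.\<close>

lemma region_colouring_ratio:
  assumes S: "open S" "connected S" and f: "region_colouring S f" and g: "region_colouring S g"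
    and T: "quandle T"
  shows "\<exists>c\<in>qaut T. \<forall>Z\<in>S - D. f Z = c \<circ> g Z"
proof -
  interpret quandle_loc T by unfold_locales (rule T)
  have "connected (S - F)"
    by (rule connected_open_delete_finite) (use S F in auto)
  then have "\<exists>k. \<forall>Z\<in>(S - F) - D. f Z \<circ> inv (g Z) = k"
  proof (rule locally_constant_off_dense[OF _ dense])
    fix Q assume Q: "Q \<in> S - F"
    then obtain h h' where h: "h \<in> qaut T" "germ f h Q" "h' \<in> qaut T" "germ g h' Q"
      using f g unfolding region_colouring_def by meson
    have "\<forall>\<^sub>F Z in nhds Q. Z \<notin> D \<longrightarrow> f Z \<circ> inv (g Z) = h \<circ> inv h'"
      using h(2,4) unfolding germ_def
    proof eventually_elim
      case (elim Z)
      show ?case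
      proof
        assume "Z \<notin> D"
        then have "f Z \<circ> inv (g Z) = h \<circ> (side Q Z \<circ> inv (side Q Z)) \<circ> inv h'"
          using elim o_inv_distrib[OF qaut_bij[OF h(3)] qaut_bij[OF side, of Q Z]] by (simp add: o_assoc)
        then show "f Z \<circ> inv (g Z) = h \<circ> inv h'"
          using qaut_bij[OF side, of Q Z] by (simp add: bij_def surj_iff)
      qed
    qed
    then show "\<exists>k. \<forall>\<^sub>F Z in nhds Q. Z \<notin> D \<longrightarrow> f Z \<circ> inv (g Z) = k" by blast
  qed
  then obtain k where k: "\<And>Z. Z \<in> S - D \<Longrightarrow> f Z \<circ> inv (g Z) = k" using F by auto
  show ?thesis
  proof (cases "S - D = {}")
    case True
    then show ?thesis using id_in_qaut by blast
  next
    case False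
    then obtain Z where "Z \<in> S - D" by blast
    then have "k \<in> qaut T"
      using k[of Z] f g comp_in_qaut[OF _ inv_in_qaut] unfolding region_colouring_def by metis
    moreover have "f Z = k \<circ> g Z" if "Z \<in> S - D" for Z
    proof -
      have "bij (g Z)" using g that qaut_bij unfolding region_colouring_def by blast
      then show ?thesis using k[OF that] by (auto simp: bij_def o_assoc[symmetric])
    qed
    ultimately show ?thesis by blast
  qed
qed

text \<open>On the connected overlap the two solutions differ by a constant left factor; absorbing
  this factor into \<open>g\<close> makes them agree there.\<close>

lemma region_colouring_Un:
  assumes f: "region_colouring U f" and g: "region_colouring V g"
    and o: "open U" "open V" "connected (U \<inter> V)" and T: "quandle T"
  shows "\<exists>h. region_colouring (U \<union> V) h"
proof -
  obtain c where c: "c \<in> qaut T" "\<And>Z. Z \<in> U \<inter> V - D \<Longrightarrow> f Z = c \<circ> g Z"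
    using region_colouring_ratio[of "U \<inter> V" f g] region_colouring_mono[OF f] region_colouring_mono[OF g] o T
    by (metis Int_lower1 Int_lower2 open_Int)
  let ?h = "\<lambda>Z. if Z \<in> U then f Z else c \<circ> g Z"
  have cg: "region_colouring V (\<lambda>Z. c \<circ> g Z)" by (rule region_colouring_comp[OF g c(1)])
  have "\<exists>h\<in>qaut T. germ ?h h Q" if Q: "Q \<in> U \<union> V - F" for Q
  proof (cases "Q \<in> U")
    case True
    then obtain h where "h \<in> qaut T" "germ f h Q" using f Q unfolding region_colouring_def by blast
    then show ?thesis using germ_cong[of f h Q U ?h] True o by auto
  next
    case False
    then obtain h where "h \<in> qaut T" "germ (\<lambda>Z. c \<circ> g Z) h Q"
      using cg Q unfolding region_colouring_def by blast
    moreover have "germ ?h h Q"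
      by (rule germ_cong[OF \<open>germ (\<lambda>Z. c \<circ> g Z) h Q\<close> o(2)]) (use False Q c(2) in auto)
    ultimately show ?thesis by blast
  qed
  then have "region_colouring (U \<union> V) ?h"
    using f cg unfolding region_colouring_def by auto
  then show ?thesis by blast
qed

text \<open>An intersection of axis-parallel open rectangles is such a rectangle or empty, hence
  connected. This is where the topology of the plane enters the gluing.\<close>

lemma region_colouring_Un_rect:
  assumes T: "quandle T"
    and g: "region_colouring (open_rect a b c d) g" "region_colouring (open_rect a' b' c' d') g'"
    and "a \<le> p" "q \<le> b" "c \<le> r" "s \<le> d" "a' \<le> p'" "q' \<le> b'" "c' \<le> r'" "s' \<le> d'"
  shows "\<exists>h. region_colouring (open_rect p q r s \<union> open_rect p' q' r' s') h"
proof (rule region_colouring_Un[OF _ _ open_open_rect open_open_rect _ T])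
  show "region_colouring (open_rect p q r s) g"
    by (rule region_colouring_mono[OF g(1)]) (use assms in \<open>auto simp: open_rect_def\<close>)
  show "region_colouring (open_rect p' q' r' s') g'"
    by (rule region_colouring_mono[OF g(2)]) (use assms in \<open>auto simp: open_rect_def\<close>)
  show "connected (open_rect p q r s \<inter> open_rect p' q' r' s')"
    unfolding open_rect_Int by (rule connected_open_rect)
qed

text \<open>Bisection in one coordinate at a time: small rectangles are glued into thin columns, and
  columns into the whole rectangle. Each piece is kept a little larger than the interval it covers,
  so that neighbouring pieces overlap in an open set.\<close>

lemma region_colouring_rect:
  assumes loc: "\<And>P. \<exists>e>0. \<exists>g. region_colouring (ball P e) g" and T: "quandle T"
    and ab: "a \<le> b" and cd: "c \<le> d"
  shows "\<exists>g. region_colouring (open_rect a b c d) g"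
proof -
  have column: "\<exists>e>0. \<exists>g. region_colouring (open_rect (x - e) (x + e) (c - e) (d + e)) g" for x
    using cd
  proof (rule Bolzano)
    fix p q r
    assume "\<exists>e>0. \<exists>g. region_colouring (open_rect (x - e) (x + e) (p - e) (q + e)) g"
      and "\<exists>e>0. \<exists>g. region_colouring (open_rect (x - e) (x + e) (q - e) (r + e)) g"
      and pqr: "p \<le> q" "q \<le> r"
    then obtain e1 e2 g1 g2 where e: "e1 > 0" "e2 > 0"
      and g: "region_colouring (open_rect (x - e1) (x + e1) (p - e1) (q + e1)) g1"
        "region_colouring (open_rect (x - e2) (x + e2) (q - e2) (r + e2)) g2" by blast
    define e where "e = min e1 e2"
    have e0: "e > 0" "e \<le> e1" "e \<le> e2" using e by (auto simp: e_def)
    obtain h where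
      "region_colouring (open_rect (x - e) (x + e) (p - e) (q + e) \<union> open_rect (x - e) (x + e) (q - e) (r + e)) h"
      using region_colouring_Un_rect[OF T g, of "x - e" "x + e" "p - e" "q + e" "x - e" "x + e" "q - e" "r + e"] e0
      by auto
    then have "region_colouring (open_rect (x - e) (x + e) (p - e) (r + e)) h"
      by (rule region_colouring_mono) (use e0 pqr in \<open>auto simp: open_rect_def\<close>)
    then show "\<exists>e>0. \<exists>g. region_colouring (open_rect (x - e) (x + e) (p - e) (r + e)) g"
      using e0 by blast
  next
    fix y
    obtain e g where e: "e > 0" and g: "region_colouring (ball (Complex x y) e) g" using loc by blast
    have "\<exists>e'>0. \<exists>g. region_colouring (open_rect (x - e') (x + e') (p - e') (q + e')) g"
      if "p \<le> y" "y \<le> q" "q - p < e / 4" for p q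
    proof (intro exI conjI)
      show "region_colouring (open_rect (x - e / 8) (x + e / 8) (p - e / 8) (q + e / 8)) g"
      proof (rule region_colouring_mono[OF g], rule subsetI)
        fix Z assume Z: "Z \<in> open_rect (x - e / 8) (x + e / 8) (p - e / 8) (q + e / 8)"
        then have "x - e / 8 < Re Z" "Re Z < x + e / 8" "p - e / 8 < Im Z" "Im Z < q + e / 8"
          by (simp_all add: open_rect_def)
        then have "\<bar>x - Re Z\<bar> < e / 2" "\<bar>y - Im Z\<bar> < e / 2"
          using that e by linarith+
        then show "Z \<in> ball (Complex x y) e"
          using cmod_le[of "Complex x y - Z"] by (simp add: dist_norm)
      qed
    qed (use e in simp)
    then show "\<exists>d>0. \<forall>p q. p \<le> y \<and> y \<le> q \<and> q - p < d \<longrightarrow>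
        (\<exists>e>0. \<exists>g. region_colouring (open_rect (x - e) (x + e) (p - e) (q + e)) g)"
      using e by (intro exI[of _ "e / 4"]) auto
  qed
  have "\<exists>e>0. \<exists>g. region_colouring (open_rect (a - e) (b + e) (c - e) (d + e)) g"
    using ab
  proof (rule Bolzano)
    fix p q r
    assume "\<exists>e>0. \<exists>g. region_colouring (open_rect (p - e) (q + e) (c - e) (d + e)) g"
      and "\<exists>e>0. \<exists>g. region_colouring (open_rect (q - e) (r + e) (c - e) (d + e)) g"
      and pqr: "p \<le> q" "q \<le> r"
    then obtain e1 e2 g1 g2 where e: "e1 > 0" "e2 > 0"
      and g: "region_colouring (open_rect (p - e1) (q + e1) (c - e1) (d + e1)) g1"
        "region_colouring (open_rect (q - e2) (r + e2) (c - e2) (d + e2)) g2" by blast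
    define e where "e = min e1 e2"
    have e0: "e > 0" "e \<le> e1" "e \<le> e2" using e by (auto simp: e_def)
    obtain h where
      "region_colouring (open_rect (p - e) (q + e) (c - e) (d + e) \<union> open_rect (q - e) (r + e) (c - e) (d + e)) h"
      using region_colouring_Un_rect[OF T g, of "p - e" "q + e" "c - e" "d + e" "q - e" "r + e" "c - e" "d + e"] e0
      by auto
    then have "region_colouring (open_rect (p - e) (r + e) (c - e) (d + e)) h"
      by (rule region_colouring_mono) (use e0 pqr in \<open>auto simp: open_rect_def\<close>)
    then show "\<exists>e>0. \<exists>g. region_colouring (open_rect (p - e) (r + e) (c - e) (d + e)) g"
      using e0 by blast
  next
    fix x
    obtain e g where e: "e > 0" and g: "region_colouring (open_rect (x - e) (x + e) (c - e) (d + e)) g"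
      using column by blast
    have "\<exists>e'>0. \<exists>g. region_colouring (open_rect (p - e') (q + e') (c - e') (d + e')) g"
      if "p \<le> x" "x \<le> q" "q - p < e / 2" for p q
    proof (intro exI conjI)
      show "region_colouring (open_rect (p - e / 2) (q + e / 2) (c - e / 2) (d + e / 2)) g"
        by (rule region_colouring_mono[OF g]) (use that e in \<open>auto simp: open_rect_def\<close>)
    qed (use e in simp)
    then show "\<exists>d'>0. \<forall>p q. p \<le> x \<and> x \<le> q \<and> q - p < d' \<longrightarrow>
        (\<exists>e>0. \<exists>g. region_colouring (open_rect (p - e) (q + e) (c - e) (d + e)) g)"
      using e by (intro exI[of _ "e / 2"]) auto
  qed
  then obtain e g where "e > 0" and g: "region_colouring (open_rect (a - e) (b + e) (c - e) (d + e)) g"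
    by blast
  then have "region_colouring (open_rect a b c d) g"
    by (intro region_colouring_mono[OF g]) (auto simp: open_rect_def)
  then show ?thesis by blast
qed

end

section \<open>Geometry of regular polygons\<close>

text \<open>The determinant of \<open>a\<close> and \<open>b\<close>, positive when \<open>b\<close>
  points to the left of \<open>a\<close>.\<close>

definition wedge :: "complex \<Rightarrow> complex \<Rightarrow> real" where
  "wedge a b = Re a * Im b - Im a * Re b"

lemma wedge_commute: "wedge a b = - wedge b a"
  by (simp add: wedge_def)

lemma wedge_self [simp]: "wedge a a = 0"
  by (simp add: wedge_def)

lemma wedge_eq_0:
  assumes "a \<noteq> 0" "wedge a b = 0"
  shows "b = of_real (Re (cnj a * b) / (cmod a)\<^sup>2) * a"
proof -
  have n: "(cmod a)\<^sup>2 = Re a * Re a + Im a * Im a" "(cmod a)\<^sup>2 \<noteq> 0"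
    using assms(1) cmod_power2[of a] by (simp_all add: power2_eq_square complex_eq_iff)
  have w: "Re a * Im b = Im a * Re b" using assms(2) by (simp add: wedge_def)
  have "Re b * (cmod a)\<^sup>2 = Re (cnj a * b) * Re a"
  proof -
    have "Re b * (cmod a)\<^sup>2 = Re a * Re a * Re b + Im a * (Im a * Re b)" by (simp add: n algebra_simps)
    then show ?thesis unfolding w[symmetric] by (simp add: algebra_simps)
  qed
  moreover have "Im b * (cmod a)\<^sup>2 = Re (cnj a * b) * Im a"
  proof -
    have "Im b * (cmod a)\<^sup>2 = Re a * (Re a * Im b) + Im a * Im a * Im b" by (simp add: n algebra_simps)
    then show ?thesis unfolding w by (simp add: algebra_simps)
  qed
  ultimately show ?thesis using n(2) by (simp add: complex_eq_iff field_simps)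
qed

lemma crossing_sign_wedge:
  "crossing_sign p i j = (if wedge (vertex p (Suc i) - vertex p i) (vertex p (Suc j) - vertex p j) > 0 then 1 else -1)"
  by (simp add: crossing_sign_def wedge_def Let_def)

locale polygon =
  fixes p :: "complex list"
  assumes regular: "regular_polygon p"
begin

abbreviation "n \<equiv> length p"
abbreviation "V \<equiv> vertex p"
abbreviation "E \<equiv> edge p"
abbreviation nxt :: "nat \<Rightarrow> nat" where "nxt i \<equiv> Suc i mod n"

definition dir :: "nat \<Rightarrow> complex" where "dir i = V (Suc i) - V i"

definition pt :: "nat \<Rightarrow> real \<Rightarrow> complex" where "pt i t = V i + of_real t * dir i"

text \<open>The edge parameter of the orthogonal projection of \<open>Z\<close> to the line through
  edge \<open>i\<close>. It is continuous on the whole plane, so it can also be used at points near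
  the edge.\<close>

definition tt :: "nat \<Rightarrow> complex \<Rightarrow> real" where
  "tt i Z = Re (cnj (dir i) * (Z - V i)) / (cmod (dir i))\<^sup>2"

text \<open>\<open>cr i\<close> is positive to the left of the line through edge \<open>i\<close>.\<close>

definition cr :: "nat \<Rightarrow> complex \<Rightarrow> real" where "cr i Z = wedge (dir i) (Z - V i)"

definition D :: "complex set" where "D = (\<Union>i<n. E i)"

definition F :: "complex set" where
  "F = V ` {..<n} \<union> (\<Union>i<n. \<Union>j\<in>{..<n} - {i}. E i \<inter> E j)"

lemma n3: "3 \<le> n" and n_pos: "0 < n" and p_nonempty [simp]: "p \<noteq> []"
  using regular by (auto simp: regular_polygon_def)

lemma nxt_less [simp]: "nxt i < n"
  by simp

lemma V_mod [simp]: "V (i mod n) = V i"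
  by (simp add: vertex_def)

lemma V_Suc_nxt [simp]: "V (Suc (nxt i)) = V (Suc (Suc i))"
  by (metis V_mod mod_Suc_eq)

lemma vertex_on_edge: "i < n \<Longrightarrow> j < n \<Longrightarrow> V i \<in> E j \<Longrightarrow> i = j \<or> i = nxt j"
  using regular by (auto simp: regular_polygon_def)

lemma no_triple: "i < n \<Longrightarrow> j < n \<Longrightarrow> k < n \<Longrightarrow> distinct [i, j, k] \<Longrightarrow> E i \<inter> E j \<inter> E k = {}"
  using regular by (auto simp: regular_polygon_def)

lemma nxt_neq: "i < n \<Longrightarrow> nxt i \<noteq> i" "i < n \<Longrightarrow> nxt (nxt i) \<noteq> i" "i < n \<Longrightarrow> nxt (nxt i) \<noteq> nxt i"
  using n3 by (auto simp: mod_Suc)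

lemma nxt_inj: "i < n \<Longrightarrow> j < n \<Longrightarrow> nxt i = nxt j \<longleftrightarrow> i = j"
  by (auto simp: mod_Suc split: if_splits)

lemma mem_edge: "Z \<in> E i \<longleftrightarrow> (\<exists>t. 0 \<le> t \<and> t \<le> 1 \<and> Z = pt i t)"
  unfolding edge_def in_segment pt_def dir_def scaleR_conv_of_real
  by (auto simp: algebra_simps)

lemma pt_0: "pt i 0 = V i" and pt_1: "pt i 1 = V (Suc i)"
  by (simp_all add: pt_def dir_def)

lemma V_in_edge: "V i \<in> E i" "V (Suc i) \<in> E i"
  by (simp_all add: edge_def)

lemma dir_neq_0: assumes i: "i < n" shows "dir i \<noteq> 0"
proof
  assume "dir i = 0"
  then have "V i \<in> E (nxt i)" using V_in_edge(1)[of "nxt i"] by (simp add: dir_def)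
  then show False using vertex_on_edge[OF i nxt_less] nxt_neq[OF i] by metis
qed

lemma cr_pt [simp]: "cr i (pt i t) = 0"
  by (simp add: cr_def pt_def wedge_def)

lemma tt_pt [simp]: assumes "i < n" shows "tt i (pt i t) = t"
proof -
  have "Re (cnj (dir i) * (pt i t - V i)) = t * (cmod (dir i))\<^sup>2"
    using cmod_power2[of "dir i"] by (simp add: pt_def power2_eq_square algebra_simps)
  then show ?thesis using dir_neq_0[OF assms] by (simp add: tt_def)
qed

lemma cr_eq_0: assumes "i < n" "cr i Z = 0" shows "Z = pt i (tt i Z)"
proof -
  have "Z - V i = of_real (tt i Z) * dir i"
    unfolding tt_def by (rule wedge_eq_0) (use dir_neq_0 assms in \<open>auto simp: cr_def\<close>)
  then show ?thesis by (simp add: pt_def algebra_simps)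
qed

lemma mem_edge_iff: "i < n \<Longrightarrow> Z \<in> E i \<longleftrightarrow> cr i Z = 0 \<and> 0 \<le> tt i Z \<and> tt i Z \<le> 1"
  using cr_eq_0 by (fastforce simp: mem_edge)

lemma cr_pt_diff: "cr j (pt i t) = cr j (pt i s) + (t - s) * wedge (dir j) (dir i)"
  by (simp add: cr_def pt_def wedge_def algebra_simps)

lemma isCont_cr: "isCont (cr i) Z"
  unfolding cr_def wedge_def isCont_def by (intro tendsto_intros)

lemma isCont_tt: "isCont (tt i) Z"
  unfolding tt_def divide_inverse isCont_def by (intro tendsto_intros)

lemma closed_E: "closed (E i)"
  by (simp add: edge_def)

text \<open>If the next edge turned back along edge \<open>i\<close>, the far end of the shorter one
  would lie on the other, against regularity. Parallel consecutive edges therefore continue straight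
  on.\<close>

lemma no_backtracking:
  assumes i: "i < n" and w: "wedge (dir i) (dir (nxt i)) = 0"
  shows "\<exists>c>0. dir (nxt i) = of_real c * dir i"
proof -
  obtain c where c: "dir (nxt i) = of_real c * dir i"
    using wedge_eq_0[OF dir_neq_0[OF i] w] by blast
  have c0: "c \<noteq> 0" using c dir_neq_0[of "nxt i"] by auto
  have "\<not> c < 0"
  proof
    assume neg: "c < 0"
    show False
    proof (cases "c \<ge> -1")
      case True
      have "V (Suc (Suc i)) = pt i (1 + c)"
        using c by (simp add: pt_def dir_def algebra_simps)
      then have "V (nxt (nxt i)) \<in> E i" unfolding mem_edge using neg True
        by (intro exI[of _ "1 + c"]) auto
      then show False using vertex_on_edge[OF nxt_less i] nxt_neq[OF i] by blast
    next
      case False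
      have "V i = pt (nxt i) (- 1 / c)"
        using c0 unfolding pt_def c by (simp add: dir_def)
      then have "V i \<in> E (nxt i)" unfolding mem_edge using False
        by (intro exI[of _ "- 1 / c"]) (auto simp: field_simps)
      then show False using vertex_on_edge[OF i nxt_less] nxt_neq[OF i] by metis
    qed
  qed
  then show ?thesis using c c0 by (intro exI[of _ c]) auto
qed

lemma edge_Int_nxt: assumes i: "i < n" shows "E i \<inter> E (nxt i) = {V (nxt i)}"
proof
  let ?j = "nxt i"
  have Vj: "V ?j = pt i 1" by (simp add: pt_1)
  show "{V ?j} \<subseteq> E i \<inter> E ?j" using V_in_edge[of i] V_in_edge[of ?j] by simp
  show "E i \<inter> E ?j \<subseteq> {V ?j}"
  proof
    fix Z assume Z: "Z \<in> E i \<inter> E ?j"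
    then obtain t where t: "0 \<le> t" "t \<le> 1" "Z = pt ?j t" unfolding Int_iff mem_edge by blast
    have cZ: "cr i Z = 0" "tt i Z \<le> 1" using Z mem_edge_iff[OF i] by auto
    have c0: "cr i (pt ?j 0) = 0" using Vj by (simp add: pt_0)
    have "t = 0"
    proof (cases "wedge (dir i) (dir ?j) = 0")
      case False
      then show ?thesis using cr_pt_diff[of i ?j t 0] c0 cZ t by simp
    next
      case True
      then obtain c where c: "c > 0" "dir ?j = of_real c * dir i" using no_backtracking[OF i] by blast
      have "Z = pt i (1 + t * c)" 
      proof -
        have "Z = V (Suc i) + of_real t * (of_real c * dir i)" using t(3) c(2) by (simp add: pt_def)
        moreover have "V (Suc i) = V i + dir i" by (simp add: dir_def)
        ultimately show ?thesis by (simp add: pt_def algebra_simps)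
      qed
      then have "t * c \<le> 0" using cZ(2) i by simp
      then show ?thesis using t(1) c(1) by (simp add: mult_le_0_iff)
    qed
    then show "Z \<in> {V ?j}" using t by (simp add: pt_0)
  qed
qed

text \<open>No endpoint of either edge lies on the other, so the meeting point is interior to both.
  If the edges were parallel they would overlap on one line; the endpoints of edge \<open>j\<close>
  would then lie beyond both ends of edge \<open>i\<close>, which would put \<open>V i\<close> on
  edge \<open>j\<close>.\<close>

lemma passage_point:
  assumes "(i, j) \<in> passages p"
  obtains s t where "0 < s" "s < 1" "0 < t" "t < 1" "pt i s = pt j t"
    "wedge (dir i) (dir j) \<noteq> 0" "E i \<inter> E j = {pt i s}"
proof -
  have ij: "i < n" "j < n" "i \<noteq> j" "j \<noteq> nxt i" "i \<noteq> nxt j" "E i \<inter> E j \<noteq> {}"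
    using assms by (auto simp: passages_def)
  have noV: "V k \<notin> E j" if "k = i \<or> k = Suc i" for k
  proof
    assume "V k \<in> E j"
    then have "V (k mod n) \<in> E j" by simp
    then have "k mod n = j \<or> k mod n = nxt j" using vertex_on_edge[of "k mod n" j] ij by simp
    then show False using that ij nxt_inj by auto
  qed
  have noV': "V k \<notin> E i" if "k = j \<or> k = Suc j" for k
  proof
    assume "V k \<in> E i"
    then have "V (k mod n) \<in> E i" by simp
    then have "k mod n = i \<or> k mod n = nxt i" using vertex_on_edge[of "k mod n" i] ij by simp
    then show False using that ij nxt_inj by auto
  qed
  obtain Z where Z: "Z \<in> E i" "Z \<in> E j" using ij by blast
  then obtain s t where s: "0 \<le> s" "s \<le> 1" "Z = pt i s" and t: "0 \<le> t" "t \<le> 1" "Z = pt j t"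
    unfolding mem_edge by blast
  have "s \<noteq> 0" "s \<noteq> 1" using noV[of i] noV[of "Suc i"] Z s by (auto simp: pt_0 pt_1)
  moreover have "t \<noteq> 0" "t \<noteq> 1" using noV'[of j] noV'[of "Suc j"] Z t by (auto simp: pt_0 pt_1)
  ultimately have st: "0 < s" "s < 1" "0 < t" "t < 1" using s t by auto
  have w: "wedge (dir i) (dir j) \<noteq> 0"
  proof
    assume "wedge (dir i) (dir j) = 0"
    then obtain c where c: "dir j = of_real c * dir i"
      using wedge_eq_0[OF dir_neq_0[OF ij(1)]] by blast
    have c0: "c \<noteq> 0" using c dir_neq_0[OF ij(2)] by auto
    define a where "a = s - t * c"
    have Vj: "V j = pt i a"
      using s(3) t(3) by (simp add: pt_def c a_def algebra_simps)
    have Vj1: "V (Suc j) = pt i (a + c)"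
    proof -
      have "V (Suc j) = V j + of_real c * dir i" using c by (simp add: dir_def[of j] algebra_simps)
      then show ?thesis using Vj by (simp add: pt_def algebra_simps)
    qed
    have a: "a < 0 \<or> a > 1" using noV'[of j] Vj not_less unfolding mem_edge by blast
    have ac: "a + c < 0 \<or> a + c > 1" using noV'[of "Suc j"] Vj1 not_less unfolding mem_edge by blast
    have "V i = pt j (- a / c)"
      using Vj c c0 unfolding pt_def by simp
    moreover have "0 \<le> - a / c \<and> - a / c \<le> 1"
    proof (cases "c > 0")
      case True
      then have "a < s" "s < a + c" using st by (auto simp: a_def algebra_simps)
      then have "a < 0" "a + c > 1" using a ac st by auto
      then show ?thesis using True by (simp add: field_simps)
    next
      case False
      then have "c < 0" using c0 by simp
      then have "t * c < 0" "c < t * c" using st by (auto simp: mult_pos_neg)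
      then have "s < a" "a + c < s" by (auto simp: a_def)
      then have "a > 1" "a + c < 0" using a ac st by auto
      then show ?thesis using \<open>c < 0\<close> by (simp add: field_simps)
    qed
    ultimately show False using noV[of i] unfolding mem_edge by blast
  qed
  have "E i \<inter> E j = {pt i s}"
  proof
    show "{pt i s} \<subseteq> E i \<inter> E j" using Z s by simp
    show "E i \<inter> E j \<subseteq> {pt i s}"
    proof
      fix Z' assume Z': "Z' \<in> E i \<inter> E j"
      then obtain s' where s': "Z' = pt i s'" unfolding Int_iff mem_edge by blast
      have "cr j (pt i s') = 0" "cr j (pt i s) = 0"
        using Z' Z s s' mem_edge_iff[OF ij(2)] by auto
      then have "s' = s" using cr_pt_diff[of j i s' s] w wedge_commute[of "dir j" "dir i"] by auto
      then show "Z' \<in> {pt i s}" using s' by simp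
    qed
  qed
  then show thesis using that[OF st _ w] s t by simp
qed

lemma passages_sym: "(i, j) \<in> passages p \<Longrightarrow> (j, i) \<in> passages p"
  by (auto simp: passages_def)

lemma edge_Int_cases:
  assumes "i < n" "j < n" "i \<noteq> j" "Z \<in> E i" "Z \<in> E j"
  obtains "j = nxt i" "Z = V (nxt i)" | "i = nxt j" "Z = V (nxt j)" | "(i, j) \<in> passages p"
  using assms edge_Int_nxt[of i] edge_Int_nxt[of j] by (auto simp: passages_def)

lemma finite_F: "finite F"
proof -
  have "finite (E i \<inter> E j)" if "i < n" "j < n" "i \<noteq> j" for i j
  proof (cases "(i, j) \<in> passages p")
    case True
    then show ?thesis by (metis passage_point finite.simps)
  next
    case False
    then have "E i \<inter> E j \<subseteq> {V (nxt i), V (nxt j)}" using that edge_Int_cases[of i j] by blast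
    then show ?thesis by (rule finite_subset) simp
  qed
  then show ?thesis unfolding F_def by (intro finite_UnI finite_imageI finite_UN_I) auto
qed

lemma F_subset_D: "F \<subseteq> D"
  unfolding F_def D_def using V_in_edge by blast

text \<open>Vertices are written as \<open>V (nxt i)\<close> so that the two edges meeting there are
  \<open>i\<close> and \<open>nxt i\<close>, also at vertex \<open>0\<close>.\<close>

lemma F_cases:
  assumes "Z \<in> F"
  obtains i where "i < n" "Z = V (nxt i)" | i j where "(i, j) \<in> passages p" "Z \<in> E i" "Z \<in> E j"
proof -
  have V: "\<exists>i<n. V k = V (nxt i)" if "k < n" for k
  proof (cases k)
    case 0
    then have "nxt (n - 1) = k" using n_pos by (simp add: Suc_diff_1)
    then show ?thesis using n_pos by (intro exI[of _ "n - 1"]) auto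
  next
    case (Suc i)
    then show ?thesis using that by (intro exI[of _ i]) auto
  qed
  from assms consider k where "k < n" "Z = V k" | i j where "i < n" "j < n" "i \<noteq> j" "Z \<in> E i" "Z \<in> E j"
    unfolding F_def by blast
  then show thesis
  proof cases
    case 1
    then show thesis using V that(1) by metis
  next
    case 2
    then show thesis using edge_Int_cases[OF 2] that by metis
  qed
qed

lemma edge_unique: "Q \<notin> F \<Longrightarrow> i < n \<Longrightarrow> j < n \<Longrightarrow> Q \<in> E i \<Longrightarrow> Q \<in> E j \<Longrightarrow> i = j"
  unfolding F_def by blast

lemma not_F_tt:
  assumes "Q \<notin> F" "i < n" "Q \<in> E i" shows "0 < tt i Q" "tt i Q < 1" "Q = pt i (tt i Q)"
proof -
  have e: "cr i Q = 0" "0 \<le> tt i Q" "tt i Q \<le> 1" using mem_edge_iff assms by auto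
  show q: "Q = pt i (tt i Q)" by (rule cr_eq_0[OF assms(2) e(1)])
  have VF: "V k \<in> F" for k
    unfolding F_def by (rule UnI1, rule image_eqI[of _ _ "k mod n"]) simp_all
  have "tt i Q \<noteq> 0"
  proof
    assume "tt i Q = 0"
    then show False using q assms(1) VF[of i] by (simp add: pt_0)
  qed
  moreover have "tt i Q \<noteq> 1"
  proof
    assume "tt i Q = 1"
    then show False using q assms(1) VF[of "Suc i"] by (simp add: pt_1)
  qed
  ultimately show "0 < tt i Q" "tt i Q < 1" using e by auto
qed

text \<open>Segments are null sets in the plane, so finitely many of them cannot cover a nonempty
  open set.\<close>

lemma dense_D: assumes "open U" "U \<noteq> {}" shows "U - D \<noteq> {}"
proof
  assume "U - D = {}"
  then have "U \<subseteq> D" by blast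
  moreover have "negligible D"
    unfolding D_def
  proof (rule negligible_Union, simp, clarify)
    fix i show "negligible (E i)"
    proof -
      have "convex (E i)" by (simp add: edge_def)
      moreover have "interior (E i) = {}"
        unfolding edge_def by (rule interior_closed_segment_ge2) simp
      ultimately show ?thesis using negligible_convex_interior by blast
    qed
  qed
  ultimately show False using assms open_not_negligible negligible_subset by blast
qed

end

section \<open>Local region colourings of a polygon\<close>

lemma eventually_pos:
  "isCont f Q \<Longrightarrow> f Q > 0 \<Longrightarrow> \<forall>\<^sub>F Z in nhds Q. f Z > (0::real)"
  "isCont f Q \<Longrightarrow> f Q < 0 \<Longrightarrow> \<forall>\<^sub>F Z in nhds Q. f Z < (0::real)"
  unfolding isCont_def tendsto_at_iff_tendsto_nhds using order_tendstoD by blast+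

text \<open>At the point \<open>t\<close> of edge \<open>i\<close>, the value of a region colouring on the right of the edge is its
  value on the left composed with \<open>\<gamma> i t\<close>.\<close>

locale polygon_colouring = polygon +
  fixes \<gamma> :: "nat \<Rightarrow> real \<Rightarrow> 'a \<Rightarrow> 'a" and T :: "'a magma"
  assumes quandle_T: "quandle T"
    and gamma_qaut: "\<gamma> i t \<in> qaut T"
    and gamma_regular: "i < n \<Longrightarrow> 0 < t \<Longrightarrow> t < 1 \<Longrightarrow> pt i t \<notin> F \<Longrightarrow>
      \<forall>\<^sub>F t' in nhds t. \<gamma> i t' = \<gamma> i t"
    and gamma_vertex: "i < n \<Longrightarrow>
      \<exists>k. (\<forall>\<^sub>F t in at_left 1. \<gamma> i t = k) \<and> (\<forall>\<^sub>F t in at_right 0. \<gamma> (nxt i) t = k)"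
    and gamma_crossing: "(i, j) \<in> passages p \<Longrightarrow> 0 < s \<Longrightarrow> s < 1 \<Longrightarrow> 0 < t \<Longrightarrow> t < 1 \<Longrightarrow>
      pt i s = pt j t \<Longrightarrow> wedge (dir i) (dir j) > 0 \<Longrightarrow>
      \<exists>bi ai bj aj. (\<forall>\<^sub>F x in at_left s. \<gamma> i x = bi) \<and> (\<forall>\<^sub>F x in at_right s. \<gamma> i x = ai) \<and>
        (\<forall>\<^sub>F x in at_left t. \<gamma> j x = bj) \<and> (\<forall>\<^sub>F x in at_right t. \<gamma> j x = aj) \<and> bi \<circ> bj = aj \<circ> ai"
begin

text \<open>The default \<open>id\<close> at points off the diagram makes the germ condition there
  say that the region colouring is locally constant.\<close>

definition side :: "complex \<Rightarrow> complex \<Rightarrow> 'a \<Rightarrow> 'a" where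
  "side Q Z = (if Q \<in> D - F then
      (let i = THE i. i < n \<and> Q \<in> E i in if cr i Z > 0 then id else \<gamma> i (tt i Q)) else id)"

lemma side_edge:
  assumes "Q \<notin> F" "i < n" "Q \<in> E i"
  shows "side Q Z = (if cr i Z > 0 then id else \<gamma> i (tt i Q))"
proof -
  have "(THE i. i < n \<and> Q \<in> E i) = i"
    using assms edge_unique by (intro the_equality) blast+
  moreover have "Q \<in> D" using assms by (auto simp: D_def)
  ultimately show ?thesis using assms(1) by (simp add: side_def)
qed

sublocale region_gluing D F side T
proof
  show "finite F" by (rule finite_F)
  show "F \<subseteq> D" by (rule F_subset_D)
  show "U - D \<noteq> {}" if "open U" "U \<noteq> {}" for U by (rule dense_D[OF that])
  show "side Q Z \<in> qaut T" for Q Z by (simp add: side_def Let_def gamma_qaut id_in_qaut)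
qed

lemma germ_offI:
  assumes "Q \<notin> D" "\<forall>\<^sub>F Z in nhds Q. g Z = h" shows "germ g h Q"
  using assms(2) unfolding germ_def by eventually_elim (use assms(1) in \<open>simp add: side_def\<close>)

lemma germ_onI:
  assumes "Q \<notin> F" "i < n" "Q \<in> E i"
    and "\<forall>\<^sub>F Z in nhds Q. g Z = h \<circ> (if cr i Z > 0 then id else \<gamma> i (tt i Q))"
  shows "germ g h Q"
  using assms(4) unfolding germ_def by eventually_elim (simp add: side_edge[OF assms(1-3)])

lemma eventually_tt:
  assumes "\<forall>\<^sub>F t in at (tt i Q) within A. P t"
  shows "\<forall>\<^sub>F Z in nhds Q. tt i Z \<noteq> tt i Q \<longrightarrow> tt i Z \<in> A \<longrightarrow> P (tt i Z)"
proof -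
  have "filterlim (tt i) (nhds (tt i Q)) (nhds Q)"
    using isCont_tt[of Q i] unfolding isCont_def tendsto_at_iff_tendsto_nhds .
  then show ?thesis using assms unfolding eventually_at_filter filterlim_iff by blast
qed

lemma eventually_tt_bounds:
  "a < tt i Q \<Longrightarrow> \<forall>\<^sub>F Z in nhds Q. a < tt i Z" "tt i Q < b \<Longrightarrow> \<forall>\<^sub>F Z in nhds Q. tt i Z < b"
  using isCont_tt[of Q i] order_tendstoD unfolding isCont_def tendsto_at_iff_tendsto_nhds by blast+

lemma eventually_off_edges: "\<forall>\<^sub>F Z in nhds Q. \<forall>k<n. Q \<notin> E k \<longrightarrow> Z \<notin> E k"
proof -
  have "\<forall>\<^sub>F Z in nhds Q. Q \<notin> E k \<longrightarrow> Z \<notin> E k" for k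
  proof (cases "Q \<in> E k")
    case False
    then show ?thesis using eventually_nhds_in_open[of "- E k" Q] closed_E
      by (auto elim: eventually_mono simp: open_Compl)
  qed simp
  then have "\<forall>\<^sub>F Z in nhds Q. \<forall>k\<in>{..<n}. Q \<notin> E k \<longrightarrow> Z \<notin> E k"
    by (intro eventually_ball_finite) auto
  then show ?thesis by (simp add: lessThan_iff Ball_def)
qed

lemma const_value_qaut:
  assumes "\<forall>\<^sub>F t in G. \<gamma> i t = k" "G \<noteq> bot" shows "k \<in> qaut T"
  using eventually_happens[OF assms(1)] assms(2) gamma_qaut by metis

lemma eventually_sign:
  "cr i Q \<noteq> 0 \<Longrightarrow> \<forall>\<^sub>F Z in nhds Q. (cr i Z > 0) = (cr i Q > 0)"
  using eventually_pos[OF isCont_cr[of Q i]]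
  by (cases "cr i Q > 0") (auto elim!: eventually_mono)

text \<open>Near such a point the diagram is a single line and \<open>\<gamma> i\<close> is constant
  along it, so two half-planes with values \<open>id\<close> and \<open>\<gamma> i t\<close> form a
  local solution.\<close>

lemma regular_local:
  assumes i: "i < n" and t: "0 < t" "t < 1" and Q0: "pt i t \<notin> F"
  defines "g \<equiv> \<lambda>Z. if cr i Z > 0 then id else \<gamma> i t"
  shows "\<forall>\<^sub>F Q in nhds (pt i t). Q \<notin> F \<longrightarrow> (\<exists>h\<in>qaut T. germ g h Q) \<and> (Q \<in> E i \<longrightarrow> germ g id Q)"
proof -
  let ?P = "pt i t"
  have ti: "tt i ?P = t" using i by simp
  have PE: "?P \<in> E i" using t unfolding mem_edge by (intro exI[of _ t]) simp
  have "\<forall>\<^sub>F x in at (tt i ?P) within UNIV. \<gamma> i x = \<gamma> i t"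
    unfolding ti using gamma_regular[OF i t Q0] by (auto simp: eventually_at_filter elim: eventually_mono)
  from eventually_tt[OF this]
  have G: "\<forall>\<^sub>F Q in nhds ?P. \<gamma> i (tt i Q) = \<gamma> i t" by (auto simp: ti elim: eventually_mono)
  have "\<forall>\<^sub>F Q in nhds ?P. 0 < tt i Q" "\<forall>\<^sub>F Q in nhds ?P. tt i Q < 1"
    using eventually_tt_bounds ti t by simp_all
  with G eventually_off_edges[of ?P] show ?thesis
  proof eventually_elim
    case (elim Q)
    have on: "germ g id Q" if "Q \<notin> F" "Q \<in> E i"
      by (rule germ_onI[OF that(1) i that(2)]) (simp add: g_def elim)
    have off: "\<exists>h\<in>qaut T. germ g h Q" if "Q \<notin> F" "Q \<notin> E i"
    proof -
      have "Q \<notin> E k" if "k < n" for k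
        using elim that edge_unique[OF Q0 i that PE] \<open>Q \<notin> E i\<close> by blast
      then have QD: "Q \<notin> D" by (auto simp: D_def)
      have "cr i Q \<noteq> 0" using that(2) mem_edge_iff[OF i, of Q] elim by auto
      from eventually_sign[OF this] have "\<forall>\<^sub>F Z in nhds Q. g Z = g Q"
        by (rule eventually_mono) (simp add: g_def)
      moreover have "g Q \<in> qaut T" by (simp add: g_def id_in_qaut gamma_qaut)
      ultimately show ?thesis using germ_offI[OF QD] by blast
    qed
    show ?case using on off id_in_qaut by blast
  qed
qed

text \<open>One transition \<open>k\<close> serves both edges near the vertex, so two sectors with
  values \<open>id\<close> and \<open>k\<close> suffice. The case \<kappa> = 0 does occur, since
  regularity allows collinear consecutive edges.\<close>

lemma vertex_local:
  assumes i: "i < n"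
  shows "\<exists>g. (\<forall>Z. g Z \<in> qaut T) \<and> (\<forall>\<^sub>F Q in nhds (V (nxt i)). Q \<notin> F \<longrightarrow>
    (\<exists>h\<in>qaut T. germ g h Q) \<and> (Q \<in> E i \<union> E (nxt i) \<longrightarrow> germ g id Q))"
proof -
  let ?j = "nxt i"
  define P where "P = V ?j"
  obtain k where k: "\<forall>\<^sub>F t in at_left 1. \<gamma> i t = k" "\<forall>\<^sub>F t in at_right 0. \<gamma> ?j t = k"
    using gamma_vertex[OF i] by blast
  have kq: "k \<in> qaut T" by (rule const_value_qaut[OF k(1)]) simp
  have Pi: "P = pt i 1" and Pj: "P = pt ?j 0" by (simp_all add: P_def pt_1 pt_0)
  have tt: "tt i P = 1" "tt ?j P = 0"
    unfolding Pi using i apply simp unfolding Pi[symmetric] Pj by simp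
  define \<kappa> where "\<kappa> = wedge (dir i) (dir ?j)"
  have crj: "cr ?j (pt i t) = (1 - t) * \<kappa>" for t
    using cr_pt_diff[of ?j i t 1] Pi[symmetric] Pj wedge_commute[of "dir ?j" "dir i"]
    by (simp add: \<kappa>_def algebra_simps)
  have cri: "cr i (pt ?j t) = t * \<kappa>" for t
    using cr_pt_diff[of i ?j t 0] Pi Pj[symmetric] by (simp add: \<kappa>_def)
  \<comment> \<open>the left side of the polygon near the vertex, according to whether it turns left or right\<close>
  define L where "L = (\<lambda>Z. if \<kappa> > 0 then cr i Z > 0 \<and> cr ?j Z > 0
    else if \<kappa> < 0 then cr i Z > 0 \<or> cr ?j Z > 0 else cr i Z > 0)"
  define g where "g = (\<lambda>Z. if L Z then id else k)"
  have gq: "g Z \<in> qaut T" for Z by (simp add: g_def kq id_in_qaut)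
  have parallel: "\<exists>c>0. \<forall>Z. cr ?j Z = c * cr i Z" if k0: "\<kappa> = 0"
  proof -
    obtain c where c: "c > 0" "dir ?j = of_real c * dir i"
      using no_backtracking[OF i] k0 by (auto simp: \<kappa>_def)
    have "cr ?j Z = c * cr i Z" for Z
    proof -
      have "cr ?j Z = c * wedge (dir i) (Z - pt i 1)"
        unfolding cr_def P_def[symmetric] Pi c(2) by (simp add: wedge_def algebra_simps)
      also have "wedge (dir i) (Z - pt i 1) = cr i Z"
        by (simp add: cr_def pt_def wedge_def algebra_simps)
      finally show ?thesis .
    qed
    then show ?thesis using c(1) by blast
  qed
  have "\<forall>\<^sub>F t in at (tt i P) within {..<1}. \<gamma> i t = k" "\<forall>\<^sub>F t in at (tt ?j P) within {0<..}. \<gamma> ?j t = k"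
    using k by (simp_all add: tt)
  note G = this[THEN eventually_tt, unfolded tt]
  have "\<forall>\<^sub>F Q in nhds P. 0 < tt i Q" "\<forall>\<^sub>F Q in nhds P. tt ?j Q < 1"
    using eventually_tt_bounds tt by simp_all
  with G eventually_off_edges[of P]
  have "\<forall>\<^sub>F Q in nhds P. Q \<notin> F \<longrightarrow>
    (\<exists>h\<in>qaut T. germ g h Q) \<and> (Q \<in> E i \<union> E ?j \<longrightarrow> germ g id Q)"
  proof eventually_elim
    case (elim Q)
    have on_i: "germ g id Q" if F: "Q \<notin> F" and Q: "Q \<in> E i"
    proof -
      note q = not_F_tt[OF F i Q]
      have gam: "\<gamma> i (tt i Q) = k" using elim q by simp
      \<comment> \<open>On edge \<open>i\<close> the function \<open>cr ?j\<close> has the sign of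
        \<kappa>. This sign persists near \<open>Q\<close>, so \<open>L\<close> reduces to the left
        side of edge \<open>i\<close> there.\<close>
      have cj: "cr ?j Q = (1 - tt i Q) * \<kappa>" using crj[of "tt i Q"] q(3) by simp
      have "\<forall>\<^sub>F Z in nhds Q. L Z = (cr i Z > 0)"
      proof (cases "\<kappa> = 0")
        case False
        then have "cr ?j Q \<noteq> 0" using cj q by simp
        from eventually_sign[OF this] show ?thesis
          by (rule eventually_mono) (use False q cj in \<open>auto simp: L_def mult_pos_neg zero_less_mult_iff\<close>)
      qed (simp add: L_def)
      then show ?thesis
        by (intro germ_onI[OF F i Q]) (auto simp: g_def gam elim: eventually_mono)
    qed
    have on_j: "germ g id Q" if F: "Q \<notin> F" and Q: "Q \<in> E ?j"
    proof -
      have j: "?j < n" by simp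
      note q = not_F_tt[OF F j Q]
      have gam: "\<gamma> ?j (tt ?j Q) = k" using elim q by simp
      have ci: "cr i Q = tt ?j Q * \<kappa>" using cri[of "tt ?j Q"] q(3) by simp
      have "\<forall>\<^sub>F Z in nhds Q. L Z = (cr ?j Z > 0)"
      proof (cases "\<kappa> = 0")
        case False
        then have "cr i Q \<noteq> 0" using ci q by simp
        from eventually_sign[OF this] show ?thesis
          by (rule eventually_mono) (use False q ci in \<open>auto simp: L_def mult_pos_neg zero_less_mult_iff\<close>)
      next
        case True
        then show ?thesis using parallel[OF True] by (auto simp: L_def zero_less_mult_iff)
      qed
      then show ?thesis
        by (intro germ_onI[OF F j Q]) (auto simp: g_def gam elim: eventually_mono)
    qed
    have off: "\<exists>h\<in>qaut T. germ g h Q" if Fi: "Q \<notin> E i" and Fj: "Q \<notin> E ?j"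
    proof -
      have "Q \<notin> E m" if m: "m < n" for m
      proof
        assume Qm: "Q \<in> E m"
        then have Pm: "P \<in> E m" using elim m by blast
        then have "?j = m \<or> ?j = nxt m" using vertex_on_edge[of ?j m] m by (simp add: P_def)
        then show False using Qm Fi Fj nxt_inj[OF i m] by auto
      qed
      then have QD: "Q \<notin> D" by (auto simp: D_def)
      have "\<forall>\<^sub>F Z in nhds Q. L Z = L Q"
      proof (cases "cr i Q = 0")
        \<comment> \<open>Here \<open>Q\<close> lies on the extension of edge \<open>i\<close>
          beyond the vertex, where the sign of \<open>cr i\<close> is unstable; the sign of
          \<open>cr ?j\<close> alone decides \<open>L\<close> near \<open>Q\<close>.\<close>
        case True
        define t where "t = tt i Q"
        have Q: "Q = pt i t" unfolding t_def by (rule cr_eq_0[OF i True])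
        have t1: "t > 1" using Fi mem_edge_iff[OF i, of Q] True elim by (auto simp: t_def)
        have cj: "cr ?j Q = (1 - t) * \<kappa>" using crj[of t] Q by simp
        have k0: "\<kappa> \<noteq> 0"
        proof
          assume k0: "\<kappa> = 0"
          then have cj0: "cr ?j Q = 0" using cj by simp
          obtain c where c: "c > 0" "dir ?j = of_real c * dir i"
            using no_backtracking[OF i] k0 by (auto simp: \<kappa>_def)
          have "Q = pt ?j ((t - 1) / c)"
          proof -
            have "Q = P + of_real (t - 1) * dir i" unfolding Q Pi by (simp add: pt_def algebra_simps)
            then show ?thesis using c by (simp add: pt_def[of ?j] P_def)
          qed
          then have "tt ?j Q = (t - 1) / c" by simp
          then have "tt ?j Q > 0" using c(1) t1 by simp
          then show False using Fj mem_edge_iff[of ?j Q] cj0 elim by simp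
        qed
        then have "cr ?j Q \<noteq> 0" using cj t1 by simp
        from eventually_sign[OF this] show ?thesis
          by (rule eventually_mono) (use k0 t1 cj True in \<open>auto simp: L_def zero_less_mult_iff\<close>)
      next
        case False
        show ?thesis
        proof (cases "cr ?j Q = 0")
          case True
          define t where "t = tt ?j Q"
          have Q: "Q = pt ?j t" unfolding t_def by (rule cr_eq_0[OF _ True]) simp
          have t1: "t < 0" using Fj mem_edge_iff[of ?j Q] True elim by (auto simp: t_def)
          have ci: "cr i Q = t * \<kappa>" using cri[of t] Q by simp
          have k0: "\<kappa> \<noteq> 0" using False ci by auto
          from eventually_sign[OF False] show ?thesis
            by (rule eventually_mono) (use k0 t1 ci True in \<open>auto simp: L_def zero_less_mult_iff\<close>)
        next
          case c: False
          from eventually_sign[OF False] eventually_sign[OF c] show ?thesis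
            by eventually_elim (simp add: L_def)
        qed
      qed
      then have "\<forall>\<^sub>F Z in nhds Q. g Z = g Q" by (rule eventually_mono) (simp add: g_def)
      then show ?thesis using germ_offI[OF QD] gq by blast
    qed
    show ?case using on_i on_j off id_in_qaut by blast
  qed
  then show ?thesis using gq unfolding P_def by blast
qed

text \<open>With strand \<open>j\<close> crossing strand \<open>i\<close> from right to left, \<open>c\<close> is the value in the region to the
  left of both; \<open>bi\<close> and \<open>aj\<close> are the transitions across \<open>i\<close> before and across \<open>j\<close> after the crossing.\<close>

definition crossing_germs ::
    "(complex \<Rightarrow> 'a \<Rightarrow> 'a) \<Rightarrow> ('a \<Rightarrow> 'a) \<Rightarrow> nat \<Rightarrow> real \<Rightarrow> ('a \<Rightarrow> 'a) \<Rightarrow> nat \<Rightarrow> real \<Rightarrow> ('a \<Rightarrow> 'a) \<Rightarrow> complex \<Rightarrow> bool"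
  where "crossing_germs g c i s bi j t aj Q \<longleftrightarrow>
    (Q \<in> E i \<longrightarrow> tt i Q < s \<longrightarrow> germ g c Q) \<and> (Q \<in> E i \<longrightarrow> tt i Q > s \<longrightarrow> germ g (c \<circ> aj) Q) \<and>
    (Q \<in> E j \<longrightarrow> tt j Q < t \<longrightarrow> germ g (c \<circ> bi) Q) \<and> (Q \<in> E j \<longrightarrow> tt j Q > t \<longrightarrow> germ g c Q)"

text \<open>The four quadrants carry \<open>id\<close> to the left of both strands,
  \<open>bi\<close> to the right of \<open>i\<close> only, \<open>aj\<close> to the right of
  \<open>j\<close> only, and \<open>bi \<circ> bj\<close> to the right of both. The assumption
  \<open>comm\<close> says that the two ways round to the last quadrant give the same value.\<close>

lemma crossing_local:
  assumes ij: "(i, j) \<in> passages p" and s: "0 < s" "s < 1" and t: "0 < t" "t < 1"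
    and P: "pt i s = pt j t" and w: "wedge (dir i) (dir j) > 0"
    and i_vals: "\<forall>\<^sub>F x in at_left s. \<gamma> i x = bi" "\<forall>\<^sub>F x in at_right s. \<gamma> i x = ai"
    and j_vals: "\<forall>\<^sub>F x in at_left t. \<gamma> j x = bj" "\<forall>\<^sub>F x in at_right t. \<gamma> j x = aj"
    and comm: "bi \<circ> bj = aj \<circ> ai"
  shows "\<exists>g. (\<forall>Z. g Z \<in> qaut T) \<and> (\<forall>\<^sub>F Q in nhds (pt i s). Q \<notin> F \<longrightarrow>
    (\<exists>h\<in>qaut T. germ g h Q) \<and> crossing_germs g id i s bi j t aj Q)"
proof -
  let ?P = "pt i s"
  have i: "i < n" and j: "j < n" and ne: "i \<noteq> j" using ij by (auto simp: passages_def)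
  have q: "bi \<in> qaut T" "ai \<in> qaut T" "bj \<in> qaut T" "aj \<in> qaut T"
    using const_value_qaut i_vals j_vals by (meson trivial_limit_at_left_real trivial_limit_at_right_real)+
  have tt: "tt i ?P = s" "tt j ?P = t" by (rule tt_pt[OF i]) (simp only: P tt_pt[OF j])
  have PE: "?P \<in> E i" "?P \<in> E j"
    using s t P unfolding mem_edge by (metis less_imp_le)+
  have PF: "?P \<in> F" unfolding F_def using i j ne PE by blast
  have crj: "cr j (pt i x) = (s - x) * wedge (dir i) (dir j)" for x
    using cr_pt_diff[of j i x s] P wedge_commute[of "dir j" "dir i"] by (simp add: algebra_simps)
  have cri: "cr i (pt j x) = (x - t) * wedge (dir i) (dir j)" for x
    using cr_pt_diff[of i j x t] P[symmetric] by simp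
  define g where "g = (\<lambda>Z. if cr i Z > 0 then (if cr j Z > 0 then id else aj)
    else (if cr j Z > 0 then bi else bi \<circ> bj))"
  have gq: "g Z \<in> qaut T" for Z using q by (simp add: g_def id_in_qaut comp_in_qaut)
  have "\<forall>\<^sub>F x in at (tt i ?P) within {..<s}. \<gamma> i x = bi" "\<forall>\<^sub>F x in at (tt i ?P) within {s<..}. \<gamma> i x = ai"
    "\<forall>\<^sub>F x in at (tt j ?P) within {..<t}. \<gamma> j x = bj" "\<forall>\<^sub>F x in at (tt j ?P) within {t<..}. \<gamma> j x = aj"
    using i_vals j_vals by (simp_all add: tt)
  note G = this[THEN eventually_tt, unfolded tt]
  have "\<forall>\<^sub>F Q in nhds ?P. 0 < tt i Q" "\<forall>\<^sub>F Q in nhds ?P. tt i Q < 1"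
    "\<forall>\<^sub>F Q in nhds ?P. 0 < tt j Q" "\<forall>\<^sub>F Q in nhds ?P. tt j Q < 1"
    using eventually_tt_bounds tt s t by simp_all
  with G eventually_off_edges[of ?P]
  have "\<forall>\<^sub>F Q in nhds ?P. Q \<notin> F \<longrightarrow>
    (\<exists>h\<in>qaut T. germ g h Q) \<and> crossing_germs g id i s bi j t aj Q"
  proof eventually_elim
    case (elim Q)
    have i1: "germ g id Q" if F: "Q \<notin> F" and Q: "Q \<in> E i" and x: "tt i Q < s"
    proof (rule germ_onI[OF F i Q])
      have gam: "\<gamma> i (tt i Q) = bi" using elim x by simp
      have "cr j Q > 0" using crj[of "tt i Q"] not_F_tt(3)[OF F i Q] x w by (simp add: mult_neg_pos mult_pos_pos)
      from eventually_pos(1)[OF isCont_cr this]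
      show "\<forall>\<^sub>F Z in nhds Q. g Z = id \<circ> (if cr i Z > 0 then id else \<gamma> i (tt i Q))"
        by (rule eventually_mono) (simp add: g_def gam)
    qed
    have i2: "germ g aj Q" if F: "Q \<notin> F" and Q: "Q \<in> E i" and x: "tt i Q > s"
    proof (rule germ_onI[OF F i Q])
      have gam: "\<gamma> i (tt i Q) = ai" using elim x by simp
      have "cr j Q < 0" using crj[of "tt i Q"] not_F_tt(3)[OF F i Q] x w by (simp add: mult_neg_pos mult_pos_pos)
      from eventually_pos(2)[OF isCont_cr this]
      show "\<forall>\<^sub>F Z in nhds Q. g Z = aj \<circ> (if cr i Z > 0 then id else \<gamma> i (tt i Q))"
        by (rule eventually_mono) (simp add: g_def gam comm)
    qed
    have j1: "germ g bi Q" if F: "Q \<notin> F" and Q: "Q \<in> E j" and x: "tt j Q < t"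
    proof (rule germ_onI[OF F j Q])
      have gam: "\<gamma> j (tt j Q) = bj" using elim x by simp
      have "cr i Q < 0" using cri[of "tt j Q"] not_F_tt(3)[OF F j Q] x w by (simp add: mult_neg_pos mult_pos_pos)
      from eventually_pos(2)[OF isCont_cr this]
      show "\<forall>\<^sub>F Z in nhds Q. g Z = bi \<circ> (if cr j Z > 0 then id else \<gamma> j (tt j Q))"
        by (rule eventually_mono) (simp add: g_def gam)
    qed
    have j2: "germ g id Q" if F: "Q \<notin> F" and Q: "Q \<in> E j" and x: "tt j Q > t"
    proof (rule germ_onI[OF F j Q])
      have gam: "\<gamma> j (tt j Q) = aj" using elim x by simp
      have "cr i Q > 0" using cri[of "tt j Q"] not_F_tt(3)[OF F j Q] x w by (simp add: mult_neg_pos mult_pos_pos)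
      from eventually_pos(1)[OF isCont_cr this]
      show "\<forall>\<^sub>F Z in nhds Q. g Z = id \<circ> (if cr j Z > 0 then id else \<gamma> j (tt j Q))"
        by (rule eventually_mono) (simp add: g_def gam)
    qed
    have off: "\<exists>h\<in>qaut T. germ g h Q" if Qi: "Q \<notin> E i" and Qj: "Q \<notin> E j"
    proof -
      have "Q \<notin> E m" if m: "m < n" for m
      proof
        assume Qm: "Q \<in> E m"
        then have "?P \<in> E m" using elim m by blast
        moreover have "m \<noteq> i" "m \<noteq> j" using Qm Qi Qj by auto
        ultimately show False using no_triple[OF i j m] PE ne by auto
      qed
      then have QD: "Q \<notin> D" by (auto simp: D_def)
      have "cr i Q \<noteq> 0" "cr j Q \<noteq> 0"
        using mem_edge_iff[OF i, of Q] mem_edge_iff[OF j, of Q] Qi Qj elim by auto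
      from this[THEN eventually_sign] have "\<forall>\<^sub>F Z in nhds Q. g Z = g Q"
        by eventually_elim (simp add: g_def)
      then show ?thesis using germ_offI[OF QD] gq by blast
    qed
    have ns: "tt i Q \<noteq> s" if "Q \<notin> F" "Q \<in> E i"
      using not_F_tt(3)[OF that(1) i that(2)] PF that(1) by metis
    have nt: "tt j Q \<noteq> t" if "Q \<notin> F" "Q \<in> E j"
      using not_F_tt(3)[OF that(1) j that(2)] PF that(1) P by metis
    show ?case
      unfolding crossing_germs_def id_comp
      using i1 i2 j1 j2 off ns nt q id_in_qaut by (meson linorder_neqE)
  qed
  then show ?thesis using gq by blast
qed

lemma region_colouring_local: "\<exists>e>0. \<exists>g. region_colouring (ball P e) g"
proof -
  have "\<exists>g. (\<forall>Z. g Z \<in> qaut T) \<and> (\<forall>\<^sub>F Q in nhds P. Q \<notin> F \<longrightarrow> (\<exists>h\<in>qaut T. germ g h Q))"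
  proof (cases "P \<in> F")
    case True
    then show ?thesis
    proof (cases rule: F_cases)
      case (1 i)
      from vertex_local[OF 1(1)] show ?thesis unfolding 1(2) by (auto elim!: eventually_mono)
    next
      case (2 i j)
      \<comment> \<open>Exchanging the two edges if necessary, strand \<open>j\<close> may be taken
        to cross strand \<open>i\<close> from right to left.\<close>
      have "\<exists>i j s t. (i, j) \<in> passages p \<and> 0 < s \<and> s < 1 \<and> 0 < t \<and> t < 1 \<and> P = pt i s \<and> pt i s = pt j t \<and>
          wedge (dir i) (dir j) > 0"
      proof -
        obtain s t where st: "0 < s" "s < 1" "0 < t" "t < 1" "pt i s = pt j t"
            "wedge (dir i) (dir j) \<noteq> 0" "E i \<inter> E j = {pt i s}"
          by (rule passage_point[OF 2(1)])
        have P: "P = pt i s" using st(7) 2 by blast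
        show ?thesis
        proof (cases "wedge (dir i) (dir j) > 0")
          case True
          then show ?thesis using 2(1) st P by blast
        next
          case False
          then have "wedge (dir j) (dir i) > 0" using st(6) wedge_commute[of "dir i" "dir j"] by simp
          then show ?thesis using passages_sym[OF 2(1)] st P by metis
        qed
      qed
      then obtain i j s t where st: "(i, j) \<in> passages p" "0 < s" "s < 1" "0 < t" "t < 1"
        and P: "P = pt i s" and w: "pt i s = pt j t" "wedge (dir i) (dir j) > 0" by blast
      obtain bi ai bj aj where
        "\<forall>\<^sub>F x in at_left s. \<gamma> i x = bi" "\<forall>\<^sub>F x in at_right s. \<gamma> i x = ai"
        "\<forall>\<^sub>F x in at_left t. \<gamma> j x = bj" "\<forall>\<^sub>F x in at_right t. \<gamma> j x = aj" "bi \<circ> bj = aj \<circ> ai"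
        using gamma_crossing[OF st w] by blast
      from crossing_local[OF st w this] show ?thesis unfolding P by (auto elim!: eventually_mono)
    qed
  next
    case PF: False
    show ?thesis
    proof (cases "P \<in> D")
      case True
      then obtain i where i: "i < n" "P \<in> E i" by (auto simp: D_def)
      note q = not_F_tt[OF PF i]
      from regular_local[OF i(1) q(1,2)] show ?thesis
        unfolding q(3)[symmetric] using PF gamma_qaut id_in_qaut
        by (intro exI[of _ "\<lambda>Z. if cr i Z > 0 then id else \<gamma> i (tt i P)"]) (auto elim!: eventually_mono)
    next
      case False
      have "\<forall>\<^sub>F Q in nhds P. germ (\<lambda>Z. id) id Q"
        using eventually_off_edges[of P]
      proof eventually_elim
        case (elim Q)
        then have "Q \<notin> D" using False by (auto simp: D_def)
        then show ?case by (rule germ_offI) simp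
      qed
      then show ?thesis using id_in_qaut
        by (intro exI[of _ "\<lambda>Z. id"]) (auto elim!: eventually_mono)
    qed
  qed
  then obtain g where g: "\<And>Z. g Z \<in> qaut T" and "\<forall>\<^sub>F Q in nhds P. Q \<notin> F \<longrightarrow> (\<exists>h\<in>qaut T. germ g h Q)"
    by blast
  then obtain e where "e > 0" "\<forall>Q. dist Q P < e \<longrightarrow> Q \<notin> F \<longrightarrow> (\<exists>h\<in>qaut T. germ g h Q)"
    unfolding eventually_nhds_metric by blast
  then show ?thesis using g unfolding region_colouring_def
    by (intro exI[of _ e] conjI exI[of _ g]) (auto simp: dist_commute)
qed

end

section \<open>Germs of a region colouring near points of the diagram\<close>

context polygon_colouring begin

text \<open>On a small ball the given region colouring is a constant left factor composed with the
  local model \<open>g0\<close>, so every germ found in the model holds for \<open>g\<close> up to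
  that factor.\<close>

lemma region_colouring_transport:
  assumes g: "region_colouring S g" and S: "open S" "P \<in> S" and g0: "\<And>Z. g0 Z \<in> qaut T"
    and ev: "\<forall>\<^sub>F Q in nhds P. Q \<notin> F \<longrightarrow> (\<exists>h\<in>qaut T. germ g0 h Q) \<and> R Q"
  shows "\<exists>c\<in>qaut T. \<forall>\<^sub>F Q in nhds P. Q \<notin> F \<longrightarrow> R Q \<and> (\<forall>h. germ g0 h Q \<longrightarrow> germ g (c \<circ> h) Q)"
proof -
  have "\<forall>\<^sub>F Q in nhds P. Q \<in> S" using S eventually_nhds by blast
  with ev have "\<forall>\<^sub>F Q in nhds P. Q \<in> S \<and> (Q \<notin> F \<longrightarrow> (\<exists>h\<in>qaut T. germ g0 h Q) \<and> R Q)"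
    by eventually_elim blast
  then obtain e where e: "e > 0"
      "\<forall>Q. dist Q P < e \<longrightarrow> Q \<in> S \<and> (Q \<notin> F \<longrightarrow> (\<exists>h\<in>qaut T. germ g0 h Q) \<and> R Q)"
    unfolding eventually_nhds_metric by blast
  then have B: "ball P e \<subseteq> S" "region_colouring (ball P e) g0"
    using g0 by (auto simp: region_colouring_def dist_commute)
  have "\<exists>c\<in>qaut T. \<forall>Z\<in>ball P e - D. g Z = c \<circ> g0 Z"
    by (rule region_colouring_ratio[OF open_ball _ region_colouring_mono[OF g B(1)] B(2) quandle_T]) simp
  then obtain c where c: "c \<in> qaut T" "\<And>Z. Z \<in> ball P e - D \<Longrightarrow> g Z = c \<circ> g0 Z" by blast
  have "\<forall>\<^sub>F Q in nhds P. Q \<in> ball P e" 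
    by (rule eventually_nhds_in_open[OF open_ball]) (simp add: e(1))
  then have "\<forall>\<^sub>F Q in nhds P. Q \<notin> F \<longrightarrow> R Q \<and> (\<forall>h. germ g0 h Q \<longrightarrow> germ g (c \<circ> h) Q)"
  proof eventually_elim
    case (elim Q)
    have "germ g (c \<circ> h) Q" if "germ g0 h Q" for h
      by (rule germ_cong[OF germ_comp[OF that] open_ball elim]) (rule c(2))
    then show ?case using e(2) elim by (auto simp: dist_commute)
  qed
  then show ?thesis using c(1) by blast
qed

lemma regular_germ:
  assumes g: "region_colouring S g" "open S" "pt i t \<in> S" and i: "i < n" "0 < t" "t < 1" "pt i t \<notin> F"
  shows "\<exists>c\<in>qaut T. \<forall>\<^sub>F Q in nhds (pt i t). Q \<notin> F \<longrightarrow> Q \<in> E i \<longrightarrow> germ g c Q"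
proof -
  have "\<exists>c\<in>qaut T. \<forall>\<^sub>F Q in nhds (pt i t). Q \<notin> F \<longrightarrow> (Q \<in> E i \<longrightarrow> germ (\<lambda>Z. if cr i Z > 0 then id else \<gamma> i t) id Q) \<and>
      (\<forall>h. germ (\<lambda>Z. if cr i Z > 0 then id else \<gamma> i t) h Q \<longrightarrow> germ g (c \<circ> h) Q)"
    by (rule region_colouring_transport[OF g _ regular_local[OF i]]) (simp add: gamma_qaut id_in_qaut)
  then obtain c where c: "c \<in> qaut T" "\<forall>\<^sub>F Q in nhds (pt i t). Q \<notin> F \<longrightarrow>
      (Q \<in> E i \<longrightarrow> germ (\<lambda>Z. if cr i Z > 0 then id else \<gamma> i t) id Q) \<and>
      (\<forall>h. germ (\<lambda>Z. if cr i Z > 0 then id else \<gamma> i t) h Q \<longrightarrow> germ g (c \<circ> h) Q)" by blast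
  from c(2) have "\<forall>\<^sub>F Q in nhds (pt i t). Q \<notin> F \<longrightarrow> Q \<in> E i \<longrightarrow> germ g c Q"
    by eventually_elim (metis comp_id)
  then show ?thesis using c(1) by blast
qed

lemma vertex_germ:
  assumes g: "region_colouring S g" "open S" "V (nxt i) \<in> S" and i: "i < n"
  shows "\<exists>c\<in>qaut T. \<forall>\<^sub>F Q in nhds (V (nxt i)). Q \<notin> F \<longrightarrow> Q \<in> E i \<union> E (nxt i) \<longrightarrow> germ g c Q"
proof -
  obtain g0 where g0: "\<And>Z. g0 Z \<in> qaut T" and
    ev: "\<forall>\<^sub>F Q in nhds (V (nxt i)). Q \<notin> F \<longrightarrow>
      (\<exists>h\<in>qaut T. germ g0 h Q) \<and> (Q \<in> E i \<union> E (nxt i) \<longrightarrow> germ g0 id Q)"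
    using vertex_local[OF i] by blast
  obtain c where c: "c \<in> qaut T" "\<forall>\<^sub>F Q in nhds (V (nxt i)). Q \<notin> F \<longrightarrow>
      (Q \<in> E i \<union> E (nxt i) \<longrightarrow> germ g0 id Q) \<and> (\<forall>h. germ g0 h Q \<longrightarrow> germ g (c \<circ> h) Q)"
    using region_colouring_transport[OF g g0 ev] by blast
  from c(2) have "\<forall>\<^sub>F Q in nhds (V (nxt i)). Q \<notin> F \<longrightarrow> Q \<in> E i \<union> E (nxt i) \<longrightarrow> germ g c Q"
    by eventually_elim (metis comp_id)
  then show ?thesis using c(1) by blast
qed

lemma crossing_germ:
  assumes g: "region_colouring S g" "open S" "pt i s \<in> S"
    and ij: "(i, j) \<in> passages p" "0 < s" "s < 1" "0 < t" "t < 1"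
    and P: "pt i s = pt j t" and w: "wedge (dir i) (dir j) > 0"
    and vals: "\<forall>\<^sub>F x in at_left s. \<gamma> i x = bi" "\<forall>\<^sub>F x in at_right s. \<gamma> i x = ai"
      "\<forall>\<^sub>F x in at_left t. \<gamma> j x = bj" "\<forall>\<^sub>F x in at_right t. \<gamma> j x = aj" "bi \<circ> bj = aj \<circ> ai"
  shows "\<exists>c\<in>qaut T. \<forall>\<^sub>F Q in nhds (pt i s). Q \<notin> F \<longrightarrow> crossing_germs g c i s bi j t aj Q"
proof -
  let ?R = "\<lambda>g0. crossing_germs g0 id i s bi j t aj"
  obtain g0 where g0: "\<And>Z. g0 Z \<in> qaut T" and
    ev: "\<forall>\<^sub>F Q in nhds (pt i s). Q \<notin> F \<longrightarrow> (\<exists>h\<in>qaut T. germ g0 h Q) \<and> ?R g0 Q"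
    using crossing_local[OF ij P w vals] by blast
  obtain c where c: "c \<in> qaut T" "\<forall>\<^sub>F Q in nhds (pt i s). Q \<notin> F \<longrightarrow>
      ?R g0 Q \<and> (\<forall>h. germ g0 h Q \<longrightarrow> germ g (c \<circ> h) Q)"
    using region_colouring_transport[OF g g0 ev] by blast
  have "\<forall>\<^sub>F Q in nhds (pt i s). Q \<notin> F \<longrightarrow> crossing_germs g c i s bi j t aj Q"
    using c(2)
  proof eventually_elim
    case (elim Q)
    have "germ g c Q" if "Q \<notin> F" "germ g0 id Q"
      using elim that by (metis comp_id)
    then show ?case using elim unfolding crossing_germs_def id_comp by blast
  qed
  then show ?thesis using c(1) by blast
qed

end

section \<open>Semi-arcs of a diagram\<close>

locale diagram = polygon p + quandle_loc T
  for p :: "complex list" and T :: "'a magma" +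
  fixes ov :: "nat \<Rightarrow> nat \<Rightarrow> bool" and lab :: "nat set \<Rightarrow> nat" and ps :: "(nat \<times> nat) list"
  assumes ov: "(i, j) \<in> passages p \<Longrightarrow> ov i j \<longleftrightarrow> \<not> ov j i"
    and set_ps: "set ps = passages p"
    and sorted_ps: "sorted_wrt (precedes p) ps"
    and gauss: "gauss_code (map (passage_letter p ov lab) ps)"
begin

abbreviation "N \<equiv> length ps"
abbreviation "w \<equiv> map (passage_letter p ov lab) ps"

text \<open>The polygon is parametrised by \<open>[0, n]\<close>, with edge \<open>i\<close> over \<open>[i, i + 1]\<close>. Semi-arc \<open>k\<close> lies over the
  interval from \<open>lo k\<close> to \<open>hi k\<close>; semi-arcs \<open>0\<close> and \<open>N\<close> are joined at vertex \<open>0\<close>.\<close>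

definition pos :: "nat \<Rightarrow> real" where
  "pos l = real (fst (ps ! l)) + tt (fst (ps ! l)) (double_point p (ps ! l))"

definition idx :: "real \<Rightarrow> nat" where "idx s = card {l. l < N \<and> pos l < s}"

definition lo :: "nat \<Rightarrow> real" where "lo k = (if k = 0 then 0 else pos (k - 1))"

definition hi :: "nat \<Rightarrow> real" where "hi k = (if k = N then real n else pos k)"

lemma double_point_eq:
  assumes "E i \<inter> E j = {Z}" shows "double_point p (i, j) = Z"
proof -
  have "z \<in> E i \<inter> E j \<longleftrightarrow> z = Z" for z using assms by blast
  then show ?thesis unfolding double_point_def prod.case by (intro the_equality) auto
qed

lemma passage_index: "(i, j) \<in> passages p \<Longrightarrow> \<exists>l<N. ps ! l = (i, j)"
  using set_ps by (metis in_set_conv_nth)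

lemma passage_at:
  assumes l: "l < N" and ij: "ps ! l = (i, j)"
  obtains s t where "(i, j) \<in> passages p" "i < n" "j < n" "0 < s" "s < 1" "0 < t" "t < 1" "pt i s = pt j t"
    "wedge (dir i) (dir j) \<noteq> 0" "E i \<inter> E j = {pt i s}" "pos l = real i + s" "double_point p (ps ! l) = pt i s"
proof -
  have P: "(i, j) \<in> passages p" using nth_mem[OF l] set_ps ij by simp
  have "i < n" "j < n" using P by (auto simp: passages_def)
  moreover obtain s t where st: "0 < s" "s < 1" "0 < t" "t < 1" "pt i s = pt j t"
      "wedge (dir i) (dir j) \<noteq> 0" "E i \<inter> E j = {pt i s}"
    by (rule passage_point[OF P])
  moreover have "double_point p (ps ! l) = pt i s" using double_point_eq[OF st(7)] ij by simp
  moreover from this have "pos l = real i + s" using \<open>i < n\<close> ij by (simp add: pos_def)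
  ultimately show thesis using that P by blast
qed

lemma pos_bounds: assumes "l < N" shows "0 < pos l" "pos l < real n" "pos l \<noteq> real m"
proof -
  obtain i j where ij: "ps ! l = (i, j)" by force
  obtain s t where st: "i < n" "0 < s" "s < 1" "pos l = real i + s"
    by (rule passage_at[OF assms ij])
  show "0 < pos l" using st by simp
  have "real i + 1 \<le> real n" using st(1) by linarith
  then show "pos l < real n" using st by linarith
  show "pos l \<noteq> real m"
  proof
    assume "pos l = real m"
    then have "real i < real m" "real m < real (Suc i)" using st by auto
    then have "i < m" "m < Suc i" unfolding of_nat_less_iff by blast+
    then show False by simp
  qed
qed

lemma pos_mono: assumes "l < l'" "l' < N" shows "pos l < pos l'"
proof -
  have l: "l < N" using assms by simp
  obtain i j where ij: "ps ! l = (i, j)" by force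
  obtain i' j' where ij': "ps ! l' = (i', j')" by force
  obtain s t where st: "i < n" "0 < s" "s < 1" "pos l = real i + s" "double_point p (ps ! l) = pt i s"
    by (rule passage_at[OF l ij])
  obtain s' t' where st': "i' < n" "0 < s'" "s' < 1" "pos l' = real i' + s'" "double_point p (ps ! l') = pt i' s'"
    by (rule passage_at[OF assms(2) ij'])
  have "precedes p (ps ! l) (ps ! l')"
    using sorted_ps assms by (simp add: sorted_wrt_iff_nth_less)
  then consider "i < i'" | "i = i'" "dist (V i) (pt i s) < dist (V i) (pt i s')"
    using st(5) st'(5) by (auto simp: precedes_def ij ij')
  then show ?thesis
  proof cases
    case 1
    then have "real i + 1 \<le> real i'" by linarith
    then show ?thesis using st st' by linarith
  next
    case 2
    have "dist (V i) (pt i x) = x * cmod (dir i)" if "0 < x" for x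
      using that by (simp add: pt_def dist_norm norm_mult)
    then have "s < s'" using 2(2) st(2) st'(2) dir_neq_0[OF st(1)] by simp
    then show ?thesis using st(4) st'(4) 2(1) by simp
  qed
qed

lemma pos_inj: "l < N \<Longrightarrow> l' < N \<Longrightarrow> pos l = pos l' \<Longrightarrow> l = l'"
  by (metis less_irrefl linorder_neqE_nat pos_mono)

lemma lo_less_hi: "k \<le> N \<Longrightarrow> lo k < hi k"
  using pos_bounds(1)[of 0] pos_bounds(2)[of "k - 1"] pos_bounds(1)[of k] pos_mono[of "k - 1" k] n_pos
  by (auto simp: lo_def hi_def)

lemma lo_hi_bounds: "k \<le> N \<Longrightarrow> 0 \<le> lo k" "k \<le> N \<Longrightarrow> hi k \<le> real n"
  using pos_bounds[of "k - 1"] pos_bounds[of k] by (auto simp: lo_def hi_def less_imp_le)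

lemma idx_eq:
  assumes k: "k \<le> N" and s: "lo k < s" "s < hi k" shows "idx s = k"
proof -
  have "{l. l < N \<and> pos l < s} = {..<k}"
  proof (intro equalityI subsetI)
    fix l assume l: "l \<in> {l. l < N \<and> pos l < s}"
    show "l \<in> {..<k}"
    proof (rule ccontr)
      assume "l \<notin> {..<k}"
      then have "k \<le> l" "k < N" using l by auto
      then have "pos k \<le> pos l" using pos_mono[of k l] l by (cases "k = l") auto
      then show False using s(2) l \<open>k < N\<close> by (auto simp: hi_def)
    qed
  next
    fix l assume l: "l \<in> {..<k}"
    then have "l \<le> k - 1" "k - 1 < N" using k by auto
    then have "pos l \<le> pos (k - 1)" using pos_mono[of l "k - 1"] by (cases "l = k - 1") auto
    then show "l \<in> {l. l < N \<and> pos l < s}" using l k s(1) by (auto simp: lo_def)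
  qed
  then show ?thesis by (simp add: idx_def)
qed

lemma idx_le: "idx s \<le> N"
proof -
  have "idx s \<le> card {..<N}" unfolding idx_def by (rule card_mono) auto
  then show ?thesis by simp
qed

lemma idx_between:
  assumes s: "0 < s" "s < real n" "\<And>l. l < N \<Longrightarrow> s \<noteq> pos l"
  shows "lo (idx s) < s" "s < hi (idx s)"
proof -
  define k where "k = (LEAST k. k = N \<or> s < pos k)"
  have k: "k = N \<or> s < pos k" unfolding k_def by (rule LeastI[of _ N]) simp
  have kN: "k \<le> N" unfolding k_def by (rule Least_le) simp
  have "lo k < s"
  proof (cases k)
    case (Suc m)
    then have "\<not> (m = N \<or> s < pos m)" using not_less_Least[of m "\<lambda>k. k = N \<or> s < pos k"] k_def by simp
    then show ?thesis using Suc s(3)[of m] kN by (auto simp: lo_def)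
  qed (simp add: lo_def s)
  moreover have "s < hi k" using k s(2) by (auto simp: hi_def)
  ultimately show "lo (idx s) < s" "s < hi (idx s)" using idx_eq[OF kN] by simp_all
qed

text \<open>By regularity an interior point of an edge is not a vertex, so it can lie in
  \<open>F\<close> only as a crossing, and the passage through it is listed in
  \<open>ps\<close>.\<close>

lemma pt_in_F:
  assumes i: "i < n" "0 < t" "t < 1" and F: "pt i t \<in> F"
  shows "\<exists>l<N. pos l = real i + t"
proof -
  have PE: "pt i t \<in> E i" using i unfolding mem_edge by (intro exI[of _ t]) simp
  have nV: "pt i t \<noteq> V k" for k
  proof
    assume e: "pt i t = V k"
    then have "V (k mod n) \<in> E i" using PE by simp
    then have "k mod n = i \<or> k mod n = nxt i" using vertex_on_edge[of "k mod n" i] i by simp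
    then have "V (k mod n) = V i \<or> V (k mod n) = V (nxt i)" by metis
    then have "pt i t = pt i 0 \<or> pt i t = pt i 1" using e by (simp add: pt_0 pt_1)
    then have "t = 0 \<or> t = 1" using tt_pt[OF i(1)] by metis
    then show False using i by simp
  qed
  obtain a b where ab: "a < n" "b < n" "a \<noteq> b" "pt i t \<in> E a" "pt i t \<in> E b"
    using F nV unfolding F_def by blast
  have "\<exists>j<n. j \<noteq> i \<and> pt i t \<in> E j" using ab by (cases "a = i") auto
  then obtain j where j: "j < n" "i \<noteq> j" "pt i t \<in> E j" by blast
  have P: "(i, j) \<in> passages p"
    by (rule edge_Int_cases[OF i(1) j(1,2) PE j(3)]) (use nV in auto)
  then obtain l where l: "l < N" "ps ! l = (i, j)" using passage_index by blast
  obtain s where "E i \<inter> E j = {pt i s}" "pos l = real i + s" by (rule passage_at[OF l])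
  then have "pt i t = pt i s" using PE j(3) by blast
  then have "t = s" using tt_pt[OF i(1)] by metis
  then show ?thesis using l(1) \<open>pos l = real i + s\<close> by blast
qed

end

context diagram begin

lemma pos_in_F:
  assumes i: "i < n" "0 < t" "t < 1" and l: "l < N" "pos l = real i + t"
  shows "pt i t \<in> F"
proof -
  obtain i' j' where ij: "ps ! l = (i', j')" by force
  obtain s' where s': "i' < n" "j' < n" "(i', j') \<in> passages p" "0 < s'" "s' < 1"
      "E i' \<inter> E j' = {pt i' s'}" "pos l = real i' + s'"
    by (rule passage_at[OF l(1) ij])
  have "real i < real (Suc i')" "real i' < real (Suc i)" using l(2) s' i by auto
  then have "i = i'" unfolding of_nat_less_iff by simp
  then have "pt i t \<in> E i \<inter> E j'" "i \<noteq> j'" using s' l(2) by (auto simp: passages_def)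
  then show ?thesis using i(1) s'(2) unfolding F_def by blast
qed

text \<open>A semi-arc has infinitely many parameters and only finitely many of them belong to
  vertices.\<close>

lemma semiarc_point:
  assumes k: "k \<le> N"
  obtains i t where "i < n" "0 < t" "t < 1" "lo k < real i + t" "real i + t < hi k"
proof -
  have "finite (real ` {..n})" by simp
  then have "infinite ({lo k <..< hi k} - real ` {..n})"
    using lo_less_hi[OF k] infinite_Ioo by (metis finite_Diff2)
  then have "{lo k <..< hi k} - real ` {..n} \<noteq> {}" by (metis finite.emptyI)
  then obtain s where "s \<in> {lo k <..< hi k} - real ` {..n}" by (meson all_not_in_conv)
  then have s: "lo k < s" "s < hi k" "s \<notin> real ` {..n}" by simp_all
  have sb: "0 < s" "s < real n" using s lo_hi_bounds[OF k] by auto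
  define i where "i = nat \<lfloor>s\<rfloor>"
  have i: "real i \<le> s" "s < real i + 1" "i < n" using sb by (auto simp: i_def) linarith+
  have "s \<noteq> real i" using s(3) i(3) by auto
  then show thesis using that[of i "s - real i"] i s by simp
qed

end

section \<open>Coloured diagrams and consistency at vertices and crossings\<close>

locale coloured_diagram = diagram p T ov lab ps
  for p :: "complex list" and T :: "'a magma" and ov lab ps +
  fixes C :: "nat \<Rightarrow> 'a" and f :: "nat \<Rightarrow> 'a"
  assumes C_in: "k \<le> N \<Longrightarrow> C k \<in> carrier T"
    and C_closed: "C N = C 0"
    and C_step: "k < N \<Longrightarrow> semiarc_step T f (w ! k) (C k) (C (Suc k))"
begin

definition gam :: "nat \<Rightarrow> real \<Rightarrow> 'a \<Rightarrow> 'a" where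
  "gam i t = rmul T (C (idx (real i + t)))"

lemma idx_left:
  assumes "k \<le> N" "lo k < real i + a" "real i + a \<le> hi k"
  shows "\<forall>\<^sub>F x in at_left a. lo k < real i + x \<and> real i + x < hi k \<and> idx (real i + x) = k"
proof -
  have "lo k - real i < a" using assms by simp
  then show ?thesis unfolding eventually_at_left[OF \<open>lo k - real i < a\<close>]
    using assms by (intro exI[of _ "lo k - real i"]) (auto intro!: idx_eq)
qed

lemma idx_right:
  assumes "k \<le> N" "lo k \<le> real i + a" "real i + a < hi k"
  shows "\<forall>\<^sub>F x in at_right a. lo k < real i + x \<and> real i + x < hi k \<and> idx (real i + x) = k"
proof -
  have "a < hi k - real i" using assms by simp
  then show ?thesis unfolding eventually_at_right[OF \<open>a < hi k - real i\<close>]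
    using assms by (intro exI[of _ "hi k - real i"]) (auto intro!: idx_eq)
qed

lemma lo_pos: "l < N \<Longrightarrow> lo (Suc l) = pos l" and hi_pos: "l < N \<Longrightarrow> hi l = pos l"
  by (simp_all add: lo_def hi_def)

text \<open>The crossing sign takes the direction of the over-strand first. With strand
  \<open>j\<close> crossing from right to left, the crossing is therefore positive if
  \<open>i\<close> is over and negative if \<open>j\<close> is over.\<close>

lemma crossing_colours:
  assumes l: "l < N" "ps ! l = (i, j)" and l': "l' < N" "ps ! l' = (j, i)"
    and w: "wedge (dir i) (dir j) > 0"
  obtains "w ! l = Over (lab {i, j}) 1" "w ! l' = Under (lab {i, j}) 1"
      "C (Suc l) = C l" "C (Suc l') = rmul T (C l) (C l')"
  | "w ! l = Under (lab {i, j}) (-1)" "w ! l' = Over (lab {i, j}) (-1)"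
      "C (Suc l') = C l'" "C l = rmul T (C l') (C (Suc l))"
proof -
  have P: "(i, j) \<in> passages p" using nth_mem[OF l(1)] set_ps l by simp
  have sgn: "crossing_sign p i j = 1" "crossing_sign p j i = -1"
    using w wedge_commute[of "dir i" "dir j"] by (simp_all add: crossing_sign_wedge dir_def)
  note st = C_step[OF l(1)] C_step[OF l'(1)]
  show thesis
  proof (cases "ov i j")
    case True
    have "\<not> ov j i" using ov[OF P] True by simp
    then have "w ! l = Over (lab {i, j}) 1" "w ! l' = Under (lab {i, j}) 1"
      using True l l' sgn by (simp_all add: passage_letter_def insert_commute)
    then show thesis using that(1) st by (simp add: semiarc_step_def act_def)
  next
    case False
    have "ov j i" using ov[OF P] False by simp
    then have W: "w ! l = Under (lab {i, j}) (-1)" "w ! l' = Over (lab {i, j}) (-1)"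
      using False l l' sgn by (simp_all add: passage_letter_def insert_commute)
    then have "C (Suc l) = inv (rmul T (C l')) (C l)" "C (Suc l') = C l'"
      using st by (auto simp: semiarc_step_def act_def)
    then show thesis using that(2) W rmul_inv_rmul[OF C_in[of l']] l' by simp
  qed
qed

text \<open>Both cases are the conjugation rule for the translation by the over colour: moving it
  past the translation by one under colour turns the latter into the translation by the
  other.\<close>

lemma crossing_commute:
  assumes l: "l < N" "ps ! l = (i, j)" and l': "l' < N" "ps ! l' = (j, i)"
    and w: "wedge (dir i) (dir j) > 0"
  shows "rmul T (C l) \<circ> rmul T (C l') = rmul T (C (Suc l')) \<circ> rmul T (C (Suc l))"
proof -
  have c: "C l \<in> carrier T" "C l' \<in> carrier T" "C (Suc l) \<in> carrier T" using C_in l(1) l'(1) by auto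
  show ?thesis
    by (rule crossing_colours[OF l l' w])
      (simp_all add: qaut_rmul_comm[OF rmul_in_qaut[OF c(1)] c(2)] qaut_rmul_comm[OF rmul_in_qaut[OF c(2)] c(3)])
qed

lemma passage_pair:
  assumes ij: "(i, j) \<in> passages p" and i: "0 < s" "s < 1" "0 < t" "t < 1" "pt i s = pt j t"
  obtains l l' where "l < N" "ps ! l = (i, j)" "l' < N" "ps ! l' = (j, i)"
    "pos l = real i + s" "pos l' = real j + t"
proof -
  have n: "i < n" "j < n" using ij by (auto simp: passages_def)
  have PE: "pt i s \<in> E i" "pt i s \<in> E j"
    using i unfolding mem_edge by (metis less_imp_le)+
  obtain l where l: "l < N" "ps ! l = (i, j)" using passage_index[OF ij] by blast
  obtain l' where l': "l' < N" "ps ! l' = (j, i)" using passage_index[OF passages_sym[OF ij]] by blast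
  obtain s' where s': "E i \<inter> E j = {pt i s'}" "pos l = real i + s'" by (rule passage_at[OF l])
  have "pt i s = pt i s'" using s'(1) PE by blast
  then have "s = s'" using tt_pt[OF n(1)] by metis
  obtain t' where t': "E j \<inter> E i = {pt j t'}" "pos l' = real j + t'" by (rule passage_at[OF l'])
  have "pt j t = pt j t'" using t'(1) PE i(5) by auto
  then have "t = t'" using tt_pt[OF n(2)] by metis
  show thesis using that[OF l l'] s'(2) t'(2) \<open>s = s'\<close> \<open>t = t'\<close> by simp
qed

lemma gam_sides:
  assumes l: "l < N" "pos l = real i + s"
  shows "\<forall>\<^sub>F x in at_left s. gam i x = rmul T (C l)" "\<forall>\<^sub>F x in at_right s. gam i x = rmul T (C (Suc l))"
proof -
  have "\<forall>\<^sub>F x in at_left s. lo l < real i + x \<and> real i + x < hi l \<and> idx (real i + x) = l"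
    by (rule idx_left) (use l lo_less_hi[of l] hi_pos[OF l(1)] in auto)
  then show "\<forall>\<^sub>F x in at_left s. gam i x = rmul T (C l)"
    by (rule eventually_mono) (simp add: gam_def)
  have "\<forall>\<^sub>F x in at_right s. lo (Suc l) < real i + x \<and> real i + x < hi (Suc l) \<and> idx (real i + x) = Suc l"
    by (rule idx_right) (use l lo_less_hi[of "Suc l"] lo_pos[OF l(1)] in auto)
  then show "\<forall>\<^sub>F x in at_right s. gam i x = rmul T (C (Suc l))"
    by (rule eventually_mono) (simp add: gam_def)
qed

sublocale polygon_colouring p gam T
proof
  show "quandle T" by (rule quandle)
  show "gam i t \<in> qaut T" for i t
    unfolding gam_def by (rule rmul_in_qaut[OF C_in[OF idx_le]])
  show "\<forall>\<^sub>F t' in nhds t. gam i t' = gam i t"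
    if i: "i < n" "0 < t" "t < 1" and F: "pt i t \<notin> F" for i t
  proof -
    let ?s = "real i + t"
    have "real i + 1 \<le> real n" using i by linarith
    then have s: "0 < ?s" "?s < real n" using i by linarith+
    have np: "?s \<noteq> pos l" if l: "l < N" for l
      using pos_in_F[OF i l] F by auto
    note b = idx_between[OF s np]
    have "\<forall>\<^sub>F t' in nhds t. t' \<in> {lo (idx ?s) - real i <..< hi (idx ?s) - real i}"
      by (rule eventually_nhds_in_open) (use b in auto)
    then show ?thesis
      by (rule eventually_mono) (auto simp: gam_def intro!: arg_cong[of _ _ "\<lambda>k. rmul T (C k)"] idx_eq[OF idx_le])
  qed
  show "\<exists>k. (\<forall>\<^sub>F t in at_left 1. gam i t = k) \<and> (\<forall>\<^sub>F t in at_right 0. gam (nxt i) t = k)"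
    if i: "i < n" for i
  proof (cases "Suc i < n")
    case True
    \<comment> \<open>The vertex is not a crossing, so a single semi-arc passes through it and
      colours both edges.\<close>
    let ?s = "real (Suc i)"
    have np: "?s \<noteq> pos l" if "l < N" for l
      using pos_bounds(3)[OF that, of "Suc i"] by simp
    have sb: "0 < ?s" "?s < real n" using True by simp_all
    note b = idx_between[OF sb np]
    have "\<forall>\<^sub>F x in at_left 1. gam i x = rmul T (C (idx ?s))"
      by (rule eventually_mono[OF idx_left[OF idx_le[of ?s], of i 1]])
        (use b in \<open>simp_all add: gam_def add.commute\<close>)
    moreover have "\<forall>\<^sub>F x in at_right 0. gam (nxt i) x = rmul T (C (idx ?s))"
      by (rule eventually_mono[OF idx_right[OF idx_le[of ?s], of "Suc i" 0]])
        (use b True in \<open>simp_all add: gam_def\<close>)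
    ultimately show ?thesis by blast
  next
    case False
    \<comment> \<open>Semi-arcs \<open>N\<close> and \<open>0\<close> are joined at vertex
      \<open>0\<close>, and \<open>C_closed\<close> makes their colours equal.\<close>
    then have Si: "Suc i = n" using i by simp
    have "\<forall>\<^sub>F x in at_left 1. gam i x = rmul T (C 0)"
      by (rule eventually_mono[OF idx_left[of N i 1]])
        (use lo_less_hi[of N] Si C_closed in \<open>auto simp: gam_def hi_def add.commute\<close>)
    moreover have "\<forall>\<^sub>F x in at_right 0. gam (nxt i) x = rmul T (C 0)"
      by (rule eventually_mono[OF idx_right[of 0 0 0]])
        (use lo_less_hi[of 0] Si in \<open>auto simp: gam_def lo_def\<close>)
    ultimately show ?thesis by blast
  qed
  show "\<exists>bi ai bj aj. (\<forall>\<^sub>F x in at_left s. gam i x = bi) \<and> (\<forall>\<^sub>F x in at_right s. gam i x = ai) \<and>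
        (\<forall>\<^sub>F x in at_left t. gam j x = bj) \<and> (\<forall>\<^sub>F x in at_right t. gam j x = aj) \<and> bi \<circ> bj = aj \<circ> ai"
    if ij: "(i, j) \<in> passages p" and s: "0 < s" "s < 1" "0 < t" "t < 1" "pt i s = pt j t"
      and w: "wedge (dir i) (dir j) > 0" for i j s t
  proof -
    obtain l l' where l: "l < N" "ps ! l = (i, j)" "l' < N" "ps ! l' = (j, i)"
        and pos: "pos l = real i + s" "pos l' = real j + t"
      by (rule passage_pair[OF ij s])
    show ?thesis
      using gam_sides[OF l(1) pos(1)] gam_sides[OF l(3) pos(2)] crossing_commute[OF l w] by blast
  qed
qed

definition curve :: "real \<Rightarrow> complex" where
  "curve s = pt (nat \<lfloor>s\<rfloor>) (s - real (nat \<lfloor>s\<rfloor>))"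

lemma curve_eq: "real i < s \<Longrightarrow> s < real i + 1 \<Longrightarrow> curve s = pt i (s - real i)"
proof -
  assume "real i < s" "s < real i + 1"
  then have "\<lfloor>s\<rfloor> = int i" by (intro floor_unique) auto
  then show ?thesis by (simp add: curve_def)
qed

lemma eventually_along_edge:
  assumes "\<forall>\<^sub>F Q in nhds (pt i (s - a)). R Q"
  shows "\<forall>\<^sub>F x in nhds s. R (pt i (x - a))"
proof -
  have "isCont (\<lambda>x. pt i (x - a)) s" unfolding pt_def by (intro continuous_intros)
  then have "filterlim (\<lambda>x. pt i (x - a)) (nhds (pt i (s - a))) (nhds s)"
    using tendsto_at_iff_tendsto_nhds[of "\<lambda>x. pt i (x - a)" s] by (simp add: isCont_def)
  then show ?thesis using assms unfolding filterlim_iff by blast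
qed

lemma not_pos_between: "k \<le> N \<Longrightarrow> l < N \<Longrightarrow> lo k < pos l \<Longrightarrow> pos l < hi k \<Longrightarrow> False"
proof -
  assume k: "k \<le> N" and l: "l < N" and b: "lo k < pos l" "pos l < hi k"
  have "idx (pos l) = k" by (rule idx_eq[OF k b])
  show False
  proof (cases "l < k")
    case True
    then have "l \<le> k - 1" "k - 1 < N" using k by auto
    then have "pos l \<le> pos (k - 1)" using pos_mono[of l "k - 1"] by (cases "l = k - 1") auto
    then show False using b(1) True by (simp add: lo_def)
  next
    case False
    then have "pos k \<le> pos l" using pos_mono[of k l] l by (cases "k = l") auto
    then show False using b(2) False l by (simp add: hi_def split: if_splits)
  qed
qed

lemma pt_off_F:
  assumes "k \<le> N" "i < n" "0 < t" "t < 1" "lo k < real i + t" "real i + t < hi k"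
  shows "pt i t \<notin> F" "pt i t \<in> E i"
proof -
  show "pt i t \<notin> F"
    using pt_in_F[OF assms(2-4)] not_pos_between[OF assms(1)] assms(5,6) by metis
  show "pt i t \<in> E i" unfolding mem_edge using assms by (intro exI[of _ t]) simp
qed

text \<open>The germ is locally constant along the open parameter interval: inside an edge by the
  local model, and through a vertex because both edges there have the same germ. The finitely many
  integer parameters form the exceptional set.\<close>

lemma germ_along_semiarc:
  assumes g: "region_colouring S g" and S: "open S" "D \<subseteq> S" and k: "k \<le> N"
  shows "\<exists>h\<in>qaut T. \<forall>i<n. \<forall>t. 0 < t \<longrightarrow> t < 1 \<longrightarrow> lo k < real i + t \<longrightarrow> real i + t < hi k \<longrightarrow>
    germ g h (pt i t)"
proof -
  let ?I = "{lo k <..< hi k}" and ?Z = "real ` {..n}"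
  define r where "r = (\<lambda>s. THE h. germ g h (curve s))"
  have r_eq: "r s = h" if "germ g h (curve s)" for s h
    unfolding r_def using that germ_unique by blast
  have VS: "V m \<in> S" for m
  proof -
    have "V (m mod n) \<in> D"
      unfolding D_def by (rule UN_I[of "m mod n"]) (simp, rule V_in_edge)
    then have "V (m mod n) \<in> S" by (rule subsetD[OF S(2)])
    then show ?thesis by simp
  qed
  have dense: "U - ?Z \<noteq> {}" if "open U" "U \<noteq> {}" for U
    using that finite_imp_not_open[of U] by (metis Diff_eq_empty_iff finite_atMost finite_imageI finite_subset)
  have loc: "\<exists>c. \<forall>\<^sub>F x in nhds s. x \<notin> ?Z \<longrightarrow> r x = c" if s: "s \<in> ?I" for s
  proof -
    have sb: "0 < s" "s < real n" using s lo_hi_bounds[OF k] by auto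
    have nI: "\<forall>\<^sub>F x in nhds s. x \<in> ?I" by (rule eventually_nhds_in_open) (use s in auto)
    define i where "i = nat \<lfloor>s\<rfloor>"
    have i: "real i \<le> s" "s < real i + 1" "i < n" using sb by (auto simp: i_def) linarith+
    show ?thesis
    proof (cases "s = real i")
      case False
      then have t: "0 < s - real i" "s - real i < 1" using i by auto
      have off: "pt i (s - real i) \<notin> F" "pt i (s - real i) \<in> E i"
        using pt_off_F[OF k i(3) t] s by simp_all
      then have "pt i (s - real i) \<in> S" using S i(3) by (auto simp: D_def)
      from regular_germ[OF g S(1) this i(3) t off(1)]
      obtain c where "\<forall>\<^sub>F Q in nhds (pt i (s - real i)). Q \<notin> F \<longrightarrow> Q \<in> E i \<longrightarrow> germ g c Q" by blast
      from eventually_along_edge[OF this]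
      have ev: "\<forall>\<^sub>F x in nhds s. pt i (x - real i) \<notin> F \<longrightarrow> pt i (x - real i) \<in> E i \<longrightarrow> germ g c (pt i (x - real i))" .
      have "\<forall>\<^sub>F x in nhds s. x \<in> {real i <..< real i + 1}"
        by (rule eventually_nhds_in_open) (use t in auto)
      with ev nI have "\<forall>\<^sub>F x in nhds s. x \<notin> ?Z \<longrightarrow> r x = c"
      proof eventually_elim
        case (elim x)
        have "germ g c (curve x)"
          using elim pt_off_F[OF k i(3), of "x - real i"] curve_eq[of i x] by simp
        then show ?case using r_eq by blast
      qed
      then show ?thesis by blast
    next
      case True
      then have i0: "0 < i" using sb by simp
      \<comment> \<open>Edge \<open>m\<close> ends and edge \<open>i\<close> begins at this vertex.
        There is no wrap-around, because the parameter \<open>0\<close> is never inside the open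
        interval.\<close>
      define m where "m = i - 1"
      have m: "Suc m = i" "m < n" "nxt m = i" using i0 i(3) by (auto simp: m_def)
      obtain c where c: "\<forall>\<^sub>F Q in nhds (V i). Q \<notin> F \<longrightarrow> Q \<in> E m \<union> E i \<longrightarrow> germ g c Q"
        using vertex_germ[OF g S(1) VS m(2)] unfolding m(3) by blast
      have Vi: "V i = pt m (s - real m)" "V i = pt i (s - real i)"
        using True m(1) pt_1[of m] pt_0[of i] by auto
      have ev: "\<forall>\<^sub>F x in nhds s. pt m (x - real m) \<notin> F \<longrightarrow> pt m (x - real m) \<in> E m \<union> E i \<longrightarrow> germ g c (pt m (x - real m))"
        by (rule eventually_along_edge) (use c Vi(1) in simp)
      have ev': "\<forall>\<^sub>F x in nhds s. pt i (x - real i) \<notin> F \<longrightarrow> pt i (x - real i) \<in> E m \<union> E i \<longrightarrow> germ g c (pt i (x - real i))"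
        by (rule eventually_along_edge) (use c Vi(2) in simp)
      have "\<forall>\<^sub>F x in nhds s. x \<in> {real m <..< real i + 1}"
        by (rule eventually_nhds_in_open) (use True m in auto)
      with ev ev' nI have "\<forall>\<^sub>F x in nhds s. x \<notin> ?Z \<longrightarrow> r x = c"
      proof eventually_elim
        case (elim x)
        show ?case
        proof
          assume x: "x \<notin> ?Z"
          then have "x \<noteq> real i" using i(3) by auto
          then consider "real m < x" "x < real m + 1" | "real i < x" "x < real i + 1"
            using elim m(1) by fastforce
          then have "germ g c (curve x)"
          proof cases
            case 1
            then show ?thesis
              using elim pt_off_F[OF k m(2), of "x - real m"] curve_eq[of m x] by simp
          next
            case 2
            then show ?thesis
              using elim pt_off_F[OF k i(3), of "x - real i"] curve_eq[of i x] by simp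
          qed
          then show "r x = c" by (rule r_eq)
        qed
      qed
      then show ?thesis by blast
    qed
  qed
  obtain h where h: "\<And>s. s \<in> ?I - ?Z \<Longrightarrow> r s = h"
    using locally_constant_off_dense[OF _ dense loc] connected_Ioo by meson
  have main: "germ g h (pt i t) \<and> h \<in> qaut T"
    if "i < n" "0 < t" "t < 1" "lo k < real i + t" "real i + t < hi k" for i t
  proof -
    have off: "pt i t \<notin> F" "pt i t \<in> E i" using pt_off_F[OF k that] by blast+
    then have "pt i t \<in> S - F" using S that(1) by (auto simp: D_def)
    then obtain h' where h': "h' \<in> qaut T" "germ g h' (pt i t)"
      using g unfolding region_colouring_def by blast
    have "curve (real i + t) = pt i t" using curve_eq[of i "real i + t"] that by simp
    then have "r (real i + t) = h'" using r_eq[of h' "real i + t"] h'(2) by simp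
    moreover have "real i + t \<notin> ?Z"
    proof
      assume "real i + t \<in> ?Z"
      then obtain m where "real i + t = real m" by blast
      then have "real i < real m" "real m < real (Suc i)" using that by auto
      then show False unfolding of_nat_less_iff by simp
    qed
    ultimately have "h' = h" using h[of "real i + t"] that by simp
    then show ?thesis using h' by simp
  qed
  obtain i t where it: "i < n" "0 < t" "t < 1" "lo k < real i + t" "real i + t < hi k"
    by (rule semiarc_point[OF k])
  then have "h \<in> qaut T" using main by blast
  then show ?thesis using main by blast
qed

end

section \<open>From upper to lower colourings\<close>

context polygon begin

lemma D_in_rect: "\<exists>B>0. D \<subseteq> open_rect (- B) B (- B) B"
proof -
  have "compact D" unfolding D_def edge_def by (intro compact_UN) auto
  then obtain B where B: "B > 0" "\<And>Z. Z \<in> D \<Longrightarrow> cmod Z < B"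
    using bounded_pos_less[THEN iffD1, OF compact_imp_bounded] by blast
  have "D \<subseteq> open_rect (- B) B (- B) B"
  proof
    fix Z assume "Z \<in> D"
    then have "\<bar>Re Z\<bar> < B" "\<bar>Im Z\<bar> < B"
      using B(2)[of Z] abs_Re_le_cmod[of Z] abs_Im_le_cmod[of Z] by auto
    then show "Z \<in> open_rect (- B) B (- B) B" by (auto simp: open_rect_def abs_less_iff)
  qed
  then show ?thesis using B(1) by blast
qed

end

section \<open>Germs at the ends of semi-arcs and the lower colours\<close>

context coloured_diagram begin

text \<open>The condition \<open>g Z0 = id\<close> fixes the left factor up to which a region
  colouring is determined, so that the solutions for different upper colourings can be
  compared.\<close>

definition semiarc_germs ::
    "complex set \<Rightarrow> complex \<Rightarrow> (complex \<Rightarrow> 'a \<Rightarrow> 'a) \<Rightarrow> (nat \<Rightarrow> 'a \<Rightarrow> 'a) \<Rightarrow> bool" where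
  "semiarc_germs S Z0 g h \<longleftrightarrow> region_colouring S g \<and> g Z0 = id \<and>
    (\<forall>k\<le>N. h k \<in> qaut T \<and> (\<forall>i<n. \<forall>t. 0 < t \<longrightarrow> t < 1 \<longrightarrow>
      lo k < real i + t \<longrightarrow> real i + t < hi k \<longrightarrow> germ g (h k) (pt i t)))"

lemma semiarc_germs_exist:
  assumes B: "B > 0" "D \<subseteq> open_rect (- B) B (- B) B" and Z0: "Z0 \<in> open_rect (- B) B (- B) B - D"
  shows "\<exists>g h. semiarc_germs (open_rect (- B) B (- B) B) Z0 g h"
proof -
  let ?S = "open_rect (- B) B (- B) B"
  obtain g0 where g0: "region_colouring ?S g0"
    using region_colouring_rect[OF region_colouring_local quandle_T, of "- B" B "- B" B] B(1) by auto
  then have q: "g0 Z0 \<in> qaut T" using Z0 by (auto simp: region_colouring_def)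
  define g where "g = (\<lambda>Z. inv (g0 Z0) \<circ> g0 Z)"
  have g: "region_colouring ?S g"
    unfolding g_def by (rule region_colouring_comp[OF g0 inv_in_qaut[OF q]])
  have "g Z0 = id" using qaut_bij[OF q] by (simp add: g_def bij_def)
  moreover have "\<forall>k\<in>{..N}. \<exists>h\<in>qaut T. \<forall>i<n. \<forall>t. 0 < t \<longrightarrow> t < 1 \<longrightarrow>
      lo k < real i + t \<longrightarrow> real i + t < hi k \<longrightarrow> germ g h (pt i t)"
    using germ_along_semiarc[OF g open_open_rect B(2)] by simp
  then obtain h where "\<forall>k\<in>{..N}. h k \<in> qaut T \<and> (\<forall>i<n. \<forall>t. 0 < t \<longrightarrow> t < 1 \<longrightarrow>
      lo k < real i + t \<longrightarrow> real i + t < hi k \<longrightarrow> germ g (h k) (pt i t))"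
    by (metis (no_types, lifting))
  ultimately have "semiarc_germs ?S Z0 g h" using g by (simp add: semiarc_germs_def)
  then show ?thesis by blast
qed

definition lower_colour :: "(nat \<Rightarrow> 'a \<Rightarrow> 'a) \<Rightarrow> nat \<Rightarrow> 'a" where
  "lower_colour h k = h k (C k)"

context
  fixes g :: "complex \<Rightarrow> 'a \<Rightarrow> 'a" and h :: "nat \<Rightarrow> 'a \<Rightarrow> 'a" and S :: "complex set" and Z0 :: complex
  assumes gh: "semiarc_germs S Z0 g h" and S: "open S" "D \<subseteq> S"
begin

lemma g: "region_colouring S g"
  and hq: "k \<le> N \<Longrightarrow> h k \<in> qaut T"
  and hg: "k \<le> N \<Longrightarrow> i < n \<Longrightarrow> 0 < t \<Longrightarrow> t < 1 \<Longrightarrow> lo k < real i + t \<Longrightarrow>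
      real i + t < hi k \<Longrightarrow> germ g (h k) (pt i t)"
  using gh by (simp_all add: semiarc_germs_def)

text \<open>Points of the semi-arc accumulate at the parameter \<open>a\<close> from below and germs
  are unique, so \<open>h k\<close> can be read off just before \<open>a\<close>.\<close>

lemma germ_left:
  assumes ev: "\<forall>\<^sub>F Q in nhds (pt i a). Q \<notin> F \<longrightarrow> Q \<in> E i \<longrightarrow> tt i Q < a \<longrightarrow> germ g c Q"
    and i: "i < n" and a: "0 < a" "a \<le> 1" and k: "k \<le> N" "lo k < real i + a" "real i + a \<le> hi k"
  shows "h k = c"
proof -
  have "\<forall>\<^sub>F x in nhds a. pt i (x - 0) \<notin> F \<longrightarrow> pt i (x - 0) \<in> E i \<longrightarrow> tt i (pt i (x - 0)) < a \<longrightarrow>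
      germ g c (pt i (x - 0))"
    by (rule eventually_along_edge) (use ev in simp)
  then have "\<forall>\<^sub>F x in at_left a. pt i x \<notin> F \<longrightarrow> pt i x \<in> E i \<longrightarrow> x < a \<longrightarrow> germ g c (pt i x)"
    unfolding eventually_at_filter by (rule eventually_mono) (simp add: i)
  moreover have "\<forall>\<^sub>F x in at_left a. 0 < x \<and> x < a"
    unfolding eventually_at_left[OF a(1)] using a(1) by blast
  ultimately have "\<forall>\<^sub>F x in at_left a. h k = c"
    using idx_left[OF k]
  proof eventually_elim
    case (elim x)
    then have x: "0 < x" "x < 1" "lo k < real i + x" "real i + x < hi k" using a by auto
    have "germ g c (pt i x)" using elim pt_off_F[OF k(1) i x] by simp
    then show ?case using germ_unique[OF hg[OF k(1) i x]] by blast
  qed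
  then show ?thesis using eventually_happens[of "\<lambda>x. h k = c" "at_left a"] by simp
qed

lemma germ_right:
  assumes ev: "\<forall>\<^sub>F Q in nhds (pt i a). Q \<notin> F \<longrightarrow> Q \<in> E i \<longrightarrow> tt i Q > a \<longrightarrow> germ g c Q"
    and i: "i < n" and a: "0 \<le> a" "a < 1" and k: "k \<le> N" "lo k \<le> real i + a" "real i + a < hi k"
  shows "h k = c"
proof -
  have "\<forall>\<^sub>F x in nhds a. pt i (x - 0) \<notin> F \<longrightarrow> pt i (x - 0) \<in> E i \<longrightarrow> tt i (pt i (x - 0)) > a \<longrightarrow>
      germ g c (pt i (x - 0))"
    by (rule eventually_along_edge) (use ev in simp)
  then have "\<forall>\<^sub>F x in at_right a. pt i x \<notin> F \<longrightarrow> pt i x \<in> E i \<longrightarrow> x > a \<longrightarrow> germ g c (pt i x)"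
    unfolding eventually_at_filter by (rule eventually_mono) (simp add: i)
  moreover have "\<forall>\<^sub>F x in at_right a. a < x \<and> x < 1"
    unfolding eventually_at_right[OF a(2)] using a(2) by blast
  ultimately have "\<forall>\<^sub>F x in at_right a. h k = c"
    using idx_right[OF k]
  proof eventually_elim
    case (elim x)
    then have x: "0 < x" "x < 1" "lo k < real i + x" "real i + x < hi k" using a by auto
    have "germ g c (pt i x)" using elim pt_off_F[OF k(1) i x] by simp
    then show ?case using germ_unique[OF hg[OF k(1) i x]] by blast
  qed
  then show ?thesis using eventually_happens[of "\<lambda>x. h k = c" "at_right a"] by simp
qed

text \<open>Semi-arc \<open>N\<close> ends and semi-arc \<open>0\<close> begins at vertex
  \<open>0\<close>, near which the germs on the two edges coincide.\<close>

lemma germ_wrap: "h N = h 0"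
proof -
  define i where "i = n - 1"
  have i: "i < n" "nxt i = 0" "Suc i = n" using n_pos by (auto simp: i_def)
  have "V (nxt i) \<in> S"
  proof -
    have "V 0 \<in> D" unfolding D_def by (rule UN_I[of 0]) (use n_pos V_in_edge in auto)
    then show ?thesis using S(2) i(2) by auto
  qed
  from vertex_germ[OF g S(1) this i(1)]
  obtain c where c: "\<forall>\<^sub>F Q in nhds (V 0). Q \<notin> F \<longrightarrow> Q \<in> E i \<union> E 0 \<longrightarrow> germ g c Q"
    unfolding i(2) by blast
  have Vi: "V 0 = pt i 1" using V_mod[of "Suc i"] by (simp add: i(2) pt_1)
  have "h N = c"
  proof (rule germ_left[OF _ i(1)])
    show "\<forall>\<^sub>F Q in nhds (pt i 1). Q \<notin> F \<longrightarrow> Q \<in> E i \<longrightarrow> tt i Q < 1 \<longrightarrow> germ g c Q"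
      unfolding Vi[symmetric] by (rule eventually_mono[OF c]) simp
    have "real i + 1 = real n" using i(3) by linarith
    then show "lo N < real i + 1" "real i + 1 \<le> hi N" using lo_less_hi[of N] by (simp_all add: hi_def)
  qed simp_all
  moreover have "h 0 = c"
  proof (rule germ_right)
    show "\<forall>\<^sub>F Q in nhds (pt 0 0). Q \<notin> F \<longrightarrow> Q \<in> E 0 \<longrightarrow> tt 0 Q > 0 \<longrightarrow> germ g c Q"
      unfolding pt_0 by (rule eventually_mono[OF c]) simp
    show "lo 0 \<le> real 0 + 0" "real 0 + 0 < hi 0" using lo_less_hi[of 0] by (simp_all add: lo_def)
  qed (use n_pos in simp_all)
  ultimately show ?thesis by simp
qed

text \<open>A germ on an edge is the value on its left. Before and after the crossing the left of
  \<open>i\<close> is the quadrant left of both strands and the one right of \<open>j\<close> only;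
  the left of \<open>j\<close> is the quadrant right of \<open>i\<close> only and then the one left
  of both.\<close>

lemma germ_crossing:
  assumes l: "l < N" "ps ! l = (i, j)" and l': "l' < N" "ps ! l' = (j, i)"
    and w: "wedge (dir i) (dir j) > 0"
  shows "h (Suc l) = h l \<circ> rmul T (C (Suc l'))" "h l' = h l \<circ> rmul T (C l)" "h (Suc l') = h l"
proof -
  obtain s t where P: "(i, j) \<in> passages p" "i < n" "j < n" "0 < s" "s < 1" "0 < t" "t < 1" "pt i s = pt j t"
      "pos l = real i + s"
    by (rule passage_at[OF l])
  obtain m m' where m: "m < N" "ps ! m = (i, j)" "m' < N" "ps ! m' = (j, i)"
        and pos: "pos m = real i + s" "pos m' = real j + t"
      by (rule passage_pair[OF P(1,4-8)])
  have "pos m = pos l" "pos m' = pos l'" by (simp_all add: pos_def m l l')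
  then have ml: "m = l" "m' = l'" using pos_inj m l l' by blast+
  note pos = pos[unfolded ml]
  have "pt i s \<in> S"
  proof -
    have "pt i s \<in> E i" using P unfolding mem_edge by (intro exI[of _ s]) simp
    then show ?thesis using S(2) P(2) by (auto simp: D_def)
  qed
  note vals = gam_sides[OF l(1) pos(1)] gam_sides[OF l'(1) pos(2)] crossing_commute[OF l l' w]
  obtain c where c: "\<forall>\<^sub>F Q in nhds (pt i s). Q \<notin> F \<longrightarrow>
      crossing_germs g c i s (rmul T (C l)) j t (rmul T (C (Suc l'))) Q"
    using crossing_germ[OF g S(1) \<open>pt i s \<in> S\<close> P(1,4-8) w vals] by blast
  have b: "lo l < pos l" "pos l < hi (Suc l)" "lo l' < pos l'" "pos l' < hi (Suc l')"
    using lo_less_hi[of l] lo_less_hi[of "Suc l"] lo_less_hi[of l'] lo_less_hi[of "Suc l'"] l l'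
      lo_pos hi_pos by auto
  have "h l = c"
    by (rule germ_left[OF eventually_mono[OF c] P(2)]) (use P l b pos hi_pos in \<open>auto simp: crossing_germs_def\<close>)
  moreover have "h (Suc l) = c \<circ> rmul T (C (Suc l'))"
    by (rule germ_right[OF eventually_mono[OF c] P(2)]) (use P l b pos lo_pos in \<open>auto simp: crossing_germs_def\<close>)
  moreover have "h l' = c \<circ> rmul T (C l)"
    by (rule germ_left[OF eventually_mono[OF c[unfolded P(8)]] P(3)]) (use P l' b pos hi_pos in \<open>auto simp: crossing_germs_def\<close>)
  moreover have "h (Suc l') = c"
    by (rule germ_right[OF eventually_mono[OF c[unfolded P(8)]] P(3)]) (use P l' b pos lo_pos in \<open>auto simp: crossing_germs_def\<close>)
  ultimately show "h (Suc l) = h l \<circ> rmul T (C (Suc l'))" "h l' = h l \<circ> rmul T (C l)" "h (Suc l') = h l"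
    by simp_all
qed

lemma lower_colour_in: "k \<le> N \<Longrightarrow> lower_colour h k \<in> carrier T"
  using C_in hq qaut_carrier_iff unfolding lower_colour_def by metis

text \<open>Along the under-strand the change of the germ by the translation by the over colour
  undoes the change of the upper colour, so the lower colour is constant there. Along the
  over-strand the upper colour is constant and only the germ changes, by the translation by an under
  colour; after applying the germ this is the lower crossing rule.\<close>

lemma lower_colour_crossing:
  assumes l: "l < N" "ps ! l = (i, j)" and l': "l' < N" "ps ! l' = (j, i)"
    and w: "wedge (dir i) (dir j) > 0"
    and e: "\<And>m X \<epsilon>. m < N \<Longrightarrow> w ! m = Under X \<epsilon> \<Longrightarrow> e X = lower_colour h m"
  shows "semiarc_step T e (swap_letter (w ! l)) (lower_colour h l) (lower_colour h (Suc l))"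
    and "semiarc_step T e (swap_letter (w ! l')) (lower_colour h l') (lower_colour h (Suc l'))"
proof -
  note H = germ_crossing[OF l l' w]
  define c where "c = h l"
  have c: "c \<in> qaut T" unfolding c_def using hq l by simp
  have CC: "C l \<in> carrier T" "C l' \<in> carrier T" "C (Suc l) \<in> carrier T" "C (Suc l') \<in> carrier T"
    using C_in l(1) l'(1) by auto
  have Y: "lower_colour h l = c (C l)" "lower_colour h (Suc l) = c (rmul T (C (Suc l')) (C (Suc l)))"
    "lower_colour h l' = c (rmul T (C l) (C l'))" "lower_colour h (Suc l') = c (C (Suc l'))"
    by (simp_all add: lower_colour_def H c_def)
  have "semiarc_step T e (swap_letter (w ! l)) (lower_colour h l) (lower_colour h (Suc l)) \<and>
      semiarc_step T e (swap_letter (w ! l')) (lower_colour h l') (lower_colour h (Suc l'))"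
  proof (rule crossing_colours[OF l l' w])
    assume W: "w ! l = Over (lab {i, j}) 1" "w ! l' = Under (lab {i, j}) 1"
      and C: "C (Suc l) = C l" "C (Suc l') = rmul T (C l) (C l')"
    have "e (lab {i, j}) = c (C (Suc l'))" using e[OF l'(1) W(2)] Y(3) C(2) by simp
    then show "semiarc_step T e (swap_letter (w ! l)) (lower_colour h l) (lower_colour h (Suc l)) \<and>
        semiarc_step T e (swap_letter (w ! l')) (lower_colour h l') (lower_colour h (Suc l'))"
      unfolding Y W using C qaut_rmul[OF c CC(4)] by (simp add: semiarc_step_def act_def)
  next
    assume W: "w ! l = Under (lab {i, j}) (-1)" "w ! l' = Over (lab {i, j}) (-1)"
      and C: "C (Suc l') = C l'" "C l = rmul T (C l') (C (Suc l))"
    have eX: "e (lab {i, j}) = c (C l)" using e[OF l(1) W(1)] Y(1) by simp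
    have "inv (rmul T (c (C l))) (c (rmul T (C l) (C l'))) = c (C l')"
      using inv_rmul_rmul[of "c (C l)"] qaut_rmul[OF c CC(1)] qaut_carrier_iff[OF c] CC(1) by simp
    then show "semiarc_step T e (swap_letter (w ! l)) (lower_colour h l) (lower_colour h (Suc l)) \<and>
        semiarc_step T e (swap_letter (w ! l')) (lower_colour h l') (lower_colour h (Suc l'))"
      unfolding Y W using C eX by (simp add: semiarc_step_def act_def)
  qed
  then show "semiarc_step T e (swap_letter (w ! l)) (lower_colour h l) (lower_colour h (Suc l))"
    and "semiarc_step T e (swap_letter (w ! l')) (lower_colour h l') (lower_colour h (Suc l'))"
    by blast+
qed

lemma lower_colour_step:
  assumes l: "l < N" and e: "\<And>m X \<epsilon>. m < N \<Longrightarrow> w ! m = Under X \<epsilon> \<Longrightarrow> e X = lower_colour h m"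
  shows "semiarc_step T e (swap_letter (w ! l)) (lower_colour h l) (lower_colour h (Suc l))"
proof -
  obtain i j where ij: "ps ! l = (i, j)" by force
  obtain s t where P: "(i, j) \<in> passages p" "wedge (dir i) (dir j) \<noteq> 0"
    by (rule passage_at[OF l ij])
  obtain l' where l': "l' < N" "ps ! l' = (j, i)" using passage_index[OF passages_sym[OF P(1)]] by blast
  show ?thesis
  proof (cases "wedge (dir i) (dir j) > 0")
    case True
    show ?thesis by (rule lower_colour_crossing(1)[OF l ij l' True e])
  next
    case False
    then have "wedge (dir j) (dir i) > 0" using P(2) wedge_commute[of "dir i" "dir j"] by simp
    from lower_colour_crossing(2)[OF l' l ij this e] show ?thesis .
  qed
qed

end

end

section \<open>Recovery of the upper colouring\<close>

context diagram begin

text \<open>Across an edge with common lower colour \<open>y\<close>, both \<open>g1\<close> and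
  \<open>g2\<close> change by the left factor \<open>rmul T y\<close>, which cancels in
  \<open>inv (g1 Z) \<circ> g2 Z\<close>. This ratio is therefore constant, and it is
  \<open>id\<close> at \<open>Z0\<close>; hence the germs on each semi-arc agree, and applying their
  inverse to the lower colour gives equal upper colours.\<close>

lemma region_colourings_unique:
  assumes c1: "coloured_diagram p T ov lab ps C1 f1" and c2: "coloured_diagram p T ov lab ps C2 f2"
    and S: "open S" "connected S" "D \<subseteq> S" and Z0: "Z0 \<in> S - D"
    and sg: "coloured_diagram.semiarc_germs p T ps C1 S Z0 g1 h1" "coloured_diagram.semiarc_germs p T ps C2 S Z0 g2 h2"
    and eq: "\<And>k. k \<le> N \<Longrightarrow> h1 k (C1 k) = h2 k (C2 k)"
    and k: "k \<le> N"
  shows "C1 k = C2 k"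
proof -
  interpret c1: coloured_diagram p T ov lab ps C1 f1 by (rule c1)
  interpret c2: coloured_diagram p T ov lab ps C2 f2 by (rule c2)
  note sg = sg[unfolded c1.semiarc_germs_def c2.semiarc_germs_def]
  have g1: "c1.region_colouring S g1" "g1 Z0 = id" and g2: "c2.region_colouring S g2" "g2 Z0 = id"
    and hq: "\<And>k. k \<le> N \<Longrightarrow> h1 k \<in> qaut T" "\<And>k. k \<le> N \<Longrightarrow> h2 k \<in> qaut T"
    using sg by blast+
  have near: "\<forall>\<^sub>F Z in nhds (pt i t). Z \<notin> D \<longrightarrow> inv (g1 Z) \<circ> g2 Z = inv (h1 k) \<circ> h2 k"
    if k: "k \<le> N" and it: "i < n" "0 < t" "t < 1" "lo k < real i + t" "real i + t < hi k" for k i t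
  proof -
    have off: "pt i t \<notin> F" "pt i t \<in> E i" using c1.pt_off_F[OF k it] by blast+
    have ix: "idx (real i + t) = k" by (rule idx_eq[OF k it(4,5)])
    have C: "C1 k \<in> carrier T" "C2 k \<in> carrier T" using c1.C_in c2.C_in k by auto
    have b: "bij (h1 k)" "bij (h2 k)" using hq k qaut_bij by blast+
    define y where "y = h1 k (C1 k)"
    have y: "y = h2 k (C2 k)" "y \<in> carrier T"
      using eq[OF k] qaut_carrier_iff[OF hq(2)[OF k]] C by (simp_all add: y_def)
    have r1: "h1 k \<circ> rmul T (C1 k) = rmul T y \<circ> h1 k" "h2 k \<circ> rmul T (C2 k) = rmul T y \<circ> h2 k"
      using qaut_rmul_comm[OF hq(1)[OF k] C(1)] qaut_rmul_comm[OF hq(2)[OF k] C(2)] y by (simp_all add: y_def)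
    have s1: "c1.side (pt i t) Z = (if cr i Z > 0 then id else rmul T (C1 k))" for Z
      using c1.side_edge[OF off(1) it(1) off(2)] it ix by (simp add: c1.gam_def)
    have s2: "c2.side (pt i t) Z = (if cr i Z > 0 then id else rmul T (C2 k))" for Z
      using c2.side_edge[OF off(1) it(1) off(2)] it ix by (simp add: c2.gam_def)
    have bijy: "bij (rmul T y)" by (rule rmul_bij[OF y(2)])
    have key: "inv (rmul T y \<circ> h1 k) \<circ> (rmul T y \<circ> h2 k) = inv (h1 k) \<circ> h2 k"
      using o_inv_distrib[OF bijy b(1)] bijy by (simp add: fun_eq_iff bij_def)
    have "c1.germ g1 (h1 k) (pt i t)" "c2.germ g2 (h2 k) (pt i t)" using sg k it by blast+
    then show ?thesis
      unfolding c1.germ_def c2.germ_def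
      by eventually_elim (auto simp: s1 s2 r1 key)
  qed
  have "\<exists>c. \<forall>Z\<in>(S - F) - D. inv (g1 Z) \<circ> g2 Z = c"
  proof (rule locally_constant_off_dense[OF _ dense_D])
    show "connected (S - F)"
      by (rule connected_open_delete_finite) (use S finite_F in auto)
    fix Q assume Q: "Q \<in> S - F"
    show "\<exists>c. \<forall>\<^sub>F Z in nhds Q. Z \<notin> D \<longrightarrow> inv (g1 Z) \<circ> g2 Z = c"
    proof (cases "Q \<in> D")
      case True
      then obtain i where i: "i < n" "Q \<in> E i" by (auto simp: D_def)
      have QF: "Q \<notin> F" using Q by simp
      note q = not_F_tt[OF QF i]
      let ?s = "real i + tt i Q"
      have "real i + 1 \<le> real n" using i by linarith
      then have s: "0 < ?s" "?s < real n" using q by linarith+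
      have np: "?s \<noteq> pos l" if "l < N" for l
        using pos_in_F[OF i(1) q(1,2) that] q(3) QF by metis
      show ?thesis
        using near[OF idx_le i(1) q(1,2) idx_between[OF s np]] q(3) by metis
    next
      case False
      obtain k1 k2 where "c1.germ g1 k1 Q" "c2.germ g2 k2 Q"
        using g1(1) g2(1) Q unfolding c1.region_colouring_def c2.region_colouring_def by meson
      then have "\<forall>\<^sub>F Z in nhds Q. Z \<notin> D \<longrightarrow> inv (g1 Z) \<circ> g2 Z = inv k1 \<circ> k2"
        unfolding c1.germ_def c2.germ_def
        by eventually_elim (use False in \<open>simp add: c1.side_def c2.side_def\<close>)
      then show ?thesis by blast
    qed
  qed
  then obtain c where c: "\<And>Z. Z \<in> S - D \<Longrightarrow> inv (g1 Z) \<circ> g2 Z = c" using F_subset_D by auto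
  have cid: "c = id" using c[OF Z0] g1(2) g2(2) by simp
  obtain i t where it: "i < n" "0 < t" "t < 1" "lo k < real i + t" "real i + t < hi k"
    by (rule semiarc_point[OF k])
  have "pt i t \<in> S" using c1.pt_off_F(2)[OF k it] it(1) S(3) by (auto simp: D_def)
  then have "\<forall>\<^sub>F Z in nhds (pt i t). Z \<in> S" using S(1) eventually_nhds_in_open by blast
  with near[OF k it] have "\<forall>\<^sub>F Z in nhds (pt i t). Z \<notin> D \<longrightarrow> inv (h1 k) \<circ> h2 k = id"
    by eventually_elim (use c cid in auto)
  then obtain U where U: "open U" "pt i t \<in> U" "\<forall>Z\<in>U. Z \<notin> D \<longrightarrow> inv (h1 k) \<circ> h2 k = id"
    unfolding eventually_nhds by blast
  then have "inv (h1 k) \<circ> h2 k = id" using dense_D[of U] by blast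
  then have "inv (h1 k) (h2 k (C2 k)) = C2 k" by (metis comp_apply id_apply)
  moreover have "inv (h1 k) (h1 k (C1 k)) = C1 k"
    using qaut_bij[OF hq(1)[OF k]] by (simp add: bij_def)
  ultimately show ?thesis using eq[OF k] by simp
qed

end

section \<open>Comparison of the numbers of upper and lower colourings\<close>

context diagram begin

text \<open>The data \<open>C\<close>, \<open>g\<close> and \<open>h\<close> come from existence
  statements, so the passage from \<open>q\<close> to \<open>q'\<close> is a relation that keeps
  them available for the proof of injectivity.\<close>

definition lower_colouring ::
    "complex set \<Rightarrow> complex \<Rightarrow> 'a \<times> (nat \<Rightarrow> 'a) \<Rightarrow> 'a \<times> (nat \<Rightarrow> 'a) \<Rightarrow>
      (nat \<Rightarrow> 'a) \<Rightarrow> (complex \<Rightarrow> 'a \<Rightarrow> 'a) \<Rightarrow> (nat \<Rightarrow> 'a \<Rightarrow> 'a) \<Rightarrow> bool" where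
  "lower_colouring S Z0 q q' C g h \<longleftrightarrow> q' \<in> colourings T (map swap_letter w) \<and>
    coloured_diagram p T ov lab ps C (snd q) \<and> C 0 = fst q \<and>
    coloured_diagram.semiarc_germs p T ps C S Z0 g h \<and> fst q' = h 0 (C 0) \<and>
    (\<forall>l<N. semiarc_step T (snd q') (map swap_letter w ! l) (h l (C l)) (h (Suc l) (C (Suc l))))"

lemma lower_colouring_exists:
  assumes B: "B > 0" "D \<subseteq> open_rect (- B) B (- B) B" and Z0: "Z0 \<in> open_rect (- B) B (- B) B - D"
    and q: "q \<in> colourings T w"
  shows "\<exists>q' C g h. lower_colouring (open_rect (- B) B (- B) B) Z0 q q' C g h"
proof -
  obtain a f where af: "(a, f) \<in> colourings T w" "q = (a, f)" using q by (cases q) blast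
  let ?S = "open_rect (- B) B (- B) B" and ?w = "map swap_letter w"
  let ?L = "crossing ` set ?w"
  obtain C where "f \<in> crossing ` set w \<rightarrow>\<^sub>E carrier T"
    and C: "C 0 = a" "C (length w) = a"
      "\<forall>i<length w. semiarc_step T f (w ! i) (C i) (C (Suc i))"
      "\<And>i. i \<le> length w \<Longrightarrow> C i \<in> carrier T"
    by (rule colourings_semiarcs[OF af(1)]) blast
  have cd: "coloured_diagram p T ov lab ps C f"
    by unfold_locales (use C in auto)
  interpret coloured_diagram p T ov lab ps C f by (rule cd)
  obtain g h where gh: "semiarc_germs ?S Z0 g h"
    using semiarc_germs_exist[OF B Z0] by blast
  note rules = gh open_open_rect B(2)
  \<comment> \<open>The over letter of the swapped code with label \<open>X\<close> is the under
    letter of \<open>w\<close>, and the lower colour at that position is the label colour.\<close>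
  define e where "e = (\<lambda>X. lower_colour h (THE m. m < N \<and> (\<exists>\<epsilon>. ?w ! m = Over X \<epsilon>)))"
  have uniq: "(THE m. m < N \<and> (\<exists>\<epsilon>. ?w ! m = Over X \<epsilon>)) = m" if m: "m < N" "?w ! m = Over X \<epsilon>" for m X \<epsilon>
  proof (rule the_equality)
    show "m < N \<and> (\<exists>\<epsilon>. ?w ! m = Over X \<epsilon>)" using m by blast
    fix m' assume "m' < N \<and> (\<exists>\<epsilon>. ?w ! m' = Over X \<epsilon>)"
    then obtain \<epsilon>' where "m' < N" "?w ! m' = Over X \<epsilon>'" by blast
    then show "m' = m"
      using gauss_code_over_unique[OF gauss_code_swap[OF gauss], of m' m X \<epsilon>' \<epsilon>] m by simp
  qed
  have e: "e X = lower_colour h m" if "m < N" "w ! m = Under X \<epsilon>" for m X \<epsilon>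
    using uniq[of m X \<epsilon>] that by (simp add: e_def)
  define f' where "f' = restrict e ?L"
  have "f' X \<in> carrier T" if X: "X \<in> ?L" for X
  proof -
    obtain \<epsilon> where "Over X \<epsilon> \<in> set ?w"
      using gauss_codeE[OF gauss_code_swap[OF gauss] X] by metis
    then obtain m where m: "m < N" "?w ! m = Over X \<epsilon>" unfolding in_set_conv_nth by auto
    then have "e X = lower_colour h m" using uniq by (simp add: e_def)
    then show ?thesis using lower_colour_in[OF rules, of m] m(1) X by (simp add: f'_def)
  qed
  then have f': "f' \<in> ?L \<rightarrow>\<^sub>E carrier T" by (auto simp: f'_def)
  have steps: "semiarc_step T f' (?w ! l) (lower_colour h l) (lower_colour h (Suc l))" if l: "l < N" for l
  proof -
    have "crossing (?w ! l) \<in> ?L" by (rule imageI, rule nth_mem) (use l in simp)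
    moreover have "semiarc_step T e (?w ! l) (lower_colour h l) (lower_colour h (Suc l))"
      using lower_colour_step[OF rules l e] l by simp
    ultimately show ?thesis by (cases "?w ! l") (auto simp: semiarc_step_def f'_def)
  qed
  have "lower_colour h N = lower_colour h 0"
    using germ_wrap[OF rules] C_closed by (simp add: lower_colour_def)
  then have "walk T f' ?w (lower_colour h 0) (lower_colour h 0)"
    unfolding walk_iff_semiarcs using steps by (intro exI[of _ "lower_colour h"]) simp
  then have "(lower_colour h 0, f') \<in> colourings T ?w"
    using f' lower_colour_in[OF rules, of 0] by (simp add: colourings_def)
  then have "lower_colouring ?S Z0 q (lower_colour h 0, f') C g h"
    using cd C(1) gh steps by (simp add: lower_colouring_def af(2) lower_colour_def)
  then show ?thesis by blast
qed

lemma card_colourings_le_lower: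
  assumes fin: "finite (carrier T)"
  shows "card (colourings T w) \<le> card (colourings T (map swap_letter w))"
proof -
  obtain B where B: "B > 0" "D \<subseteq> open_rect (- B) B (- B) B" using D_in_rect by blast
  let ?S = "open_rect (- B) B (- B) B" and ?w = "map swap_letter w"
  have "0 \<in> ?S" using B(1) by (simp add: open_rect_def)
  then have "?S - D \<noteq> {}" using dense_D[OF open_open_rect] by blast
  then obtain Z0 where Z0: "Z0 \<in> ?S - D" by blast
  let ?Q = "lower_colouring ?S Z0"
  obtain \<Phi> where \<Phi>: "\<And>q. q \<in> colourings T w \<Longrightarrow> \<exists>C g h. ?Q q (\<Phi> q) C g h"
    using lower_colouring_exists[OF B Z0] by metis
  have "inj_on \<Phi> (colourings T w)"
  proof (rule inj_onI)
    fix q1 q2 assume q: "q1 \<in> colourings T w" "q2 \<in> colourings T w" and e: "\<Phi> q1 = \<Phi> q2"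
    obtain C1 g1 h1 where 1: "?Q q1 (\<Phi> q1) C1 g1 h1" using \<Phi>[OF q(1)] by blast
    obtain C2 g2 h2 where 2: "?Q q2 (\<Phi> q1) C2 g2 h2" using \<Phi>[OF q(2)] e by metis
    note Q1 = 1[unfolded lower_colouring_def] and Q2 = 2[unfolded lower_colouring_def]
    have c1: "coloured_diagram p T ov lab ps C1 (snd q1)" and c2: "coloured_diagram p T ov lab ps C2 (snd q2)"
      and sg: "coloured_diagram.semiarc_germs p T ps C1 ?S Z0 g1 h1" "coloured_diagram.semiarc_germs p T ps C2 ?S Z0 g2 h2"
      using Q1 Q2 by blast+
    \<comment> \<open>The same lower colouring has the same base colour and the same steps, hence
      the same colours on all semi-arcs.\<close>
    have eqs: "h1 k (C1 k) = h2 k (C2 k)" if "k \<le> N" for k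
      by (rule semiarcs_unique[of N T "snd (\<Phi> q1)" ?w]) (use Q1 Q2 that in auto)
    have C: "C1 k = C2 k" if k: "k \<le> N" for k
      by (rule region_colourings_unique[OF c1 c2 open_open_rect connected_open_rect B(2) Z0 sg]) (auto intro: eqs k)
    have "fst q1 = fst q2" using Q1 Q2 C[of 0] by simp
    moreover have "snd q1 = snd q2"
    proof
      fix X
      have E: "snd q1 \<in> crossing ` set w \<rightarrow>\<^sub>E carrier T" "snd q2 \<in> crossing ` set w \<rightarrow>\<^sub>E carrier T"
        using q unfolding colourings_def by force+
      show "snd q1 X = snd q2 X"
      proof (cases "X \<in> crossing ` set w")
        case True
        obtain \<epsilon> where "Over X \<epsilon> \<in> set w" using gauss_codeE[OF gauss True] by metis
        then obtain m where m: "m < N" "w ! m = Over X \<epsilon>" unfolding in_set_conv_nth by auto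
        \<comment> \<open>A label colour is the colour of the semi-arc at the over letter, so it is
          recovered together with the semi-arc colours.\<close>
        have "snd q1 X = C1 m" "snd q2 X = C2 m"
          using coloured_diagram.C_step[OF c1 m(1)] coloured_diagram.C_step[OF c2 m(1)] m(2)
          by (simp_all only: m(2) semiarc_step_def letter.case)
        then show ?thesis using C[of m] m(1) by simp
      next
        case False
        then show ?thesis using E by (metis PiE_arb)
      qed
    qed
    ultimately show "q1 = q2" by (rule prod_eqI)
  qed
  moreover have "\<Phi> ` colourings T w \<subseteq> colourings T ?w" using \<Phi> by (auto simp: lower_colouring_def)
  moreover have "finite (colourings T ?w)"
  proof (rule finite_subset)
    show "colourings T ?w \<subseteq> carrier T \<times> (crossing ` set ?w \<rightarrow>\<^sub>E carrier T)"
      by (auto simp: colourings_def)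
    show "finite (carrier T \<times> (crossing ` set ?w \<rightarrow>\<^sub>E carrier T))"
      by (intro finite_cartesian_product fin finite_PiE) auto
  qed
  ultimately show ?thesis by (rule card_inj_on_le)
qed

end

section \<open>The diagram seen from below\<close>

lemma vertex_cnj: "p \<noteq> [] \<Longrightarrow> vertex (map cnj p) i = cnj (vertex p i)"
  by (simp add: vertex_def)

lemma edge_cnj: "p \<noteq> [] \<Longrightarrow> edge (map cnj p) i = cnj ` edge p i"
  unfolding edge_def vertex_cnj
  by (rule closed_segment_linear_image[OF bounded_linear.linear[OF bounded_linear_cnj]])

lemma inj_cnj: "inj cnj"
  by (auto simp: inj_def)

lemma regular_polygon_cnj: "regular_polygon p \<Longrightarrow> regular_polygon (map cnj p)"
proof -
  assume p: "regular_polygon p"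
  then have ne: "p \<noteq> []" by (auto simp: regular_polygon_def)
  have "cnj ` A \<inter> cnj ` B \<inter> cnj ` C = cnj ` (A \<inter> B \<inter> C)" for A B C
    by (simp add: image_Int[OF inj_cnj])
  then show ?thesis
    using p unfolding regular_polygon_def edge_cnj[OF ne] vertex_cnj[OF ne] inj_image_mem_iff[OF inj_cnj]
    by simp
qed

lemma passages_cnj: "p \<noteq> [] \<Longrightarrow> passages (map cnj p) = passages p"
  unfolding passages_def by (simp add: edge_cnj image_Int[OF inj_cnj, symmetric])

text \<open>Conjugation negates the determinant of two directions, and so does exchanging
  them.\<close>

lemma crossing_sign_cnj: "p \<noteq> [] \<Longrightarrow> crossing_sign (map cnj p) i j = crossing_sign p j i"
proof -
  assume "p \<noteq> []"
  moreover have "wedge (cnj a) (cnj b) = wedge b a" for a b by (simp add: wedge_def)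
  ultimately show ?thesis by (simp add: crossing_sign_wedge vertex_cnj flip: complex_cnj_diff)
qed

text \<open>Reflection reverses crossing signs and so does exchanging over and under; together they
  preserve the signs, as \<open>swap_letter\<close> does. Conjugation is an isometry and keeps the
  order of the passages, so the same list \<open>ps\<close> serves.\<close>

lemma (in diagram) mirror_diagram: "diagram (map cnj p) T (\<lambda>i j. ov j i) lab ps"
  and mirror_code: "map (passage_letter (map cnj p) (\<lambda>i j. ov j i) lab) ps = map swap_letter w"
proof -
  have ne: "p \<noteq> []" by simp
  interpret m: polygon "map cnj p" by unfold_locales (rule regular_polygon_cnj[OF regular])
  have letter: "passage_letter (map cnj p) (\<lambda>i j. ov j i) lab a = swap_letter (passage_letter p ov lab a)"
    if "a \<in> set ps" for a
  proof -
    obtain i j where a: "a = (i, j)" by force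
    then have "ov i j \<longleftrightarrow> \<not> ov j i" using ov that set_ps by blast
    then show ?thesis by (simp add: a passage_letter_def crossing_sign_cnj[OF ne])
  qed
  show code: "map (passage_letter (map cnj p) (\<lambda>i j. ov j i) lab) ps = map swap_letter w"
    using letter by simp
  have dp: "double_point (map cnj p) a = cnj (double_point p a)" if "a \<in> set ps" for a
  proof -
    obtain i j where a: "a = (i, j)" by force
    then have "(i, j) \<in> passages p" using that set_ps by simp
    then obtain s where s: "E i \<inter> E j = {pt i s}" by (rule passage_point)
    have "edge (map cnj p) i \<inter> edge (map cnj p) j = {cnj (pt i s)}"
      using s by (simp add: edge_cnj image_Int[OF inj_cnj, symmetric])
    then have "z \<in> edge (map cnj p) i \<inter> edge (map cnj p) j \<longleftrightarrow> z = cnj (pt i s)" for z by simp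
    then have "double_point (map cnj p) a = cnj (pt i s)"
      unfolding double_point_def a prod.case by (intro the_equality) auto
    then show ?thesis using double_point_eq[OF s] a by simp
  qed
  have dist: "dist (cnj x) (cnj y) = dist x y" for x y
    by (simp add: dist_norm flip: complex_cnj_diff)
  show "diagram (map cnj p) T (\<lambda>i j. ov j i) lab ps"
  proof unfold_locales
    show "ov j i \<longleftrightarrow> \<not> ov i j" if "(i, j) \<in> passages (map cnj p)" for i j
      using ov[OF passages_sym] that unfolding passages_cnj[OF ne] by blast
    show "set ps = passages (map cnj p)" using set_ps by (simp add: passages_cnj[OF ne])
    show "sorted_wrt (precedes (map cnj p)) ps"
      by (rule sorted_wrt_mono_rel[OF _ sorted_ps]) (simp add: precedes_def dp vertex_cnj[OF ne] dist)
    show "gauss_code (map (passage_letter (map cnj p) (\<lambda>i j. ov j i) lab) ps)"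
      unfolding code by (rule gauss_code_swap[OF gauss])
  qed
qed

lemma swap_letter_swap: "swap_letter (swap_letter l) = l"
  by (cases l) auto

lemma (in diagram) card_colourings_eq_lower:
  assumes "finite (carrier T)"
  shows "card (colourings T w) = card (colourings T (map swap_letter w))"
proof (rule antisym)
  show "card (colourings T w) \<le> card (colourings T (map swap_letter w))"
    by (rule card_colourings_le_lower[OF assms])
  from diagram.card_colourings_le_lower[OF mirror_diagram assms]
  show "card (colourings T (map swap_letter w)) \<le> card (colourings T w)"
    unfolding mirror_code by (simp add: o_def swap_letter_swap)
qed

section \<open>Realizable codes and the conclusion\<close>

lemma QD_realizable:
  assumes T: "quandle T" "finite (carrier T)" and g: "gauss_code x" and r: "realizable x"
  shows "QD T x = 0"
proof -
  obtain p ov ps lab m where kd: "knot_diagram p ov" and ps: "set ps = passages p" "sorted_wrt (precedes p) ps"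
    and x: "x = rotate m (map (passage_letter p ov lab) ps)"
    using r unfolding realizable_def diagram_code_def by blast
  have "mset (rotate m y) = mset y" for y :: code
    by (simp add: rotate_drop_take flip: mset_append) (metis append_take_drop_id mset_append union_commute)
  then have g': "gauss_code (map (passage_letter p ov lab) ps)"
    using g gauss_code_mset[of x "map (passage_letter p ov lab) ps"] unfolding x by blast
  interpret diagram p T ov lab ps
    by unfold_locales (use kd ps g' T in \<open>auto simp: knot_diagram_def\<close>)
  have "card (colourings T x) = card (colourings T (map swap_letter x))"
    using card_colourings_eq_lower[OF T(2)]
    by (simp add: x card_colourings_rotate rotate_map[symmetric] del: map_map)
  then show ?thesis using QD_colourings[OF g] by simp
qed

theorem corollary4:
  fixes K :: "code set" and D :: code
  assumes "K \<in> virtual_knots" and "D \<in> K"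
  shows "((\<exists>T :: 'a magma. quandle T \<and> finite (carrier T) \<and> QD T D \<noteq> 0) \<longrightarrow> \<not> classical K) \<and>
         ((\<exists>T :: 'a magma. quandle T \<and> finite (carrier T) \<and> QD T D \<noteq> 0) \<longrightarrow> K \<noteq> unknot)"
proof -
  obtain x where x: "K = virtual_isotopy `` {x}"
    using assms(1) unfolding virtual_knots_def quotient_def by blast
  have xD: "(x, D) \<in> virtual_isotopy" using assms(2) x by simp
  have "QD T D = 0" if T: "quandle T" "finite (carrier T)" and K: "classical K \<or> K = unknot" for T :: "'a magma"
  proof -
    interpret quandle_loc T by unfold_locales (rule T(1))
    from K show ?thesis
    proof
      assume "classical K"
      then obtain y where y: "y \<in> K" "realizable y" by (auto simp: classical_def)
      then have xy: "(x, y) \<in> virtual_isotopy" using x by simp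
      then have "QD T y = 0" by (intro QD_realizable[OF T _ y(2)]) (simp add: virtual_isotopy_def)
      then show ?thesis using QD_virtual_isotopy[OF xD] QD_virtual_isotopy[OF xy] by simp
    next
      assume "K = unknot"
      then have "([], D) \<in> virtual_isotopy" using assms(2) by (simp add: unknot_def)
      from QD_virtual_isotopy[OF this] have "QD T D = QD T []" by simp
      \<comment> \<open>The empty code equals its swapped code, so its two quandles
        coincide.\<close>
      also have "\<dots> = 0" by (simp add: QD_def lower_quandle_def)
      finally show ?thesis .
    qed
  qed
  then show ?thesis by blast
qed

end
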